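(* Consider the fixed compact convex body $$\Omega:=\left\{x\in\mathbb R^2:\bigl((|x_1|-2)_+\bigr)^4+\bigl((|x_2|-1)_+\bigr)^4\le1\right\},$$ where $s_+:=\max\{s,0\}$. Its boundary $M:=\partial\Omega$ is a $C^3$ curve which is a compact, connected, one-dimensional $C^2$ embedded submanifold of $\mathbb R^2$ without boundary, of positive reach, and contained in some closed ball. It contains straight edges and curved corners, with curvature bounded below by a positive constant on a closed portion of a curved corner. Fix $K$, $r$ and $\chi$ as in the context. For every fixed $\eta\in(0,1/3)$ there are constants $c,C,t_0>0$ such that, whenever $0<t<t_0$ and a finite observation set $\mathcal X_N\subset M$ satisfies $d_H(\mathcal X_N,M)\le\eta t$, the reconstruction $$A_{t,N}:=\mathrm{Conv}(t,\mathcal X_N),\qquad \Delta:=d_H(A_{t,N},M),$$ satisfies $$ct^2\le\Delta\le Ct^2$$ and $$\inf_{\kappa>0}W_2(\nu_{A_{t,N},\kappa},\pi_M)\ge ct\ge c\sqrt\Delta .$$ The constants are independent of $t$, $\mathcal X_N$ and $\kappa$. (By convention, $c$ may differ from one occurrence to the next.)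
   Context: $\|\cdot\|$ is the Euclidean norm on $\mathbb R^2$, $d_A(x):=\inf_{a\in A}\|x-a\|$, and $d_H$ is the Hausdorff distance between compact sets. The reach $\mathrm{Reach}(M)$ is the largest $\tau\ge0$ such that every point of $\{x:d_M(x)<\tau\}$ has a unique nearest point on $M$. Fix $\tau_0$ with $0<\tau_0\le\mathrm{Reach}(M)$, a point $z_0\in\mathbb R^2$ and $R_0>0$ with $M\subseteq\overline B(z_0,R_0)$, and a number $r$ with $0<2r<\tau_0$, and set $K:=\overline B(z_0,R_0+3r)$. The function $\chi:[0,\infty)\to[0,\infty)$ is a fixed nondecreasing $C^2$ function with $\chi(s)=s$ for $0\le s\le r^2$, $\chi(s)\ge r^2$ for $s\ge r^2$, $\chi(s)=\chi(4r^2)$ for $s\ge4r^2$, and $\sup_{s\ge0}|\chi'(s)|<\infty$. For a finite nonempty set $\sigma\subset\mathbb R^2$, $\mathrm{rad}(\sigma):=\inf_{z\in\mathbb R^2}\max_{x\in\sigma}\|x-z\|$. For a finite nonempty set $S\subset\mathbb R^2$ and $t\ge0$, $\mathrm{Conv}(t,S):=\bigcup\{\mathrm{conv}(\sigma):\varnothing\ne\sigma\subseteq S,\ \mathrm{rad}(\sigma)\le t\}$, where $\mathrm{conv}$ denotes the convex hull. The potential $g$ is a real-valued function that is $C^2$ on a neighborhood of $K$, with $\sup_K\|\nabla g\|$, $\sup_K\|\nabla^2 g\|_{\mathrm{op}}$ and $\sup_K g-\inf_K g$ finite. The target is the Gibbs law on $M$ $$\pi_M(dy):=\frac{e^{-g(y)}}{Z_M}\,\mathrm{Vol}_M(dy),\qquad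 Z_M:=\int_M e^{-g(y)}\,\mathrm{Vol}_M(dy),$$ where $\mathrm{Vol}_M$ is the Riemannian volume (here, arclength) on $M$. For a nonempty compact set $A\subset K$ and $\kappa>0$, $\nu_{A,\kappa}$ is the probability measure $$\nu_{A,\kappa}(dx):=\frac{\mathbf 1_K(x)}{Z_{A,\kappa}^K}\exp\Bigl\{-g(x)-\tfrac{\kappa}{2}\chi\bigl(d_A(x)^2\bigr)\Bigr\}\,dx,$$ with $Z_{A,\kappa}^K$ the normalizing constant. $W_2$ is the 2-Wasserstein distance with Euclidean cost on $\mathbb R^2$. *)

theory Defs
  imports "HOL-Analysis.Analysis"
begin

text \<open>Real-valued; meaningful for nonempty bounded sets (suprema of unbounded sets, and
  \<^const>\<open>infdist\<close> to the empty set, take junk values).\<close>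

definition hausdorff_dist :: "'a::metric_space set \<Rightarrow> 'a set \<Rightarrow> real" where
  "hausdorff_dist A B = max (SUP x\<in>A. infdist x B) (SUP y\<in>B. infdist y A)"

definition reach :: "'a::metric_space set \<Rightarrow> ereal" where
  "reach M = Sup {ereal \<tau> | \<tau>. 0 \<le> \<tau> \<and>
     (\<forall>x. infdist x M < \<tau> \<longrightarrow> (\<exists>!y. y \<in> M \<and> dist x y = infdist x M))}"

definition rad :: "'a::real_normed_vector set \<Rightarrow> real" where
  "rad \<sigma> = (INF z. Max ((\<lambda>x. norm (x - z)) ` \<sigma>))"

definition Conv :: "real \<Rightarrow> 'a::real_normed_vector set \<Rightarrow> 'a set" where
  "Conv t S = \<Union> {convex hull \<sigma> | \<sigma>. \<sigma> \<noteq> {} \<and> \<sigma> \<subseteq> S \<and> rad \<sigma> \<le> t}"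

definition regular_on :: "nat \<Rightarrow> real set \<Rightarrow> (real \<Rightarrow> real^2) \<Rightarrow> bool" where
  "regular_on k I \<gamma> \<longleftrightarrow>
     (\<exists>D :: nat \<Rightarrow> real \<Rightarrow> real^2. D 0 = \<gamma> \<and>
        (\<forall>i<k. \<forall>s\<in>I. (D i has_vector_derivative D (Suc i) s) (at s)) \<and>
        continuous_on I (D k)) \<and>
     (\<forall>s\<in>I. vector_derivative \<gamma> (at s) \<noteq> 0)"

text \<open>A closed curve is given by a function of period 1 on the whole line, so that the
  derivatives also match where the curve closes up.\<close>

definition closed_curve_param :: "nat \<Rightarrow> (real \<Rightarrow> real^2) \<Rightarrow> (real^2) set \<Rightarrow> bool" where
  "closed_curve_param k \<gamma> M \<longleftrightarrow>
     regular_on k UNIV \<gamma> \<and> (\<forall>s. \<gamma> (s + 1) = \<gamma> s) \<and> inj_on \<gamma> {0..<1} \<and> range \<gamma> = M"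

text \<open>Each point has a relatively open neighbourhood in \<open>M\<close> that is the homeomorphic image of an
  open interval under a regular \<open>C\<^sup>k\<close> parametrization, so there are neither self-contacts nor
  boundary points.\<close>

definition embedded_curve :: "nat \<Rightarrow> (real^2) set \<Rightarrow> bool" where
  "embedded_curve k M \<longleftrightarrow>
     (\<forall>p\<in>M. \<exists>U \<gamma> h a b. open U \<and> p \<in> U \<and> a < b \<and>
        regular_on k {a<..<b} \<gamma> \<and> homeomorphism {a<..<b} (M \<inter> U) \<gamma> h)"

definition curvature :: "(real \<Rightarrow> real^2) \<Rightarrow> real \<Rightarrow> real" where
  "curvature \<gamma> s =
     (let v = vector_derivative \<gamma> (at s);
          w = vector_derivative (\<lambda>u. vector_derivative \<gamma> (at u)) (at s)
      in \<bar>v$1 * w$2 - v$2 * w$1\<bar> / norm v ^ 3)"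

definition curve_measure :: "(real \<Rightarrow> real^2) \<Rightarrow> (real^2) measure" where
  "curve_measure \<gamma> =
     distr (density lborel (\<lambda>s. indicator {0..<1} s * ennreal (norm (vector_derivative \<gamma> (at s)))))
       borel \<gamma>"

text \<open>Only used for curves \<open>M\<close> that admit a regular closed parametrization; the choice of the
  parametrization is then irrelevant, see \<open>Vol_eq_curve_measure\<close> below.\<close>

definition Vol :: "(real^2) set \<Rightarrow> (real^2) measure" where
  "Vol M = curve_measure (SOME \<gamma>. closed_curve_param 1 \<gamma> M)"

lemma closed_curve_paramD:
  assumes "closed_curve_param 1 \<gamma> M"
  shows "continuous_on UNIV \<gamma>"
    and "(\<gamma> has_vector_derivative vector_derivative \<gamma> (at s)) (at s)"
    and "continuous_on UNIV (\<lambda>s. vector_derivative \<gamma> (at s))"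
    and "vector_derivative \<gamma> (at s) \<noteq> 0"
    and "inj_on \<gamma> {0..<1}" and "range \<gamma> = M" and "\<gamma> ` {0..<1} = M" and "\<gamma> 1 = \<gamma> 0"
proof -
  obtain D where D: "D 0 = \<gamma>" "\<And>s. (D 0 has_vector_derivative D (Suc 0) s) (at s)"
    "continuous_on UNIV (D 1)" and nz: "\<And>s. vector_derivative \<gamma> (at s) \<noteq> 0"
    and per: "\<And>s. \<gamma> (s + 1) = \<gamma> s" and inj: "inj_on \<gamma> {0..<1}" and ran: "range \<gamma> = M"
    using assms unfolding closed_curve_param_def regular_on_def by auto
  have eq: "vector_derivative \<gamma> (at s) = D 1 s" for s
    using D(2)[of s] by (simp add: D(1) vector_derivative_at)
  show der: "(\<gamma> has_vector_derivative vector_derivative \<gamma> (at s)) (at s)" for s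
    using D(2)[of s] D(1) eq by simp
  show "continuous_on UNIV (\<lambda>s. vector_derivative \<gamma> (at s))"
    using D(3) eq by simp
  show "continuous_on UNIV \<gamma>"
    using der by (auto intro!: continuous_at_imp_continuous_on has_vector_derivative_continuous)
  show "vector_derivative \<gamma> (at s) \<noteq> 0" by (rule nz)
  show "inj_on \<gamma> {0..<1}" "range \<gamma> = M" by fact+
  have pern: "\<gamma> (s + real n) = \<gamma> s" for s n
    by (induction n) (auto simp: per algebra_simps simp flip: per[of "s + real _"])
  have "\<gamma> (frac s) = \<gamma> s" for s
  proof (cases "\<lfloor>s\<rfloor> \<ge> 0")
    case True
    then have "s = frac s + real (nat \<lfloor>s\<rfloor>)" by (simp add: frac_def)
    then show ?thesis using pern by metis
  next
    case False
    then have "frac s = s + real (nat (- \<lfloor>s\<rfloor>))" by (simp add: frac_def)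
    then show ?thesis using pern by metis
  qed
  then have "\<gamma> s \<in> \<gamma> ` {0..<1}" for s
    by (metis atLeastLessThan_iff frac_ge_0 frac_lt_1 imageI)
  then show "\<gamma> ` {0..<1} = M" using ran by auto
  show "\<gamma> 1 = \<gamma> 0" using per[of 0] by simp
qed

lemma emeasure_curve_measure:
  fixes p :: "real^2"
  assumes \<gamma>: "closed_curve_param 1 \<gamma> M" and B: "B \<in> sets borel"
  defines "J \<equiv> {s\<in>{0<..<1}. \<gamma> s \<noteq> p}"
    and "F \<equiv> (\<lambda>s. norm (vector_derivative \<gamma> (at s)) * indicator B (\<gamma> s))"
  shows "F absolutely_integrable_on J"
    and "emeasure (curve_measure \<gamma>) B = ennreal (integral J F)"
proof -
  note [measurable] = B
  have [measurable]: "\<gamma> \<in> borel_measurable borel"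
    "(\<lambda>s. vector_derivative \<gamma> (at s)) \<in> borel_measurable borel"
    using closed_curve_paramD(1,3)[OF \<gamma>] by (auto intro: borel_measurable_continuous_onI)
  have F[measurable]: "F \<in> borel_measurable borel"
    unfolding F_def by measurable
  have J[measurable]: "J \<in> sets borel" unfolding J_def by measurable
  have "compact ((\<lambda>s. vector_derivative \<gamma> (at s)) ` {0..1})"
    using closed_curve_paramD(3)[OF \<gamma>]
    by (intro compact_continuous_image) (auto intro: continuous_on_subset)
  then have "bounded ((\<lambda>s. vector_derivative \<gamma> (at s)) ` {0..1})"
    by (rule compact_imp_bounded)
  then obtain C where C: "\<And>s. s \<in> {0..1} \<Longrightarrow> norm (vector_derivative \<gamma> (at s)) \<le> C"
    unfolding bounded_iff by blast
  then have C0: "0 \<le> C" using norm_ge_zero order_trans atLeastAtMost_iff zero_le_one order_refl by metis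
  have "set_integrable lborel J F"
    unfolding set_integrable_def
  proof (rule Bochner_Integration.integrable_bound)
    show "integrable lborel (\<lambda>s::real. indicator {0..1} s * C)" by simp
    show "(\<lambda>s. indicator J s *\<^sub>R F s) \<in> borel_measurable lborel" by measurable
    show "AE s in lborel. norm (indicat_real J s *\<^sub>R F s) \<le> norm (indicat_real {0..1} s * C)"
      using C C0 by (auto simp: J_def F_def indicator_def)
  qed
  then have int: "integrable lborel (\<lambda>s. indicator J s *\<^sub>R F s)" "(LINT s:J|lborel. F s) = integral J F"
    "F integrable_on J"
    using set_borel_integral_eq_integral[of J F] by (auto simp: set_integrable_def)
  show "F absolutely_integrable_on J"
    using \<open>set_integrable lborel J F\<close> by (simp add: set_integrable_def integrable_completion)
  have "\<exists>q. {s\<in>{0..<1}. \<gamma> s = p} \<subseteq> {q}"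
  proof (cases "{s\<in>{0..<1}. \<gamma> s = p} = {}")
    case False
    then obtain q where "q \<in> {0..<1}" "\<gamma> q = p" by blast
    then have "{s\<in>{0..<1}. \<gamma> s = p} \<subseteq> {q}"
      using inj_onD[OF closed_curve_paramD(5)[OF \<gamma>]] by blast
    then show ?thesis by blast
  next
    case True
    then show ?thesis by (metis empty_subsetI)
  qed
  then obtain q where q: "{s\<in>{0..<1}. \<gamma> s = p} \<subseteq> {q}" by blast
  have "AE s in lborel. s \<notin> {0, q}"
    by (intro AE_not_in finite_imp_null_set_lborel) auto
  then have ae: "AE s in lborel. indicator {0..<1} s * ennreal (norm (vector_derivative \<gamma> (at s))) *
      indicator (\<gamma> -` B) s = ennreal (indicator J s *\<^sub>R F s)"
    by (rule AE_mp) (use q in \<open>auto simp: J_def F_def indicator_def intro!: AE_I2\<close>)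
  have vB: "\<gamma> -` B \<in> sets borel"
    using measurable_sets[of \<gamma> borel borel B] B by simp
  have "emeasure (curve_measure \<gamma>) B =
      (\<integral>\<^sup>+s. indicator {0..<1} s * ennreal (norm (vector_derivative \<gamma> (at s))) *
        indicator (\<gamma> -` B) s \<partial>lborel)"
    unfolding curve_measure_def
    by (subst emeasure_distr, measurable, subst emeasure_density) (use vB in auto)
  also have "\<dots> = (\<integral>\<^sup>+s. ennreal (indicator J s *\<^sub>R F s) \<partial>lborel)"
    by (rule nn_integral_cong_AE[OF ae])
  also have "\<dots> = ennreal (LINT s:J|lborel. F s)"
    unfolding set_lebesgue_integral_def
    by (rule nn_integral_eq_integral[OF int(1)]) (auto simp: F_def)
  finally show "emeasure (curve_measure \<gamma>) B = ennreal (integral J F)" by (simp add: int)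
qed

lemma curve_measure_unique:
  assumes \<gamma>: "closed_curve_param 1 \<gamma> M" and \<delta>: "closed_curve_param 1 \<delta> M"
  shows "curve_measure \<gamma> = curve_measure \<delta>"
proof -
  define I where "I = {s\<in>{0<..<1::real}. \<delta> s \<noteq> \<gamma> 0}"
  define J where "J = {u\<in>{0<..<1::real}. \<gamma> u \<noteq> \<delta> 0}"
  note g = closed_curve_paramD[OF \<gamma>] and d = closed_curve_paramD[OF \<delta>]
  define \<psi> where "\<psi> = the_inv_into {0..<1} \<gamma> \<circ> \<delta>"
  have g\<psi>: "\<gamma> (\<psi> s) = \<delta> s" for s
    unfolding \<psi>_def o_def by (rule f_the_inv_into_f[OF g(5)]) (use g(7) d(6) in auto)
  have \<psi>in: "\<psi> s \<in> {0..<1}" for s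
    unfolding \<psi>_def o_def by (rule the_inv_into_into[OF g(5)]) (use g(7) d(6) in auto)
  have \<psi>eq: "\<psi> s = u" if "u \<in> {0..<1}" "\<gamma> u = \<delta> s" for u s
    using that g\<psi>[of s] \<psi>in[of s] inj_onD[OF g(5), of "\<psi> s" u] by auto
  have \<psi>J: "\<psi> s \<in> J" if "s \<in> I" for s
  proof -
    have "\<psi> s \<noteq> 0" using g\<psi>[of s] that by (auto simp: I_def)
    moreover have "\<gamma> (\<psi> s) \<noteq> \<delta> 0"
      using that inj_onD[OF d(5), of s 0] unfolding g\<psi> by (auto simp: I_def)
    ultimately show ?thesis using \<psi>in[of s] by (auto simp: J_def)
  qed
  have img: "\<psi> ` I = J"
  proof
    show "\<psi> ` I \<subseteq> J" using \<psi>J by auto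
    show "J \<subseteq> \<psi> ` I"
    proof
      fix u assume u: "u \<in> J"
      have "\<gamma> u \<in> \<delta> ` {0..<1}" using d(7) g(6) by auto
      then obtain s where s: "s \<in> {0..<1}" "\<gamma> u = \<delta> s" by auto
      have "s \<noteq> 0" using u s by (auto simp: J_def)
      moreover have "\<delta> s \<noteq> \<gamma> 0" using u inj_onD[OF g(5), of u 0] unfolding s(2)[symmetric]
        by (auto simp: J_def)
      ultimately have "s \<in> I" using s by (auto simp: I_def)
      moreover have "\<psi> s = u" using \<psi>eq[of u s] u s by (auto simp: J_def)
      ultimately show "u \<in> \<psi> ` I" by auto
    qed
  qed
  have inj: "inj_on \<psi> I"
  proof (rule inj_onI)
    fix s t assume st: "s \<in> I" "t \<in> I" "\<psi> s = \<psi> t"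
    then have "\<delta> s = \<delta> t" using g\<psi> by metis
    then show "s = t" using st inj_onD[OF d(5), of s t] by (auto simp: I_def)
  qed
  have "open I"
  proof -
    have "open (\<delta> -` (- {\<gamma> 0}))" by (intro open_vimage d(1)) auto
    moreover have "I = {0<..<1} \<inter> \<delta> -` (- {\<gamma> 0})" by (auto simp: I_def)
    ultimately show ?thesis by auto
  qed
  have cont: "continuous_on I \<psi>"
    unfolding continuous_on_closed_invariant
  proof (intro allI impI)
    fix C :: "real set" assume C: "closed C"
    have "compact (\<gamma> ` (C \<inter> {0..1}))"
      using C by (intro compact_continuous_image closed_Int_compact) (auto intro: continuous_on_subset[OF g(1)])
    then have "closed (\<delta> -` (\<gamma> ` (C \<inter> {0..1})))"
      by (intro closed_vimage d(1) compact_imp_closed)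
    moreover have "\<delta> -` (\<gamma> ` (C \<inter> {0..1})) \<inter> I = \<psi> -` C \<inter> I"
    proof (intro equalityI subsetI)
      fix s assume s: "s \<in> \<delta> -` (\<gamma> ` (C \<inter> {0..1})) \<inter> I"
      then obtain u where u: "u \<in> C" "u \<in> {0..1}" "\<delta> s = \<gamma> u" by auto
      have "u \<noteq> 1" using u s g(8) by (auto simp: I_def)
      then have "\<psi> s = u" using u by (intro \<psi>eq) auto
      then show "s \<in> \<psi> -` C \<inter> I" using s u by auto
    next
      fix s assume s: "s \<in> \<psi> -` C \<inter> I"
      have "\<delta> s = \<gamma> (\<psi> s)" "\<psi> s \<in> C \<inter> {0..1}" using g\<psi>[of s] \<psi>in[of s] s by auto
      then show "s \<in> \<delta> -` (\<gamma> ` (C \<inter> {0..1})) \<inter> I" using s by auto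
    qed
    ultimately show "\<exists>A. closed A \<and> A \<inter> I = \<psi> -` C \<inter> I" by blast
  qed
  define \<psi>' where "\<psi>' s = (vector_derivative \<gamma> (at (\<psi> s)) \<bullet> vector_derivative \<delta> (at s)) /
      (norm (vector_derivative \<gamma> (at (\<psi> s))))\<^sup>2" for s
  have der: "(\<psi> has_real_derivative \<psi>' s) (at s)" if s: "s \<in> I" for s
  proof -
    define v where "v = vector_derivative \<gamma> (at (\<psi> s))"
    have v: "v \<noteq> 0" unfolding v_def by (rule g(4))
    have "((\<lambda>u. v \<bullet> \<gamma> u) has_real_derivative v \<bullet> v) (at (\<psi> s))"
      using bounded_linear.has_vector_derivative[OF bounded_linear_inner_right g(2)[of "\<psi> s"]]
      by (simp add: has_real_derivative_iff_has_vector_derivative v_def)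
    then obtain q where q: "\<And>z. v \<bullet> \<gamma> z - v \<bullet> \<gamma> (\<psi> s) = q z * (z - \<psi> s)"
      "isCont q (\<psi> s)" "q (\<psi> s) = v \<bullet> v"
      unfolding CARAT_DERIV by blast
    have "isCont \<psi> s" using cont \<open>open I\<close> s by (simp add: continuous_on_eq_continuous_at)
    then have lim: "((\<lambda>z. q (\<psi> z)) \<longlongrightarrow> v \<bullet> v) (at s)"
      using isCont_o2[of s \<psi> q] q(2,3) by (simp add: isCont_def)
    have "((\<lambda>u. v \<bullet> \<delta> u) has_real_derivative v \<bullet> vector_derivative \<delta> (at s)) (at s)"
      using bounded_linear.has_vector_derivative[OF bounded_linear_inner_right d(2)[of s]]
      by (simp add: has_real_derivative_iff_has_vector_derivative)
    then have "((\<lambda>z. (v \<bullet> \<delta> z - v \<bullet> \<delta> s) / (z - s)) \<longlongrightarrow> v \<bullet> vector_derivative \<delta> (at s)) (at s)"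
      by (simp add: has_field_derivative_iff)
    then have "((\<lambda>z. ((v \<bullet> \<delta> z - v \<bullet> \<delta> s) / (z - s)) / q (\<psi> z)) \<longlongrightarrow>
        (v \<bullet> vector_derivative \<delta> (at s)) / (v \<bullet> v)) (at s)"
      using lim v by (intro tendsto_divide) auto
    moreover have "eventually (\<lambda>z. q (\<psi> z) \<noteq> 0) (at s)"
      using lim v by (intro tendsto_imp_eventually_ne) auto
    then have "eventually (\<lambda>z. ((v \<bullet> \<delta> z - v \<bullet> \<delta> s) / (z - s)) / q (\<psi> z) = (\<psi> z - \<psi> s) / (z - s)) (at s)"
    proof eventually_elim
      case (elim z)
      have "v \<bullet> \<delta> z - v \<bullet> \<delta> s = q (\<psi> z) * (\<psi> z - \<psi> s)"
        using q(1)[of "\<psi> z"] by (simp add: g\<psi>)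
      then show ?case using elim by simp
    qed
    ultimately have "((\<lambda>z. (\<psi> z - \<psi> s) / (z - s)) \<longlongrightarrow> (v \<bullet> vector_derivative \<delta> (at s)) / (v \<bullet> v)) (at s)"
      by (rule Lim_transform_eventually)
    then show ?thesis
      by (simp add: has_field_derivative_iff \<psi>'_def v_def power2_norm_eq_inner)
  qed
  have speed: "\<bar>\<psi>' s\<bar> * norm (vector_derivative \<gamma> (at (\<psi> s))) = norm (vector_derivative \<delta> (at s))"
    if s: "s \<in> I" for s
  proof -
    have "((\<gamma> \<circ> \<psi>) has_vector_derivative \<psi>' s *\<^sub>R vector_derivative \<gamma> (at (\<psi> s))) (at s)"
      using der[OF s] g(2)[of "\<psi> s"]
      by (intro vector_diff_chain_at) (auto simp: has_real_derivative_iff_has_vector_derivative)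
    moreover have "\<gamma> \<circ> \<psi> = \<delta>" using g\<psi> by auto
    ultimately have "vector_derivative \<delta> (at s) = \<psi>' s *\<^sub>R vector_derivative \<gamma> (at (\<psi> s))"
      using vector_derivative_at by metis
    then show ?thesis by simp
  qed
  show ?thesis
  proof (rule measure_eqI)
    show "sets (curve_measure \<gamma>) = sets (curve_measure \<delta>)" by (simp add: curve_measure_def)
    fix B assume "B \<in> sets (curve_measure \<gamma>)"
    then have B: "B \<in> sets borel" by (simp add: curve_measure_def)
    let ?F = "\<lambda>u. norm (vector_derivative \<gamma> (at u)) * indicator B (\<gamma> u) :: real"
    let ?G = "\<lambda>s. norm (vector_derivative \<delta> (at s)) * indicator B (\<delta> s) :: real"
    have F: "?F absolutely_integrable_on \<psi> ` I"
      using emeasure_curve_measure(1)[OF \<gamma> B, of "\<delta> 0"] img by (simp add: J_def)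
    have "I \<in> sets lebesgue" using \<open>open I\<close> by auto
    then have "integral I (\<lambda>s. \<bar>\<psi>' s\<bar> * ?F (\<psi> s)) = integral (\<psi> ` I) ?F"
      using has_absolute_integral_change_of_variables_1'[of I \<psi> \<psi>' ?F "integral (\<psi> ` I) ?F"]
        F inj der by (auto intro: has_field_derivative_at_within)
    also have "integral I (\<lambda>s. \<bar>\<psi>' s\<bar> * ?F (\<psi> s)) = integral I ?G"
      by (intro integral_cong) (auto simp: speed[symmetric] g\<psi>)
    finally have "integral I ?G = integral J ?F" by (simp add: img)
    then show "emeasure (curve_measure \<gamma>) B = emeasure (curve_measure \<delta>) B"
      using emeasure_curve_measure(2)[OF \<gamma> B, of "\<delta> 0"] emeasure_curve_measure(2)[OF \<delta> B, of "\<gamma> 0"]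
      by (simp add: I_def J_def)
  qed
qed

lemma Vol_eq_curve_measure:
  assumes "closed_curve_param 1 \<gamma> M"
  shows "Vol M = curve_measure \<gamma>"
  unfolding Vol_def by (rule curve_measure_unique[OF someI[of _ \<gamma>] assms]) (rule assms)

text \<open>The integrand is cut off by the indicator of \<open>S\<close> also inside the normalizing constant,
  since the potential \<open>V\<close> is only controlled on \<open>S\<close>.\<close>

definition gibbs :: "'a measure \<Rightarrow> 'a set \<Rightarrow> ('a \<Rightarrow> real) \<Rightarrow> 'a measure" where
  "gibbs \<mu> S V =
     density \<mu> (\<lambda>x. ennreal (indicator S x * exp (- V x) / (LINT y:S|\<mu>. exp (- V y))))"

definition target_law :: "(real^2 \<Rightarrow> real) \<Rightarrow> (real^2) set \<Rightarrow> (real^2) measure" where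
  "target_law g M = gibbs (Vol M) M g"

definition penalized_law ::
    "(real^2) set \<Rightarrow> (real^2 \<Rightarrow> real) \<Rightarrow> (real \<Rightarrow> real) \<Rightarrow> (real^2) set \<Rightarrow> real \<Rightarrow> (real^2) measure" where
  "penalized_law K g \<phi> A \<kappa> =
     gibbs lborel K (\<lambda>x. g x + \<kappa> / 2 * \<phi> ((infdist x A)\<^sup>2))"

definition couplings :: "'a measure \<Rightarrow> 'a measure \<Rightarrow> ('a \<times> 'a) measure set" where
  "couplings \<mu> \<nu> =
     {P. sets P = sets (\<mu> \<Otimes>\<^sub>M \<nu>) \<and> distr P \<mu> fst = \<mu> \<and> distr P \<nu> snd = \<nu>}"

text \<open>Real-valued; meaningful for probability measures with finite second moments.\<close>

definition W2 :: "'a::real_normed_vector measure \<Rightarrow> 'a measure \<Rightarrow> real" where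
  "W2 \<mu> \<nu> = sqrt (enn2real
     (INF P\<in>couplings \<mu> \<nu>. \<integral>\<^sup>+ (x, y). ennreal ((norm (x - y))\<^sup>2) \<partial>P))"

definition cutoff :: "real \<Rightarrow> (real \<Rightarrow> real) \<Rightarrow> bool" where
  "cutoff r \<phi> \<longleftrightarrow>
     (\<forall>s\<ge>0. 0 \<le> \<phi> s) \<and> mono_on {0..} \<phi> \<and>
     (\<exists>\<phi>' \<phi>''.
        (\<forall>s\<ge>0. (\<phi> has_real_derivative \<phi>' s) (at s within {0..})) \<and>
        (\<forall>s\<ge>0. (\<phi>' has_real_derivative \<phi>'' s) (at s within {0..})) \<and>
        continuous_on {0..} \<phi>'' \<and>
        bdd_above ((\<lambda>s. \<bar>\<phi>' s\<bar>) ` {0..})) \<and>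
     (\<forall>s. 0 \<le> s \<and> s \<le> r\<^sup>2 \<longrightarrow> \<phi> s = s) \<and>
     (\<forall>s\<ge>r\<^sup>2. r\<^sup>2 \<le> \<phi> s) \<and>
     (\<forall>s\<ge>4 * r\<^sup>2. \<phi> s = \<phi> (4 * r\<^sup>2))"

text \<open>\<open>G\<close> is the gradient and \<open>H\<close> the Hessian matrix of \<open>g\<close>.\<close>

definition potential :: "(real^2) set \<Rightarrow> (real^2 \<Rightarrow> real) \<Rightarrow> bool" where
  "potential K g \<longleftrightarrow>
     (\<exists>U (G :: real^2 \<Rightarrow> real^2) (H :: real^2 \<Rightarrow> real^2^2).
        open U \<and> K \<subseteq> U \<and>
        (\<forall>x\<in>U. (g has_derivative (\<lambda>h. G x \<bullet> h)) (at x)) \<and>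
        (\<forall>x\<in>U. (G has_derivative (\<lambda>h. H x *v h)) (at x)) \<and>
        continuous_on U H \<and>
        bdd_above ((\<lambda>x. norm (G x)) ` K) \<and>
        bdd_above ((\<lambda>x. onorm (\<lambda>h. H x *v h)) ` K) \<and>
        bdd_above (g ` K) \<and> bdd_below (g ` K))"

definition Omega :: "(real^2) set" where
  "Omega = {x. (max (\<bar>x$1\<bar> - 2) 0) ^ 4 + (max (\<bar>x$2\<bar> - 1) 0) ^ 4 \<le> 1}"

definition M\<^sub>\<Omega> :: "(real^2) set" where
  "M\<^sub>\<Omega> = frontier Omega"

end

theory Submission
  imports Defs "HOL-Probability.Probability"
begin

text \<open>Over a straight edge the reconstruction \<open>A\<close> is contained in the edge, whereas over a curved corner
  triangles of sample points give it a thickness of order \<open>t\<^sup>2\<close>, and not more. The penalized law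
  has Gaussian width \<open>s = \<kappa>\<^sup>-\<^sup>1\<^sup>/\<^sup>2\<close> across \<open>A\<close>, and one of two effects always costs a
  distance of order \<open>t\<close>. If \<open>s \<ge> \<lambda> t\<close>, the law spreads at a scale of at least \<open>t\<close> around an edge,
  which a bump function times the distance from the edge detects, because it vanishes on the curve. If
  \<open>s < \<lambda> t\<close>, a unit of edge carries mass \<open>\<surd>(2\<pi>) s\<close>, while a unit of corner carries at least
  \<open>\<surd>(2\<pi>) s + c t\<^sup>2\<close>; up to errors of order \<open>s (s + t) + t\<^sup>4\<close>, the relative excess is
  \<open>t\<^sup>2 / s \<ge> t\<close>. A combination of an edge bump and a corner bump with \<open>\<pi>\<^sub>M\<close>-mean zero detects this
  excess. In both cases the easy direction of Kantorovich duality for a Lipschitz test function yields the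
  lower bound on \<open>W\<^sub>2\<close>.\<close>

subsection \<open>The quartic defining function\<close>

text \<open>The normalizing constant \<open>V\<close> of the penalized law is never computed. If the
  edge bump has less than half of its target mean, the test with this bump alone bounds
  \<open>W2\<close> below by a constant; otherwise \<open>V\<close> is at most a constant times the
  mass over the edge, hence of order \<open>t\<close> once \<open>s \<le> \<beta> * t\<close>. This
  is what turns an excess mass of order \<open>t^2\<close> into a relative excess of order
  \<open>t\<close>.

  In the combination of mean zero the leading terms have to cancel exactly. Corner slices are
  vertical instead of normal, so a slope widens the Gaussian across the slice by the factor
  \<open>sqrt (1 + (dqt x)^2)\<close>. This is precisely the arclength density of the graph, so edge
  and corner both have leading mass \<open>sqrt (2 * pi) * s\<close> times the integral of their
  bump against the unnormalized target.

  The reach and the upper bounds of order \<open>t^2\<close> between hulls and curve come from one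
  convex function \<open>FF\<close> that equals 1 on the curve: from its tangent inequality, its
  quadratic upper bound and its growth along rays.\<close>

lemma quartic_tangent:
  fixes u v :: real
  shows "(max u 0)^4 + 4 * (max u 0)^3 * (v - u) \<le> (max v 0)^4"
proof (cases "u \<le> 0")
  case True then show ?thesis by (simp add: max_def)
next
  case u: False
  show ?thesis
  proof (cases "v \<le> 0")
    case True
    have "0 \<le> 3 * u^4 + 4 * u^3 * (-v)" using u True by (intro add_nonneg_nonneg mult_nonneg_nonneg) auto
    then show ?thesis using u True by (simp add: max_def algebra_simps power4_eq_xxxx power3_eq_cube)
  next
    case False
    have "v^4 - (u^4 + 4 * u^3 * (v - u)) = (v-u)^2 * ((v+u)^2 + 2 * u^2)" by algebra
    moreover have "0 \<le> (v-u)^2 * ((v+u)^2 + 2 * u^2)" by simp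
    ultimately have "0 \<le> v^4 - (u^4 + 4 * u^3 * (v - u))" by (simp only:)
    then show ?thesis using u False by (simp add: max_def)
  qed
qed

text \<open>The second derivative \<open>12 * u^2\<close> is at most 432 for \<open>u\<close> up to
  6, and half of it is 216. The range 6 covers \<open>u - a\<close> and \<open>- u - a\<close> for
  \<open>\<bar>u\<bar> \<le> 4\<close> and \<open>a \<le> 2\<close>.\<close>

lemma quartic_taylor:
  fixes u v :: real
  assumes "\<bar>u\<bar> \<le> 6" "\<bar>v\<bar> \<le> 6"
  shows "(max v 0)^4 \<le> (max u 0)^4 + 4 * (max u 0)^3 * (v - u) + 216 * (v - u)^2"
proof (cases "u \<le> 0")
  case u: True
  show ?thesis
  proof (cases "v \<le> 0")
    case True then show ?thesis using u by (simp add: max_def)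
  next
    case False
    have "v^4 = v^2 * v^2" by algebra
    also have "\<dots> \<le> 216 * (v-u)^2"
    proof (rule mult_mono)
      have "v^2 \<le> 6^2" using assms False by (intro power_mono) auto
      then show "v^2 \<le> 216" by simp
      show "v^2 \<le> (v-u)^2" using u False by (intro power_mono) auto
    qed auto
    finally show ?thesis using u False by (simp add: max_def)
  qed
next
  case u: False
  have u2: "u^2 \<le> 36" using power_mono[of u 6 2] u assms by simp
  show ?thesis
  proof (cases "v \<le> 0")
    case True
    have a: "u^2 * u^2 \<le> 36 * u^2" using u2 by (intro mult_right_mono) auto
    have b: "u^2 * (u * (-v)) \<le> 36 * (u * (-v))" using u2 u True by (intro mult_right_mono) (auto intro: mult_nonneg_nonpos)
    have c: "0 \<le> u * (-v)" "0 \<le> v^2" "0 \<le> u^2" using u True by (auto intro: mult_nonneg_nonpos)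
    have "u^4 + 4 * u^3 * (v - u) + 216 * (v - u)^2 = 216 * u^2 - 3 * (u^2*u^2) + 432 * (u*(-v)) - 4 * (u^2*(u*(-v))) + 216 * v^2"
      by algebra
    also have "\<dots> \<ge> 0" using a b c by linarith
    finally show ?thesis using u True by (simp add: max_def)
  next
    case False
    have v2: "v^2 \<le> 36" using power_mono[of v 6 2] assms False by simp
    have uv: "u * v \<le> 6 * 6" using assms u False by (intro mult_mono) auto
    have "v^4 - (u^4 + 4 * u^3 * (v - u)) = (v-u)^2 * (v^2 + 2 * (u * v) + 3 * u^2)" by algebra
    also have "\<dots> \<le> (v-u)^2 * 216" using u2 v2 uv by (intro mult_left_mono) auto
    finally show ?thesis using u False by (simp add: max_def)
  qed
qed

text \<open>For \<open>a \<ge> 0\<close> this is the fourth power of the positive part of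
  \<open>\<bar>u\<bar> - a\<close>; at most one summand is nonzero. Two one-sided powers keep the
  absolute value out of derivatives.\<close>

definition qq :: "real \<Rightarrow> real \<Rightarrow> real" where
  "qq a u = (max (u - a) 0)^4 + (max (- u - a) 0)^4"

definition dqq :: "real \<Rightarrow> real \<Rightarrow> real" where
  "dqq a u = 4 * (max (u - a) 0)^3 - 4 * (max (- u - a) 0)^3"

lemma qq_abs: "0 \<le> a \<Longrightarrow> qq a u = (max (\<bar>u\<bar> - a) 0)^4"
  by (cases "u \<ge> 0") (auto simp: qq_def max_def)

lemma qq_nonneg: "0 \<le> qq a u" by (simp add: qq_def)

lemma qq_tangent: "qq a u + dqq a u * (v - u) \<le> qq a v"
  using quartic_tangent[of "u - a" "v - a"] quartic_tangent[of "- u - a" "- v - a"]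
  by (simp add: qq_def dqq_def algebra_simps)

lemma qq_taylor:
  assumes "\<bar>u\<bar> \<le> 4" "\<bar>v\<bar> \<le> 4" "0 \<le> a" "a \<le> 2"
  shows "qq a v \<le> qq a u + dqq a u * (v - u) + 432 * (v - u)^2"
proof -
  have b: "\<bar>u - a\<bar> \<le> 6" "\<bar>v - a\<bar> \<le> 6" "\<bar>-u - a\<bar> \<le> 6" "\<bar>-v - a\<bar> \<le> 6"
    using assms unfolding abs_le_iff by linarith+
  have e: "(- v - a - (- u - a))^2 = (v - u)^2" "v - a - (u - a) = v - u" "- v - a - (- u - a) = -(v - u)"
    by (auto simp: power2_eq_square algebra_simps)
  have d: "dqq a u * (v - u) = 4 * (max (u - a) 0)^3 * (v - u) + 4 * (max (- u - a) 0)^3 * (- (v - u))"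
    unfolding dqq_def by algebra
  have add: "A + A' \<le> B + B' + (p + p') + 432 * y"
    if "A \<le> B + p + 216 * y" "A' \<le> B' + p' + 216 * y" for A A' B B' p p' y :: real
    using that by linarith
  show ?thesis
    using add[OF quartic_taylor[OF b(1,2), unfolded e power2_minus] quartic_taylor[OF b(3,4), unfolded e power2_minus]]
    unfolding qq_def d .
qed

lemma DERIV_pos_part_power:
  "((\<lambda>u::real. (max u 0)^(Suc (Suc n))) has_real_derivative real (Suc (Suc n)) * (max u 0)^(Suc n)) (at u)"
proof -
  consider "u > 0" | "u < 0" | "u = 0" by linarith
  then show ?thesis
  proof cases
    case 1
    have "((\<lambda>u::real. u^(Suc (Suc n))) has_real_derivative real (Suc (Suc n)) * u^(Suc n)) (at u)"
      using DERIV_pow[of "Suc (Suc n)" u] by simp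
    moreover have "eventually (\<lambda>x. x^(Suc (Suc n)) = (max x 0)^(Suc (Suc n))) (nhds u)"
      using eventually_nhds_in_open[of "{0<..}" u] 1 by (auto elim!: eventually_mono simp: max_def)
    ultimately show ?thesis using 1 by (subst DERIV_cong_ev[OF refl _ refl, symmetric]) (auto simp: max_def)
  next
    case 2
    have "((\<lambda>u::real. 0) has_real_derivative 0) (at u)" by simp
    moreover have "eventually (\<lambda>x. 0 = (max x 0)^(Suc (Suc n))) (nhds u)"
      using eventually_nhds_in_open[of "{..<0}" u] 2 by (auto elim!: eventually_mono simp: max_def)
    ultimately show ?thesis using 2
      by (subst DERIV_cong_ev[OF refl _ refl, of _ "\<lambda>_. 0"]) (auto simp: max_def elim!: eventually_mono)
  next
    case 3
    have "((\<lambda>h. (max h 0)^(Suc (Suc n)) / h) \<longlongrightarrow> (0::real)) (at 0)"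
    proof (rule Lim_null_comparison)
      have "((\<lambda>h::real. \<bar>h\<bar>^(Suc n)) \<longlongrightarrow> \<bar>0\<bar>^(Suc n)) (at 0)" by (intro tendsto_intros)
      then show "((\<lambda>h::real. \<bar>h\<bar>^(Suc n)) \<longlongrightarrow> 0) (at 0)" by simp
      have "norm ((max h 0)^(Suc (Suc n)) / h) \<le> \<bar>h\<bar>^(Suc n)" for h :: real
        by (cases "h \<le> 0") (auto simp: max_def abs_mult power_abs intro: mult_nonpos_nonneg)
      then show "eventually (\<lambda>h. norm ((max h 0)^(Suc (Suc n)) / h) \<le> \<bar>h\<bar>^(Suc n)) (at (0::real))"
        by simp
    qed
    then show ?thesis using 3 by (simp add: DERIV_def)
  qed
qed

lemma DERIV_qq: "(qq a has_real_derivative dqq a u) (at u)"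
proof -
  have *: "((\<lambda>u::real. (max u 0)^4) has_real_derivative 4 * (max v 0)^3) (at v)" for v
    using DERIV_pos_part_power[of 2 v] by (simp add: eval_nat_numeral)
  have 1: "((\<lambda>u. (max (u - a) 0)^4) has_real_derivative 4 * (max (u - a) 0)^3 * 1) (at u)"
    by (rule DERIV_chain2[OF *]) (auto intro!: derivative_eq_intros)
  have 2: "((\<lambda>u. (max (- u - a) 0)^4) has_real_derivative 4 * (max (- u - a) 0)^3 * (-1)) (at u)"
    by (rule DERIV_chain2[OF *]) (auto intro!: derivative_eq_intros)
  show ?thesis using DERIV_add[OF 1 2] by (simp add: qq_def[abs_def] dqq_def)
qed

lemma continuous_qq: "continuous_on S (qq a)"
  using DERIV_qq by (meson DERIV_continuous continuous_at_imp_continuous_on)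

section \<open>Planar coordinates and the convex function that defines the curve\<close>

abbreviation (input) pt :: "real \<Rightarrow> real \<Rightarrow> real^2" where "pt x y \<equiv> vector [x, y]"

lemma pt_components: "pt (x$1) (x$2) = x" by (simp add: vec_eq_iff forall_2)

lemma pt_eq_iff: "pt a b = pt c d \<longleftrightarrow> a = c \<and> b = d" by (auto simp: vec_eq_iff forall_2)

lemma inner2: "(x::real^2) \<bullet> y = x$1 * y$1 + x$2 * y$2" by (simp add: inner_vec_def sum_2)

lemma norm2: "norm (x::real^2) = sqrt ((x$1)^2 + (x$2)^2)"
  by (simp add: norm_eq_sqrt_inner inner2 power2_eq_square)

lemma norm2_sq: "(norm (x::real^2))^2 = (x$1)^2 + (x$2)^2"
  by (simp add: norm2)

lemma norm_le_abs_sum2: "norm (x::real^2) \<le> \<bar>x$1\<bar> + \<bar>x$2\<bar>"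
  using norm_le_l1_cart[of x] by (simp add: sum_2)

lemma pt_as_axis: "pt x y = x *\<^sub>R axis 1 1 + y *\<^sub>R axis 2 1"
  by (simp add: vec_eq_iff forall_2 axis_def)

lemma continuous_on_pt[continuous_intros]:
  "continuous_on S f \<Longrightarrow> continuous_on S g \<Longrightarrow> continuous_on S (\<lambda>s. pt (f s) (g s))"
  unfolding pt_as_axis by (intro continuous_intros)

text \<open>\<open>Omega\<close> is the sublevel set at level 1 and the curve is the level set;
  \<open>GF\<close> below is the gradient.\<close>

definition FF :: "real^2 \<Rightarrow> real" where "FF x = qq 2 (x$1) + qq 1 (x$2)"

definition GF :: "real^2 \<Rightarrow> real^2" where "GF x = pt (dqq 2 (x$1)) (dqq 1 (x$2))"

lemma FF_0: "FF 0 = 0" by (simp add: FF_def qq_def)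

lemma continuous_FF: "continuous_on S FF"
proof -
  have "continuous_on S (\<lambda>x::real^2. qq a (x$i))" for a i
    by (rule continuous_on_compose2[OF continuous_qq[of UNIV]]) (auto intro!: continuous_intros)
  then show ?thesis unfolding FF_def[abs_def] by (intro continuous_intros)
qed

lemma FF_tangent: "FF x + GF x \<bullet> (y - x) \<le> FF y"
  using qq_tangent[of 2 "x$1" "y$1"] qq_tangent[of 1 "x$2" "y$2"]
  by (simp add: FF_def GF_def inner2)

lemma FF_taylor:
  assumes "\<bar>x$1\<bar> \<le> 4" "\<bar>x$2\<bar> \<le> 4" "\<bar>y$1\<bar> \<le> 4" "\<bar>y$2\<bar> \<le> 4"
  shows "FF y \<le> FF x + GF x \<bullet> (y - x) + 432 * (norm (y - x))^2"
  using qq_taylor[of "x$1" "y$1" 2] qq_taylor[of "x$2" "y$2" 1] assms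
  by (simp add: FF_def GF_def inner2 norm2_sq)

lemma FF_convex: "convex_on UNIV FF"
proof (rule convex_onI)
  fix t :: real and x y :: "real^2" assume t: "0 < t" "t < 1"
  let ?z = "(1 - t) *\<^sub>R x + t *\<^sub>R y"
  have e: "x - ?z = t *\<^sub>R (x - y)" "y - ?z = - (1 - t) *\<^sub>R (x - y)" by (simp_all add: algebra_simps)
  have "(1-t) * (FF ?z + GF ?z \<bullet> (x - ?z)) + t * (FF ?z + GF ?z \<bullet> (y - ?z)) \<le> (1 - t) * FF x + t * FF y"
    using t by (intro add_mono mult_left_mono FF_tangent) auto
  moreover have "(1-t) * (FF ?z + GF ?z \<bullet> (x - ?z)) + t * (FF ?z + GF ?z \<bullet> (y - ?z)) = FF ?z"
    unfolding e inner_scaleR_right by (simp add: left_diff_distrib right_diff_distrib distrib_left)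
  ultimately show "FF ?z \<le> (1 - t) * FF x + t * FF y" by simp
qed auto

text \<open>Convexity between 0 and \<open>x\<close>, with \<open>FF 0 = 0\<close>. With its
  counterpart for factors above 1 it makes every ray from the origin cross level 1 exactly once,
  which carries the radial projection and the polar parametrization.\<close>

lemma FF_scale_le:
  assumes "0 \<le> c" "c \<le> 1" shows "FF (c *\<^sub>R x) \<le> c * FF x"
  using convex_onD[OF FF_convex, of c 0 x] assms by (simp add: FF_0)

lemma FF_scale_ge:
  assumes "1 \<le> c" shows "c * FF x \<le> FF (c *\<^sub>R x)"
  using FF_scale_le[of "1/c" "c *\<^sub>R x"] assms by (simp add: field_simps)

lemma Omega_eq: "Omega = {x. FF x \<le> 1}"
  by (simp add: Omega_def FF_def qq_abs)

lemma FF_le1_bounds: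
  assumes "FF x \<le> 1" shows "\<bar>x$1\<bar> \<le> 3" "\<bar>x$2\<bar> \<le> 2"
proof -
  have *: "u \<le> 1" if "(max u 0)^4 \<le> (1::real)" for u
    using power_mono_iff[of "max u 0" 1 4] that by (auto simp: max_def split: if_splits)
  have "(max (\<bar>x$1\<bar> - 2) 0)^4 \<le> 1" "(max (\<bar>x$2\<bar> - 1) 0)^4 \<le> 1"
    using assms by (auto simp: FF_def qq_abs intro: order_trans[rotated])
  from this[THEN *] show "\<bar>x$1\<bar> \<le> 3" "\<bar>x$2\<bar> \<le> 2" by auto
qed

lemma FF_le1_norm: "FF x \<le> 1 \<Longrightarrow> norm x \<le> 4"
proof -
  assume F: "FF x \<le> 1"
  have "(x$1)^2 \<le> 3^2" "(x$2)^2 \<le> 2^2"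
    using FF_le1_bounds[OF F] by (subst power2_le_iff_abs_le; simp)+
  then have "(norm x)^2 \<le> 4^2" by (simp add: norm2_sq)
  then show ?thesis by (rule power2_le_imp_le) simp
qed

lemma compact_Omega: "compact Omega"
proof -
  have "closed Omega" unfolding Omega_eq by (intro closed_Collect_le continuous_FF continuous_intros)
  moreover have "bounded Omega" unfolding Omega_eq bounded_iff using FF_le1_norm by blast
  ultimately show ?thesis by (simp add: compact_eq_bounded_closed)
qed

lemma convex_Omega: "convex Omega"
proof (rule convexI)
  fix x y and u v :: real assume h: "x \<in> Omega" "y \<in> Omega" "0 \<le> u" "0 \<le> v" "u + v = 1"
  have "FF (u *\<^sub>R x + v *\<^sub>R y) \<le> u * FF x + v * FF y"
    using convex_onD[OF FF_convex, of v x y] h by (simp add: eq_diff_eq[symmetric])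
  also have "\<dots> \<le> u * 1 + v * 1" using h by (intro add_mono mult_left_mono) (auto simp: Omega_eq)
  finally show "u *\<^sub>R x + v *\<^sub>R y \<in> Omega" using h by (simp add: Omega_eq)
qed

text \<open>A point of level 1 cannot be interior: scaling it by \<open>1 + d\<close> raises the
  value to at least \<open>1 + d\<close>, while it moves the point only by
  \<open>d * norm x\<close>.\<close>

lemma interior_Omega: "interior Omega = {x. FF x < 1}"
proof (intro equalityI subsetI)
  fix x assume x: "x \<in> interior Omega"
  show "x \<in> {x. FF x < 1}"
  proof (rule ccontr)
    assume "x \<notin> {x. FF x < 1}"
    then have F1: "FF x = 1" using x interior_subset[of Omega] by (force simp: Omega_eq)
    obtain e where e: "e > 0" "ball x e \<subseteq> Omega" using x mem_interior by blast
    define d where "d = e / (2 * (norm x + 1))"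
    have d: "d > 0" using e by (simp add: d_def add_nonneg_pos)
    have "d * norm x \<le> d * (norm x + 1)" using d by simp
    also have "\<dots> = e / 2" using norm_ge_zero[of x] unfolding d_def by (simp add: field_simps add_nonneg_eq_0_iff)
    finally have "d * norm x \<le> e / 2" .
    then have "(1 + d) *\<^sub>R x \<in> ball x e" using e d by (simp add: dist_norm scaleR_add_left)
    then have "FF ((1+d) *\<^sub>R x) \<le> 1" using e by (auto simp: Omega_eq)
    then show False using FF_scale_ge[of "1+d" x] F1 d by simp
  qed
next
  fix x assume "x \<in> {x. FF x < 1}"
  moreover have "open {x. FF x < 1}" by (intro open_Collect_less continuous_FF continuous_intros)
  ultimately show "x \<in> interior Omega" by (intro interiorI[of "{x. FF x < 1}"]) (auto simp: Omega_eq)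
qed

lemma M_eq: "M\<^sub>\<Omega> = {x. FF x = 1}"
proof -
  have "closed Omega" using compact_Omega compact_imp_closed by blast
  then have "M\<^sub>\<Omega> = Omega - {x. FF x < 1}" by (simp add: M\<^sub>\<Omega>_def frontier_def interior_Omega)
  also have "\<dots> = {x. FF x = 1}" unfolding Omega_eq set_eq_iff Diff_iff mem_Collect_eq by (intro allI iffI) linarith+
  finally show ?thesis .
qed

lemma compact_M: "compact M\<^sub>\<Omega>"
  unfolding M\<^sub>\<Omega>_def by (intro compact_frontier compact_Omega)

lemma M_bounds: assumes "x \<in> M\<^sub>\<Omega>" shows "\<bar>x$1\<bar> \<le> 3" "\<bar>x$2\<bar> \<le> 2" "norm x \<le> 4"
proof -
  have F: "FF x \<le> 1" using assms by (simp add: M_eq)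
  show "\<bar>x$1\<bar> \<le> 3" by (rule FF_le1_bounds(1)[OF F])
  show "\<bar>x$2\<bar> \<le> 2" by (rule FF_le1_bounds(2)[OF F])
  show "norm x \<le> 4" by (rule FF_le1_norm[OF F])
qed

text \<open>On the ray through \<open>a\<close>, level 1 is attained at a factor between 1 and
  \<open>1 / FF a\<close>, because \<open>FF\<close> grows at least linearly there. This factor
  differs from 1 by at most \<open>2 * e\<close>, and \<open>norm a \<le> 8\<close> gives the
  constant 16.\<close>

lemma radial_projection:
  assumes "\<bar>FF a - 1\<bar> \<le> e" "e \<le> 1/2" "norm a \<le> 8"
  shows "\<exists>y\<in>M\<^sub>\<Omega>. dist a y \<le> 16 * e"
proof -
  have Fa: "FF a \<ge> 1/2" using assms by linarith
  have cont: "continuous_on S (\<lambda>c. FF (c *\<^sub>R a))" for S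
    by (rule continuous_on_compose2[OF continuous_FF[of UNIV]]) (auto intro!: continuous_intros)
  have inv: "\<bar>1 / FF a - 1\<bar> \<le> 2 * e"
  proof -
    have "1 / FF a - 1 = (1 - FF a) / FF a" using Fa by (simp add: field_simps)
    then have "\<bar>1 / FF a - 1\<bar> = \<bar>1 - FF a\<bar> / FF a" using Fa by simp
    also have "\<dots> \<le> e / (1/2)" using Fa assms(1) by (intro frac_le) auto
    finally show ?thesis by simp
  qed
  have "\<exists>c. \<bar>c - 1\<bar> \<le> 2 * e \<and> FF (c *\<^sub>R a) = 1"
  proof (cases "FF a \<le> 1")
    case True
    then have le: "1 \<le> 1 / FF a" using Fa by simp
    obtain c where "1 \<le> c" "c \<le> 1 / FF a" "FF (c *\<^sub>R a) = 1"
      using IVT'[of "\<lambda>c. FF (c *\<^sub>R a)" 1 1 "1 / FF a", OF _ _ le cont] FF_scale_ge[OF le, of a] True Fa by auto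
    then show ?thesis using inv by (intro exI[of _ c]) (auto simp: abs_if split: if_splits)
  next
    case False
    then have le: "1 / FF a \<le> 1" using Fa by simp
    obtain c where "1 / FF a \<le> c" "c \<le> 1" "FF (c *\<^sub>R a) = 1"
      using IVT'[of "\<lambda>c. FF (c *\<^sub>R a)" "1 / FF a" 1 1, OF _ _ le cont] FF_scale_le[OF _ le, of a] False Fa by auto
    then show ?thesis using inv by (intro exI[of _ c]) (auto simp: abs_if split: if_splits)
  qed
  then obtain c where c: "\<bar>c - 1\<bar> \<le> 2 * e" "FF (c *\<^sub>R a) = 1" by blast
  have "dist a (c *\<^sub>R a) = \<bar>c - 1\<bar> * norm a"
    by (metis dist_commute dist_norm norm_scaleR scaleR_left_diff_distrib scaleR_one)
  also have "\<dots> \<le> (2 * e) * 8" using c assms by (intro mult_mono) auto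
  finally show ?thesis using c(2) by (intro bexI[of _ "c *\<^sub>R a"]) (auto simp: M_eq)
qed

text \<open>The tangent inequality at \<open>x\<close>, evaluated at the origin where
  \<open>FF\<close> vanishes. The curve is thus uniformly transversal to rays and the gradient stays
  away from 0.\<close>

lemma GF_lower: assumes "x \<in> M\<^sub>\<Omega>" shows "1 \<le> GF x \<bullet> x" "1/4 \<le> norm (GF x)"
proof -
  show 1: "1 \<le> GF x \<bullet> x" using FF_tangent[of x 0] assms by (simp add: FF_0 M_eq)
  have "1 \<le> norm (GF x) * norm x" using 1 Cauchy_Schwarz_ineq2[of "GF x" x] by linarith
  also have "\<dots> \<le> norm (GF x) * 4" using M_bounds(3)[OF assms] by (intro mult_left_mono) auto
  finally show "1/4 \<le> norm (GF x)" by simp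
qed

text \<open>Both points have level 1, so the tangent inequality bounds the inner product above by 0,
  and the Taylor bound does so from below. Unique nearest points and the distance from the curve to
  the hulls both rest on this.\<close>

lemma normal_quadratic:
  assumes "x \<in> M\<^sub>\<Omega>" "y \<in> M\<^sub>\<Omega>"
  shows "\<bar>GF x \<bullet> (y - x)\<bar> \<le> 432 * (norm (y - x))^2"
proof -
  have F: "FF x = 1" "FF y = 1" using assms by (auto simp: M_eq)
  have b: "\<bar>x$1\<bar> \<le> 4" "\<bar>x$2\<bar> \<le> 4" "\<bar>y$1\<bar> \<le> 4" "\<bar>y$2\<bar> \<le> 4"
    using M_bounds(1,2)[OF assms(1)] M_bounds(1,2)[OF assms(2)] by (auto elim: order_trans)
  have "0 \<le> 432 * (norm (y - x))^2" by simp
  then have "GF x \<bullet> (y - x) \<le> 432 * (norm (y - x))^2" "- (GF x \<bullet> (y - x)) \<le> 432 * (norm (y - x))^2"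
    using FF_taylor[OF b] FF_tangent[of x y] F by linarith+
  then show ?thesis by (simp only: abs_le_iff)
qed

lemma top_point_iff: "1 < y \<Longrightarrow> pt x y \<in> M\<^sub>\<Omega> \<longleftrightarrow> qq 2 x + (y - 1)^4 = 1"
  by (simp add: M_eq FF_def qq_abs max_def)

text \<open>Recursion through an existentially quantified derivative: closure under sums, products,
  inverses and composition becomes induction on \<open>k\<close>.\<close>

primrec Ck :: "nat \<Rightarrow> (real \<Rightarrow> real) \<Rightarrow> bool" where
  "Ck 0 f \<longleftrightarrow> continuous_on UNIV f"
| "Ck (Suc k) f \<longleftrightarrow> (\<exists>f'. (\<forall>x. (f has_real_derivative f' x) (at x)) \<and> Ck k f')"

subsection \<open>Iterated differentiability\<close>

lemma Ck_SucI: "(\<And>x. (f has_real_derivative f' x) (at x)) \<Longrightarrow> Ck k f' \<Longrightarrow> Ck (Suc k) f"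
  by auto

lemma Ck_continuous: "Ck k f \<Longrightarrow> continuous_on UNIV f"
  by (cases k) (auto intro!: continuous_at_imp_continuous_on intro: DERIV_isCont)

lemma Ck_SucD: "Ck (Suc k) f \<Longrightarrow> Ck k f"
proof (induction k arbitrary: f)
  case 0
  then show ?case using Ck_continuous[of "Suc 0" f] by simp
next
  case (Suc k)
  then show ?case unfolding Ck.simps(2)[of "Suc k"] Ck.simps(2)[of k f] by blast
qed

lemma Ck_const: "Ck k (\<lambda>x. c)"
proof (induction k arbitrary: c)
  case (Suc k)
  show ?case by (rule Ck_SucI[OF _ Suc[of 0]]) simp
qed simp

lemma Ck_ident: "Ck k (\<lambda>x. x)"
proof (cases k)
  case (Suc j)
  show ?thesis unfolding Suc by (rule Ck_SucI[OF _ Ck_const[of j 1]]) simp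
qed simp

lemma Ck_add: "Ck k f \<Longrightarrow> Ck k g \<Longrightarrow> Ck k (\<lambda>x. f x + g x)"
proof (induction k arbitrary: f g)
  case 0 then show ?case by (auto intro: continuous_intros)
next
  case (Suc k)
  obtain f' g' where h: "\<And>x. (f has_real_derivative f' x) (at x)" "Ck k f'"
      "\<And>x. (g has_real_derivative g' x) (at x)" "Ck k g'" using Suc.prems by auto
  show ?case by (rule Ck_SucI[OF DERIV_add[OF h(1,3)] Suc.IH[OF h(2,4)]])
qed

lemma Ck_mult: "Ck k f \<Longrightarrow> Ck k g \<Longrightarrow> Ck k (\<lambda>x. f x * g x)"
proof (induction k arbitrary: f g)
  case 0 then show ?case by (auto intro: continuous_intros)
next
  case (Suc k)
  obtain f' g' where h: "\<And>x. (f has_real_derivative f' x) (at x)" "Ck k f'"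
      "\<And>x. (g has_real_derivative g' x) (at x)" "Ck k g'" using Suc.prems by auto
  have "Ck k (\<lambda>x. f' x * g x + g' x * f x)"
    by (intro Ck_add Suc.IH h Ck_SucD[OF Suc.prems(1)] Ck_SucD[OF Suc.prems(2)])
  then show ?case by (rule Ck_SucI[OF DERIV_mult[OF h(1,3)]])
qed

lemma Ck_uminus: "Ck k f \<Longrightarrow> Ck k (\<lambda>x. - f x)"
  using Ck_mult[OF Ck_const[of k "-1"], of f] by simp

lemma Ck_diff: "Ck k f \<Longrightarrow> Ck k g \<Longrightarrow> Ck k (\<lambda>x. f x - g x)"
  using Ck_add[OF _ Ck_uminus, of k f g] by simp

lemma Ck_inverse:
  assumes "\<And>x. f x \<noteq> 0" shows "Ck k f \<Longrightarrow> Ck k (\<lambda>x. inverse (f x))"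
proof (induction k)
  case 0 then show ?case using assms by (auto intro: continuous_intros)
next
  case (Suc k)
  obtain f' where h: "\<And>x. (f has_real_derivative f' x) (at x)" "Ck k f'" using Suc.prems by auto
  have "Ck k (\<lambda>x. - (inverse (f x) * f' x * inverse (f x)))"
    by (intro Ck_uminus Ck_mult Suc.IH h Ck_SucD[OF Suc.prems])
  then show ?case by (rule Ck_SucI[OF DERIV_inverse'[OF h(1) assms]])
qed

lemma Ck_compose: "Ck k f \<Longrightarrow> Ck k g \<Longrightarrow> Ck k (\<lambda>x. f (g x))"
proof (induction k arbitrary: f)
  case 0 then show ?case by (auto intro: continuous_on_compose2)
next
  case (Suc k)
  obtain f' g' where h: "\<And>x. (f has_real_derivative f' x) (at x)" "Ck k f'"
      "\<And>x. (g has_real_derivative g' x) (at x)" "Ck k g'" using Suc.prems by auto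
  have "Ck k (\<lambda>x. f' (g x) * g' x)" 
    by (rule Ck_mult[OF Suc.IH[OF h(2) Ck_SucD[OF Suc.prems(2)]] h(4)])
  then show ?case by (rule Ck_SucI[OF DERIV_chain2[OF h(1) h(3)]])
qed

lemma Ck_sin_cos: "Ck k sin \<and> Ck k cos"
proof (induction k)
  case 0 then show ?case by (auto intro!: continuous_intros)
next
  case (Suc k)
  have "Ck k cos" "Ck k (\<lambda>x. - sin x)" using Suc Ck_uminus[of k sin] by auto
  then show ?case using Ck_SucI[OF DERIV_sin] Ck_SucI[OF DERIV_cos] by blast
qed

text \<open>Each differentiation lowers the power by one, until the continuous function
  \<open>max u 0\<close> is left. For cubes this gives \<open>Ck 2\<close>, which is the regularity
  of the gradient \<open>GF\<close> and the source of the \<open>C^3\<close> curve.\<close>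

lemma Ck_pos_part_power: "Ck k (\<lambda>u. (max u 0)^(Suc k))"
proof (induction k)
  case 0 then show ?case by (auto intro!: continuous_intros)
next
  case (Suc k)
  have "Ck k (\<lambda>u. real (Suc (Suc k)) * (max u 0)^(Suc k))" by (intro Ck_mult Ck_const Suc)
  then show ?case by (rule Ck_SucI[OF DERIV_pos_part_power[of k]])
qed

lemma Ck_le: assumes "Ck k f" "j \<le> k" shows "Ck j f"
  using assms(2,1) by (induction rule: inc_induct) (blast intro: Ck_SucD)+

text \<open>Turns the recursive notion into the sequence of derivatives that
  \<open>regular_on\<close> asks for.\<close>

lemma Ck_derivative_sequence:
  "Ck k f \<Longrightarrow> \<exists>d. d 0 = f \<and> (\<forall>i<k. \<forall>x. (d i has_real_derivative d (Suc i) x) (at x)) \<and> continuous_on UNIV (d k)"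
proof (induction k arbitrary: f)
  case 0 then show ?case by (intro exI[of _ "\<lambda>_. f"]) auto
next
  case (Suc k)
  obtain f' where h: "\<And>x. (f has_real_derivative f' x) (at x)" "Ck k f'" using Suc.prems by auto
  obtain d where d: "d 0 = f'" "\<forall>i<k. \<forall>x. (d i has_real_derivative d (Suc i) x) (at x)" "continuous_on UNIV (d k)"
    using Suc.IH[OF h(2)] by blast
  show ?case
  proof (intro exI[of _ "case_nat f d"] conjI allI impI)
    fix i x assume "i < Suc k"
    then show "(case_nat f d i has_real_derivative case_nat f d (Suc i) x) (at x)"
      using h d by (cases i) auto
  qed (use d in auto)
qed

lemma Ck_dqq: "Ck 2 (dqq a)"
proof -
  have 1: "Ck 2 (\<lambda>u::real. (max u 0)^3)" using Ck_pos_part_power[of 2] by (simp add: eval_nat_numeral)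
  have 2: "Ck 2 (\<lambda>u. - u - a)" "Ck 2 (\<lambda>u. u - a)" by (intro Ck_diff Ck_uminus Ck_ident Ck_const)+
  have "Ck 2 (\<lambda>u. 4 * (max (u - a) 0)^3 - 4 * (max (- u - a) 0)^3)"
    by (intro Ck_diff Ck_mult Ck_const Ck_compose[OF 1 2(1)] Ck_compose[OF 1 2(2)])
  then show ?thesis by (simp add: dqq_def[abs_def])
qed

subsection \<open>The polar parametrization\<close>

text \<open>Angles are measured clockwise from the negative first axis, so that the upper arc of the curve
  lies inside one period of the parametrization.\<close>

definition dir :: "real \<Rightarrow> real^2" where "dir u = pt (- cos u) (sin u)"

lemma norm_dir: "norm (dir u) = 1" by (simp add: norm2 dir_def)

lemma FF_scale_gt1: "FF x = 1 \<Longrightarrow> 1 < c \<Longrightarrow> 1 < FF (c *\<^sub>R x)" using FF_scale_ge[of c x] by simp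

lemma FF_scale_lt1: "FF x = 1 \<Longrightarrow> 0 \<le> c \<Longrightarrow> c < 1 \<Longrightarrow> FF (c *\<^sub>R x) < 1" using FF_scale_le[of c x] by simp

lemma continuous_FF_scale: "continuous_on S (\<lambda>c. FF (c *\<^sub>R a))"
  by (rule continuous_on_compose2[OF continuous_FF[of UNIV]]) (auto intro!: continuous_intros)

definition radius :: "real \<Rightarrow> real" where "radius u = (THE c. 0 < c \<and> FF (c *\<^sub>R dir u) = 1)"

lemma radius_unique:
  assumes "0 < c" "FF (c *\<^sub>R x) = 1" "0 < d" "FF (d *\<^sub>R x) = 1" shows "c = d"
proof (rule ccontr)
  assume "c \<noteq> d"
  then consider "1 < d / c" | "1 < c / d" using assms(1,3) by (auto simp: neq_iff)
  then show False
    using FF_scale_gt1[OF assms(2), of "d/c"] FF_scale_gt1[OF assms(4), of "c/d"] assms by cases auto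
qed

lemma radius_ex: "\<exists>c. 0 < c \<and> FF (c *\<^sub>R dir u) = 1"
proof -
  \<comment> \<open>Points with \<open>FF x \<le> 1\<close> have norm at most 4, so the factor 5 is
    already outside.\<close>
  have "1 < FF (5 *\<^sub>R dir u)" using FF_le1_norm[of "5 *\<^sub>R dir u"] by (force simp: norm_dir)
  then obtain c where "0 \<le> c" "c \<le> 5" "FF (c *\<^sub>R dir u) = 1"
    using IVT'[of "\<lambda>c. FF (c *\<^sub>R dir u)" 0 1 5, OF _ _ _ continuous_FF_scale] by (auto simp: FF_0)
  moreover from this have "c \<noteq> 0" by (auto simp: FF_0)
  ultimately show ?thesis by (intro exI[of _ c]) auto
qed

lemma radius: "0 < radius u" "FF (radius u *\<^sub>R dir u) = 1"
proof -
  have "\<exists>!c. 0 < c \<and> FF (c *\<^sub>R dir u) = 1"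
    using radius_ex[of u] radius_unique[of _ "dir u"] by blast
  from theI'[OF this] show "0 < radius u" "FF (radius u *\<^sub>R dir u) = 1" by (auto simp: radius_def)
qed

lemma radius_eqI: "0 < c \<Longrightarrow> FF (c *\<^sub>R dir u) = 1 \<Longrightarrow> radius u = c"
  using radius_unique[of c "dir u" "radius u"] radius[of u] by simp

lemma radius_gt: assumes "0 \<le> c" "FF (c *\<^sub>R dir u) < 1" shows "c < radius u"
proof (rule ccontr)
  assume "\<not> c < radius u"
  then have "1 \<le> c / radius u" using radius(1)[of u] by simp
  from FF_scale_ge[OF this, of "radius u *\<^sub>R dir u"] have "c / radius u \<le> FF (c *\<^sub>R dir u)"
    using radius[of u] by simp
  then have "1 \<le> FF (c *\<^sub>R dir u)" using \<open>1 \<le> c / radius u\<close> by linarith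
  then show False using assms by simp
qed

lemma radius_lt: assumes "0 \<le> c" "1 < FF (c *\<^sub>R dir u)" shows "radius u < c"
proof (rule ccontr)
  assume "\<not> radius u < c"
  then have "0 \<le> c / radius u" "c / radius u \<le> 1" using radius(1)[of u] assms by auto
  from FF_scale_le[OF this, of "radius u *\<^sub>R dir u"] have "FF (c *\<^sub>R dir u) \<le> c / radius u"
    using radius[of u] by simp
  then have "FF (c *\<^sub>R dir u) \<le> 1" using \<open>c / radius u \<le> 1\<close> by linarith
  then show False using assms by simp
qed

text \<open>At the fixed factors \<open>radius u - e\<close> and \<open>radius u + e\<close> the
  value of \<open>FF\<close> is below and above 1. Both strict inequalities persist for nearby
  angles and enclose the radius there.\<close>

lemma isCont_radius: "isCont radius u"
  unfolding isCont_def tendsto_iff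
proof (intro allI impI)
  fix e' :: real assume "e' > 0"
  \<comment> \<open>The cap \<open>radius u / 2\<close> keeps the inner factor positive.\<close>
  define e where "e = min e' (radius u / 2)"
  have e: "0 < e" "e \<le> e'" "e < radius u" using \<open>e' > 0\<close> radius(1)[of u] by (auto simp: e_def)
  have c: "isCont (\<lambda>v. FF (c *\<^sub>R dir v)) u" for c
  proof -
    have "continuous_on UNIV (\<lambda>v. FF (c *\<^sub>R dir v))" unfolding dir_def
      by (rule continuous_on_compose2[OF continuous_FF[of UNIV]]) (auto intro!: continuous_intros)
    then show ?thesis by (simp add: continuous_on_eq_continuous_at)
  qed
  have "FF (((radius u - e) / radius u) *\<^sub>R radius u *\<^sub>R dir u) < 1"
    using e radius[of u] by (intro FF_scale_lt1) auto
  then have 1: "FF ((radius u - e) *\<^sub>R dir u) < 1" using radius(1)[of u] by simp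
  have "1 < FF (((radius u + e) / radius u) *\<^sub>R radius u *\<^sub>R dir u)"
    using e radius[of u] by (intro FF_scale_gt1) auto
  then have 2: "1 < FF ((radius u + e) *\<^sub>R dir u)" using radius(1)[of u] by simp
  have "eventually (\<lambda>v. FF ((radius u - e) *\<^sub>R dir v) < 1) (at u)"
    "eventually (\<lambda>v. 1 < FF ((radius u + e) *\<^sub>R dir v)) (at u)"
    using order_tendstoD(2)[OF c[of "radius u - e", unfolded isCont_def] 1]
      order_tendstoD(1)[OF c[of "radius u + e", unfolded isCont_def] 2] by auto
  then show "eventually (\<lambda>v. dist (radius v) (radius u) < e') (at u)"
  proof eventually_elim
    case (elim v)
    have "radius u - e < radius v" by (rule radius_gt) (use e elim in auto)
    moreover have "radius v < radius u + e" by (rule radius_lt) (use e elim radius(1)[of u] in auto)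
    ultimately show ?case using e by (simp add: dist_real_def)
  qed
qed

text \<open>The inner product of \<open>GF\<close> at the curve point with \<open>dir u\<close>,
  that is, the derivative of \<open>FF\<close> along the ray where it reaches level 1.\<close>

definition radial_slope :: "real \<Rightarrow> real" where
  "radial_slope u = sin u * dqq 1 (radius u * sin u) - cos u * dqq 2 (- (radius u * cos u))"

lemma radial_slope_pos: "0 < radial_slope u"
proof -
  have "radius u *\<^sub>R dir u \<in> M\<^sub>\<Omega>" using radius by (simp add: M_eq)
  from GF_lower(1)[OF this] have "1 \<le> radius u * radial_slope u"
    by (simp add: GF_def dir_def inner2 radial_slope_def algebra_simps)
  then show ?thesis using radius(1)[of u] by (smt (verit) mult_nonneg_nonpos)
qed

text \<open>The value that implicit differentiation of
  \<open>FF (radius u *\<^sub>R dir u) = 1\<close> predicts.\<close>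

definition radius' :: "real \<Rightarrow> real" where
  "radius' u = - (radius u * (sin u * dqq 2 (- (radius u * cos u)) + cos u * dqq 1 (radius u * sin u))
     * inverse (radial_slope u))"

text \<open>Implicit differentiation by hand. In Caratheodory's form the difference of the level
  equations at \<open>v\<close> and \<open>u\<close> is an exact identity, linear in
  \<open>radius v - radius u\<close> with coefficient \<open>D v\<close>; continuity of the radius
  sends \<open>D v\<close> to the positive radial slope, so one may divide.\<close>

lemma DERIV_radius: "(radius has_real_derivative radius' u) (at u)"
proof -
  let ?x = "\<lambda>v. - (radius v * cos v)" and ?y = "\<lambda>v. radius v * sin v"
  obtain a where a: "\<And>z. qq 2 z - qq 2 (?x u) = a z * (z - ?x u)" "isCont a (?x u)" "a (?x u) = dqq 2 (?x u)"
    using DERIV_qq[of 2 "?x u"] unfolding CARAT_DERIV by blast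
  obtain b where b: "\<And>z. qq 1 z - qq 1 (?y u) = b z * (z - ?y u)" "isCont b (?y u)" "b (?y u) = dqq 1 (?y u)"
    using DERIV_qq[of 1 "?y u"] unfolding CARAT_DERIV by blast
  have R: "(radius \<longlongrightarrow> radius u) (at u)" using isCont_radius by (simp add: isCont_def)
  have "isCont ?x u" "isCont ?y u" by (intro continuous_intros isCont_radius)+
  then have ca: "((\<lambda>v. a (?x v)) \<longlongrightarrow> dqq 2 (?x u)) (at u)" "((\<lambda>v. b (?y v)) \<longlongrightarrow> dqq 1 (?y u)) (at u)"
    using isCont_o2[of u ?x a] isCont_o2[of u ?y b] a b by (auto simp: isCont_def)
  define D where "D v = sin v * b (?y v) - cos v * a (?x v)" for v
  have D: "(D \<longlongrightarrow> radial_slope u) (at u)"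
    unfolding D_def radial_slope_def by (intro tendsto_intros ca)
  have key: "(radius v - radius u) * D v = radius u * (a (?x v) * (cos v - cos u) - b (?y v) * (sin v - sin u))" for v
  proof -
    have "FF (radius v *\<^sub>R dir v) - FF (radius u *\<^sub>R dir u) = 0" using radius by simp
    then have "a (?x v) * (?x v - ?x u) + b (?y v) * (?y v - ?y u) = 0"
      using a(1)[of "?x v"] b(1)[of "?y v"] by (simp add: FF_def dir_def)
    then show ?thesis unfolding D_def by algebra
  qed
  have q: "((\<lambda>v. (cos v - cos u) / (v - u)) \<longlongrightarrow> - sin u) (at u)" "((\<lambda>v. (sin v - sin u) / (v - u)) \<longlongrightarrow> cos u) (at u)"
    using DERIV_cos[of u] DERIV_sin[of u] by (auto simp: has_field_derivative_iff)
  have "((\<lambda>v. radius u * (a (?x v) * ((cos v - cos u) / (v - u)) - b (?y v) * ((sin v - sin u) / (v - u))) * inverse (D v))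
      \<longlongrightarrow> radius u * (dqq 2 (?x u) * (- sin u) - dqq 1 (?y u) * cos u) * inverse (radial_slope u)) (at u)"
    using radial_slope_pos[of u] by (intro tendsto_intros ca D q) auto
  moreover have "radius u * (dqq 2 (?x u) * (- sin u) - dqq 1 (?y u) * cos u) * inverse (radial_slope u) = radius' u"
    unfolding radius'_def by algebra
  moreover have "eventually (\<lambda>v. D v \<noteq> 0) (at u)"
    using D radial_slope_pos[of u] by (intro tendsto_imp_eventually_ne) auto
  then have "eventually (\<lambda>v. radius u * (a (?x v) * ((cos v - cos u) / (v - u)) - b (?y v) * ((sin v - sin u) / (v - u))) * inverse (D v)
     = (radius v - radius u) / (v - u)) (at u)"
  proof eventually_elim
    case (elim v)
    have "radius u * (a (?x v) * ((cos v - cos u) / (v - u)) - b (?y v) * ((sin v - sin u) / (v - u))) * inverse (D v)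
      = (radius u * (a (?x v) * (cos v - cos u) - b (?y v) * (sin v - sin u))) / (v - u) * inverse (D v)"
      by (simp add: diff_divide_distrib right_diff_distrib)
    also have "\<dots> = (radius v - radius u) / (v - u)" unfolding key[symmetric] using elim by simp
    finally show ?case .
  qed
  ultimately have "((\<lambda>v. (radius v - radius u) / (v - u)) \<longlongrightarrow> radius' u) (at u)"
    by (auto intro: Lim_transform_eventually)
  then show ?thesis by (simp add: has_field_derivative_iff)
qed

text \<open>Bootstrapping: \<open>radius'\<close> is an expression in \<open>radius\<close>,
  \<open>sin\<close>, \<open>cos\<close> and \<open>dqq\<close>, so the radius gains one order as
  long as \<open>dqq\<close> has the order \<open>k\<close>; this is where \<open>k \<le> 2\<close>
  enters.\<close>

lemma Ck_radius_step:
  assumes "Ck k radius" "k \<le> 2" shows "Ck (Suc k) radius"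
proof -
  have d: "Ck k (dqq a)" for a using Ck_le[OF Ck_dqq assms(2)] .
  have sc: "Ck k sin" "Ck k cos" using Ck_sin_cos by auto
  have x: "Ck k (\<lambda>u. dqq 2 (- (radius u * cos u)))" "Ck k (\<lambda>u. dqq 1 (radius u * sin u))"
    by (intro Ck_compose[OF d] Ck_uminus Ck_mult assms sc)+
  have s: "Ck k radial_slope" unfolding radial_slope_def[abs_def] by (intro Ck_diff Ck_mult x sc)
  have "Ck k (\<lambda>u. inverse (radial_slope u))" using radial_slope_pos by (intro Ck_inverse s) (metis less_irrefl)
  then have "Ck k radius'" unfolding radius'_def[abs_def] by (intro Ck_uminus Ck_mult Ck_add assms x sc)
  then show ?thesis using DERIV_radius by auto
qed

lemma Ck_radius: "Ck 3 radius"
proof -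
  have 0: "Ck 0 radius" using isCont_radius by (simp add: continuous_at_imp_continuous_on)
  show ?thesis
    using Ck_radius_step[OF Ck_radius_step[OF Ck_radius_step[OF 0]]] by (simp del: Ck.simps add: eval_nat_numeral)
qed

definition gx :: "real \<Rightarrow> real" where "gx s = - (radius (2 * pi * s) * cos (2 * pi * s))"

definition gy :: "real \<Rightarrow> real" where "gy s = radius (2 * pi * s) * sin (2 * pi * s)"

definition gam :: "real \<Rightarrow> real^2" where "gam s = pt (gx s) (gy s)"

lemma gam_eq: "gam s = radius (2 * pi * s) *\<^sub>R dir (2 * pi * s)"
  by (simp add: gam_def gx_def gy_def dir_def vec_eq_iff forall_2)

lemma gam_FF: "FF (gam s) = 1" by (simp add: gam_eq radius)

lemma Ck_gam: "Ck 3 gx" "Ck 3 gy"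
proof -
  have l: "Ck 3 (\<lambda>s. 2 * pi * s)" by (intro Ck_mult Ck_const Ck_ident)
  have sc: "Ck 3 sin" "Ck 3 cos" using Ck_sin_cos by auto
  show "Ck 3 gx" "Ck 3 gy" unfolding gx_def[abs_def] gy_def[abs_def]
    by (intro Ck_uminus Ck_mult Ck_compose[OF Ck_radius l] Ck_compose[OF sc(1) l] Ck_compose[OF sc(2) l])+
qed

lemma dir_periodic: "dir (u + 2 * pi) = dir u" by (simp add: dir_def)

lemma radius_periodic: "radius (u + 2 * pi) = radius u"
  by (rule radius_eqI) (auto simp: dir_periodic radius)

lemma gam_periodic: "gam (s + 1) = gam s"
  using radius_periodic[of "2 * pi * s"] dir_periodic[of "2 * pi * s"]
  by (simp add: gam_eq distrib_left)

lemma inj_gam: "inj_on gam {0..<1}"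
proof (rule inj_onI)
  fix s t :: real assume st: "s \<in> {0..<1}" "t \<in> {0..<1}" and eq: "gam s = gam t"
  have n: "norm (gam v) = radius (2 * pi * v)" for v
    using radius(1)[of "2 * pi * v"] by (simp add: gam_eq norm_dir)
  have "radius (2 * pi * s) = radius (2 * pi * t)" unfolding n[symmetric] eq ..
  then have "dir (2 * pi * s) = dir (2 * pi * t)" using eq radius(1)[of "2 * pi * t"] by (simp add: gam_eq)
  then have "sin (2 * pi * s) = sin (2 * pi * t) \<and> cos (2 * pi * s) = cos (2 * pi * t)" by (simp add: dir_def pt_eq_iff)
  then obtain n :: int where n: "2 * pi * s = 2 * pi * t + 2 * pi * n" unfolding sin_cos_eq_iff by auto
  then have "2 * pi * (s - t - n) = 0" by (simp add: algebra_simps)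
  then have "s = t + n" by simp
  moreover have "n = 0" using st \<open>s = t + n\<close> by simp
  ultimately show "s = t" by simp
qed

lemma range_gam: "range gam = M\<^sub>\<Omega>"
proof
  show "range gam \<subseteq> M\<^sub>\<Omega>" by (auto simp: M_eq gam_FF)
  show "M\<^sub>\<Omega> \<subseteq> range gam"
  proof
    fix p assume p: "p \<in> M\<^sub>\<Omega>"
    then have p0: "p \<noteq> 0" by (auto simp: M_eq FF_0)
    have "(- p$1 / norm p)^2 + (p$2 / norm p)^2 = ((p$1)^2 + (p$2)^2) / (norm p)^2"
      by (simp add: power_divide add_divide_distrib)
    also have "\<dots> = 1" using p0 by (simp add: norm2_sq[symmetric])
    finally obtain u where u: "- p$1 / norm p = cos u" "p$2 / norm p = sin u"
      using sincos_total_2pi by metis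
    have "norm p *\<^sub>R dir u = p" using p0 unfolding dir_def u[symmetric] by (simp add: vec_eq_iff forall_2)
    moreover from this have "radius u = norm p" using p p0 by (intro radius_eqI) (auto simp: M_eq)
    ultimately have "gam (u / (2 * pi)) = p" by (simp add: gam_eq)
    then show "p \<in> range gam" by auto
  qed
qed

lemma has_vector_derivative_pt:
  assumes "(f has_real_derivative f') (at s)" "(g has_real_derivative g') (at s)"
  shows "((\<lambda>s. pt (f s) (g s)) has_vector_derivative pt f' g') (at s)"
  unfolding pt_as_axis using assms
  by (auto intro!: derivative_eq_intros simp: has_real_derivative_iff_has_vector_derivative)

lemma FF_gam_deriv:
  assumes "(gx has_real_derivative x') (at s)" "(gy has_real_derivative y') (at s)"
  shows "dqq 2 (gx s) * x' + dqq 1 (gy s) * y' = 0"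
proof -
  have "((\<lambda>s. qq 2 (gx s) + qq 1 (gy s)) has_real_derivative dqq 2 (gx s) * x' + dqq 1 (gy s) * y') (at s)"
    by (intro DERIV_add DERIV_chain2[OF DERIV_qq] assms)
  moreover have "(\<lambda>s. qq 2 (gx s) + qq 1 (gy s)) = (\<lambda>s. 1)"
    using gam_FF by (auto simp: FF_def gam_def)
  ultimately show ?thesis using DERIV_unique[OF _ DERIV_const] by force
qed

text \<open>The angular momentum \<open>x y' - y x'\<close> of a curve in polar coordinates is \<open>\<rho>\<^sup>2\<close> times the angular
  velocity.\<close>

lemma gam_cross:
  assumes "(gx has_real_derivative x') (at s)" "(gy has_real_derivative y') (at s)"
  shows "gx s * y' - gy s * x' = - 2 * pi * (radius (2 * pi * s))^2"
proof -
  let ?u = "2 * pi * s"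
  have r: "((\<lambda>s. radius (2 * pi * s)) has_real_derivative radius' ?u * (2 * pi)) (at s)"
    by (rule DERIV_chain2[OF DERIV_radius]) (auto intro!: derivative_eq_intros)
  have sc: "((\<lambda>s. sin (2 * pi * s)) has_real_derivative cos ?u * (2 * pi)) (at s)"
     "((\<lambda>s. cos (2 * pi * s)) has_real_derivative - sin ?u * (2 * pi)) (at s)"
    by (auto intro!: derivative_eq_intros)
  have "x' = - (radius' ?u * (2 * pi) * cos ?u + - sin ?u * (2 * pi) * radius ?u)"
    by (rule DERIV_unique[OF assms(1)]) (unfold gx_def[abs_def], intro DERIV_minus DERIV_mult r sc)
  moreover have "y' = radius' ?u * (2 * pi) * sin ?u + cos ?u * (2 * pi) * radius ?u"
    by (rule DERIV_unique[OF assms(2)]) (unfold gy_def[abs_def], intro DERIV_mult r sc)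
  moreover have "sin ?u * sin ?u = 1 - cos ?u * cos ?u"
    using sin_cos_squared_add[of ?u] by (simp add: power2_eq_square)
  ultimately show ?thesis unfolding gx_def gy_def power2_eq_square by algebra
qed

lemma gam_deriv_nonzero:
  assumes "(gx has_real_derivative x') (at s)" "(gy has_real_derivative y') (at s)"
  shows "x' \<noteq> 0 \<or> y' \<noteq> 0"
  using gam_cross[OF assms] radius(1)[of "2 * pi * s"] by auto

lemma gam_param: "closed_curve_param 3 gam M\<^sub>\<Omega>"
proof -
  obtain dx where dx: "dx 0 = gx" "\<forall>i<3. \<forall>x. (dx i has_real_derivative dx (Suc i) x) (at x)" "continuous_on UNIV (dx 3)"
    using Ck_derivative_sequence[OF Ck_gam(1)] by auto
  obtain dy where dy: "dy 0 = gy" "\<forall>i<3. \<forall>x. (dy i has_real_derivative dy (Suc i) x) (at x)" "continuous_on UNIV (dy 3)"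
    using Ck_derivative_sequence[OF Ck_gam(2)] by auto
  define D where "D i s = pt (dx i s) (dy i s)" for i :: nat and s
  have D0: "D 0 = gam" by (simp add: D_def[abs_def] gam_def[abs_def] dx dy)
  have D: "(D i has_vector_derivative D (Suc i) s) (at s)" if "i < 3" for i s
    unfolding D_def[abs_def] using dx dy that by (intro has_vector_derivative_pt) auto
  have "continuous_on UNIV (D 3)" unfolding D_def[abs_def] using dx dy by (intro continuous_intros) auto
  moreover have "vector_derivative gam (at s) \<noteq> 0" for s
  proof -
    have "vector_derivative gam (at s) = D 1 s" using D[of 0 s] D0 by (simp add: vector_derivative_at)
    moreover have "dx 1 s \<noteq> 0 \<or> dy 1 s \<noteq> 0" using dx dy by (intro gam_deriv_nonzero[of _ s]) force+
    ultimately show ?thesis by (auto simp: D_def vec_eq_iff forall_2)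
  qed
  ultimately have "regular_on 3 UNIV gam" unfolding regular_on_def using D0 D by blast
  then show ?thesis using gam_periodic inj_gam range_gam by (simp add: closed_curve_param_def)
qed

section \<open>Closed regular curves are embedded\<close>

lemma regular_on_mono:
  assumes "regular_on k I \<gamma>" "j \<le> k" "J \<subseteq> I" shows "regular_on j J \<gamma>"
proof -
  obtain D where D: "D 0 = \<gamma>" "\<forall>i<k. \<forall>s\<in>I. (D i has_vector_derivative D (Suc i) s) (at s)"
      "continuous_on I (D k)" "\<forall>s\<in>I. vector_derivative \<gamma> (at s) \<noteq> 0"
    using assms(1) by (auto simp: regular_on_def)
  have "continuous_on J (D j)"
  proof (cases "j = k")
    case False
    have "isCont (D j) s" if "s \<in> J" for s
      using has_vector_derivative_continuous[OF D(2)[rule_format, of j s]] that False assms(2,3) by auto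
    then show ?thesis by (simp add: continuous_at_imp_continuous_on)
  qed (use D assms in \<open>auto intro: continuous_on_subset\<close>)
  then show ?thesis unfolding regular_on_def using D assms by (intro conjI exI[of _ D]) auto
qed

lemma closed_curve_param_mono:
  "closed_curve_param k \<gamma> M \<Longrightarrow> j \<le> k \<Longrightarrow> closed_curve_param j \<gamma> M"
  by (auto simp: closed_curve_param_def intro: regular_on_mono)

text \<open>The chart at \<open>p = \<gamma> s0\<close> is nearly the whole curve: one period
  centred at \<open>s0\<close> is injective, and removing the single point \<open>q\<close> at its
  ends leaves the image of an open interval. Compactness makes the restricted map closed, hence a
  homeomorphism.\<close>

lemma closed_curve_embedded:
  assumes \<gamma>: "closed_curve_param k \<gamma> M" and k: "1 \<le> k"
  shows "embedded_curve k M"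
  unfolding embedded_curve_def
proof (intro ballI)
  fix p assume "p \<in> M"
  have \<gamma>1: "closed_curve_param 1 \<gamma> M" by (rule closed_curve_param_mono[OF \<gamma> k])
  note c = closed_curve_paramD[OF \<gamma>1]
  have per: "\<gamma> (s + 1) = \<gamma> s" for s using \<gamma> by (simp add: closed_curve_param_def)
  have pern: "\<gamma> (s + of_int n) = \<gamma> s" for s n
  proof (induction n rule: int_induct[where k=0])
    case (step1 i) then show ?case using per[of "s + of_int i"] by (simp add: add.assoc)
  next
    case (step2 i) then show ?case using per[of "s + of_int (i - 1)"] by simp
  qed simp
  obtain s0 where s0: "p = \<gamma> s0" using \<open>p \<in> M\<close> c(6) by auto
  define a b where "a = s0 - 1/2" and "b = s0 + 1/2"
  have ab: "b = a + 1" "a < s0" "s0 < b" by (auto simp: a_def b_def)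
  have inj: "s = t" if "s \<in> {a..<b}" "t \<in> {a..<b}" "\<gamma> s = \<gamma> t" for s t
  proof -
    have "\<gamma> (frac s) = \<gamma> s" "\<gamma> (frac t) = \<gamma> t" using pern[of s "- \<lfloor>s\<rfloor>"] pern[of t "- \<lfloor>t\<rfloor>"] by (auto simp: frac_def)
    then have "frac s = frac t" using that inj_onD[OF c(5), of "frac s" "frac t"] by (simp add: frac_lt_1)
    then have "s - t = of_int (\<lfloor>s\<rfloor> - \<lfloor>t\<rfloor>)" by (simp add: frac_def)
    moreover have "\<bar>s - t\<bar> < 1" using that ab by auto
    ultimately show ?thesis by (metis eq_iff_diff_eq_0 of_int_0 of_int_abs of_int_less_1_iff zabs_less_one_iff)
  qed
  define q where "q = \<gamma> b"
  have qa: "\<gamma> a = q" using per[of a] ab by (simp add: q_def)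
  define I where "I = {a<..<b}"
  have I: "\<gamma> s \<noteq> q" if "s \<in> I" for s using inj[of s a] that qa ab by (auto simp: I_def)
  have img: "\<gamma> ` I = M \<inter> - {q}"
  proof
    show "\<gamma> ` I \<subseteq> M \<inter> - {q}" using I c(6) by auto
    show "M \<inter> - {q} \<subseteq> \<gamma> ` I"
    proof
      fix x assume x: "x \<in> M \<inter> - {q}"
      then obtain s where s: "x = \<gamma> s" using c(6) by auto
      define t where "t = a + frac (s - a)"
      have "\<gamma> t = x" using pern[of s "- \<lfloor>s - a\<rfloor>"] s by (simp add: t_def frac_def)
      moreover have "t \<in> {a..<b}" using frac_lt_1[of "s-a"] ab(1) by (simp add: t_def)
      moreover have "t \<noteq> a" using x qa \<open>\<gamma> t = x\<close> by auto
      ultimately show "x \<in> \<gamma> ` I" by (auto simp: I_def)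
    qed
  qed
  have closed_map: "closedin (top_of_set (M \<inter> - {q})) (\<gamma> ` C)" if C: "closedin (top_of_set I) C" for C
  proof -
    obtain T where T: "closed T" "C = I \<inter> T" using C unfolding closedin_closed by blast
    \<comment> \<open>Adding the end points makes the set compact and adds at most the point
      \<open>q\<close> to the image, which the chart excludes.\<close>
    have "compact (\<gamma> ` ({a..b} \<inter> T))"
      by (rule compact_continuous_image[OF continuous_on_subset[OF c(1) subset_UNIV]
            compact_Int_closed[OF compact_Icc T(1)]])
    moreover have "\<gamma> ` C = (M \<inter> - {q}) \<inter> \<gamma> ` ({a..b} \<inter> T)"
    proof
      show "\<gamma> ` C \<subseteq> (M \<inter> - {q}) \<inter> \<gamma> ` ({a..b} \<inter> T)"
      proof
        fix x assume "x \<in> \<gamma> ` C"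
        then obtain s where s: "s \<in> I" "s \<in> T" "x = \<gamma> s" by (auto simp: T(2))
        then have "s \<in> {a..b}" by (simp add: I_def)
        moreover have "x \<noteq> q" "x \<in> M" using I[OF s(1)] s(3) c(6) by blast+
        ultimately show "x \<in> (M \<inter> - {q}) \<inter> \<gamma> ` ({a..b} \<inter> T)" using s by blast
      qed
      show "(M \<inter> - {q}) \<inter> \<gamma> ` ({a..b} \<inter> T) \<subseteq> \<gamma> ` C"
      proof
        fix x assume x: "x \<in> (M \<inter> - {q}) \<inter> \<gamma> ` ({a..b} \<inter> T)"
        then obtain s where s: "s \<in> {a..b}" "s \<in> T" "x = \<gamma> s" by auto
        have "x \<noteq> q" using x by blast
        then have "s \<noteq> a" "s \<noteq> b" using s(3) qa unfolding q_def by metis+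
        then have "s \<in> I" using s(1) by (simp add: I_def)
        then show "x \<in> \<gamma> ` C" using s(2,3) by (auto simp: T(2))
      qed
    qed
    ultimately show ?thesis unfolding closedin_closed by (blast intro: compact_imp_closed)
  qed
  have "inj_on \<gamma> I" using inj by (auto simp: inj_on_def I_def)
  then obtain h where "homeomorphism I (M \<inter> - {q}) \<gamma> h"
    using homeomorphism_injective_closed_map[OF continuous_on_subset[OF c(1)] img _ closed_map] by auto
  moreover have "regular_on k I \<gamma>" using \<gamma> by (auto simp: closed_curve_param_def intro: regular_on_mono)
  moreover have "p \<in> - {q}" using I[of s0] ab s0 by (auto simp: I_def)
  ultimately show "\<exists>U \<gamma> h a b. open U \<and> p \<in> U \<and> a < b \<and>
        regular_on k {a<..<b} \<gamma> \<and> homeomorphism {a<..<b} (M \<inter> U) \<gamma> h"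
    using ab unfolding I_def by (intro exI[of _ "- {q}"] exI[of _ \<gamma>] exI[of _ h] exI[of _ a] exI[of _ b]) auto
qed

section \<open>Curvature in the corners\<close>

lemma DERIV_dqq: "(dqq a has_real_derivative 12 * (max (u - a) 0)^2 + 12 * (max (- u - a) 0)^2) (at u)"
proof -
  have *: "((\<lambda>u::real. (max u 0)^3) has_real_derivative 3 * (max v 0)^2) (at v)" for v
    using DERIV_pos_part_power[of 1 v] by (simp add: eval_nat_numeral)
  have 1: "((\<lambda>u. (max (u - a) 0)^3) has_real_derivative 3 * (max (u - a) 0)^2 * 1) (at u)"
    by (rule DERIV_chain2[OF *]) (auto intro!: derivative_eq_intros)
  have 2: "((\<lambda>u. (max (- u - a) 0)^3) has_real_derivative 3 * (max (- u - a) 0)^2 * (-1)) (at u)"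
    by (rule DERIV_chain2[OF *]) (auto intro!: derivative_eq_intros)
  show ?thesis using DERIV_diff[OF DERIV_cmult[OF 1, of 4] DERIV_cmult[OF 2, of 4]]
    by (simp add: dqq_def[abs_def])
qed

text \<open>Differentiating \<open>F \<circ> \<gamma> = 1\<close> twice gives \<open>\<nabla>F \<cdot> \<gamma>'' = - \<gamma>'\<^sup>T \<nabla>\<^sup>2F \<gamma>' < 0\<close> in a corner, so \<open>\<gamma>''\<close> is not
  parallel to the tangent \<open>\<gamma>'\<close>.\<close>

lemma gam_corner_cross_nonzero:
  assumes dx: "\<And>s. (gx has_real_derivative x' s) (at s)" "(x' has_real_derivative x'') (at s)"
    and dy: "\<And>s. (gy has_real_derivative y' s) (at s)" "(y' has_real_derivative y'') (at s)"
    and corner: "2 < \<bar>gx s\<bar>" "1 < \<bar>gy s\<bar>"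
  shows "x' s * y'' - y' s * x'' \<noteq> 0"
proof
  assume cr: "x' s * y'' - y' s * x'' = 0"
  define A where "A = 12 * (max (gx s - 2) 0)^2 + 12 * (max (- gx s - 2) 0)^2"
  define B where "B = 12 * (max (gy s - 1) 0)^2 + 12 * (max (- gy s - 1) 0)^2"
  have "0 < (max (gx s - 2) 0)^2 \<or> 0 < (max (- gx s - 2) 0)^2" using corner(1) by (auto simp: abs_if split: if_splits)
  then have A: "A > 0" unfolding A_def by (auto intro: add_pos_nonneg add_nonneg_pos)
  have "0 < (max (gy s - 1) 0)^2 \<or> 0 < (max (- gy s - 1) 0)^2" using corner(2) by (auto simp: abs_if split: if_splits)
  then have B: "B > 0" unfolding B_def by (auto intro: add_pos_nonneg add_nonneg_pos)
  let ?p = "dqq 2 (gx s)" and ?q = "dqq 1 (gy s)"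
  have 1: "?p * x' s + ?q * y' s = 0" by (rule FF_gam_deriv[OF dx(1) dy(1)])
  have "((\<lambda>s. dqq 2 (gx s) * x' s + dqq 1 (gy s) * y' s) has_real_derivative
      (A * x' s) * x' s + x'' * ?p + ((B * y' s) * y' s + y'' * ?q)) (at s)"
    unfolding A_def B_def by (intro DERIV_add DERIV_mult DERIV_chain2[OF DERIV_dqq] dx dy)
  moreover have "(\<lambda>s. dqq 2 (gx s) * x' s + dqq 1 (gy s) * y' s) = (\<lambda>s. 0)"
    using FF_gam_deriv[OF dx(1) dy(1)] by auto
  ultimately have 2: "A * x' s * x' s + x'' * ?p + (B * y' s * y' s + y'' * ?q) = 0"
    using DERIV_unique[OF _ DERIV_const] by force
  define E where "E = A * x' s * x' s + B * y' s * y' s"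
  \<comment> \<open>If the second derivative were parallel to the tangent, the gradient would
    annihilate it too and fact 2 would leave \<open>E = 0\<close>. Multiplying by the components of
    the tangent avoids dividing by whichever vanishes.\<close>
  have "E * x' s = 0" "E * y' s = 0" using 1 2 cr unfolding E_def by algebra+
  moreover have "x' s \<noteq> 0 \<or> y' s \<noteq> 0" by (rule gam_deriv_nonzero[OF dx(1) dy(1)])
  ultimately have "E = 0" by auto
  moreover have "0 \<le> A * x' s * x' s" "0 \<le> B * y' s * y' s" using A B by (auto simp: mult.assoc)
  ultimately have "A * x' s * x' s = 0" "B * y' s * y' s = 0" unfolding E_def by linarith+
  then show False using A B \<open>x' s \<noteq> 0 \<or> y' s \<noteq> 0\<close> by auto
qed

lemma gam_corner_curvature:
  assumes "e \<in> {-1, 1::real}" "f \<in> {-1, 1::real}"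
  shows "\<exists>a b k. a < b \<and> 0 < k \<and> (\<forall>s\<in>{a..b}. 2 < e * gam s $ 1 \<and> 1 < f * gam s $ 2 \<and> k \<le> curvature gam s)"
proof -
  obtain dx where dx: "dx 0 = gx" "\<forall>i<3. \<forall>x. (dx i has_real_derivative dx (Suc i) x) (at x)" "continuous_on UNIV (dx 3)"
    using Ck_derivative_sequence[OF Ck_gam(1)] by auto
  obtain dy where dy: "dy 0 = gy" "\<forall>i<3. \<forall>x. (dy i has_real_derivative dy (Suc i) x) (at x)" "continuous_on UNIV (dy 3)"
    using Ck_derivative_sequence[OF Ck_gam(2)] by auto
  have d: "(gx has_real_derivative dx 1 s) (at s)" "(dx 1 has_real_derivative dx 2 s) (at s)" "(dx 2 has_real_derivative dx 3 s) (at s)"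
     "(gy has_real_derivative dy 1 s) (at s)" "(dy 1 has_real_derivative dy 2 s) (at s)" "(dy 2 has_real_derivative dy 3 s) (at s)" for s
    using dx(2)[rule_format, of 0 s] dx(2)[rule_format, of 1 s] dx(2)[rule_format, of 2 s]
       dy(2)[rule_format, of 0 s] dy(2)[rule_format, of 1 s] dy(2)[rule_format, of 2 s] dx(1) dy(1)
    by (simp_all add: eval_nat_numeral)
  have v1: "vector_derivative gam (at s) = pt (dx 1 s) (dy 1 s)" for s
    unfolding gam_def[abs_def] by (intro vector_derivative_at has_vector_derivative_pt d)
  have v2: "vector_derivative (\<lambda>u. vector_derivative gam (at u)) (at s) = pt (dx 2 s) (dy 2 s)" for s
    unfolding v1 by (intro vector_derivative_at has_vector_derivative_pt d)
  have curv: "curvature gam s = \<bar>dx 1 s * dy 2 s - dy 1 s * dx 2 s\<bar> / norm (pt (dx 1 s) (dy 1 s)) ^ 3" for s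
    unfolding curvature_def v1 v2[unfolded v1] Let_def by (simp del: One_nat_def)
  have cont: "continuous_on S gx" "continuous_on S gy" "continuous_on S (dx 1)" "continuous_on S (dx 2)"
    "continuous_on S (dy 1)" "continuous_on S (dy 2)" for S
    by (rule continuous_at_imp_continuous_on, rule ballI, rule DERIV_isCont, rule d)+
  have nz: "pt (dx 1 s) (dy 1 s) \<noteq> 0" for s
    using gam_deriv_nonzero[OF d(1,4), of s] by (auto simp: vec_eq_iff forall_2)
  have ccont: "continuous_on S (curvature gam)" for S
    unfolding curv[abs_def] using nz by (intro continuous_intros cont) auto
  have cpos: "0 < curvature gam s" if "2 < \<bar>gx s\<bar>" "1 < \<bar>gy s\<bar>" for s
    using gam_corner_cross_nonzero[OF d(1) d(2) d(4) d(5) that] nz[of s] unfolding curv by simp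
  \<comment> \<open>The fourth root of 1/2: at the point \<open>p\<close> below both quartic terms
    equal 1/2, so it lies strictly inside the corner with signs \<open>e\<close> and
    \<open>f\<close>.\<close>
  define w where "w = sqrt (sqrt (1/2))"
  have w2: "w^2 = sqrt (1/2)" "0 < w" by (simp_all add: w_def)
  have "w^4 = (w^2)^2" by algebra
  then have w: "w^4 = 1/2" "0 < w" using w2 by simp_all
  define p where "p = pt (e * (2 + w)) (f * (1 + w))"
  have "p \<in> M\<^sub>\<Omega>" using assms w by (auto simp: M_eq FF_def p_def qq_abs abs_mult)
  then obtain s0 where s0: "gam s0 = p" using range_gam by (metis imageE)
  let ?S = "{s. 2 < e * gx s} \<inter> {s. 1 < f * gy s}"
  have "open ?S" by (intro open_Int open_Collect_less continuous_intros cont)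
  moreover have "e * e = 1" "f * f = 1" using assms by auto
  then have "s0 \<in> ?S" using s0 w by (auto simp: gam_def p_def pt_eq_iff mult.assoc[symmetric])
  ultimately obtain \<delta> where \<delta>: "\<delta> > 0" "cball s0 \<delta> \<subseteq> ?S" using open_contains_cball by meson
  obtain m where m: "m \<in> {s0 - \<delta>..s0 + \<delta>}" "\<And>s. s \<in> {s0 - \<delta>..s0 + \<delta>} \<Longrightarrow> curvature gam m \<le> curvature gam s"
    using continuous_attains_inf[of "{s0 - \<delta>..s0 + \<delta>}" "curvature gam"] ccont \<delta>(1) by auto
  have sub: "2 < e * gx s" "1 < f * gy s" if "s \<in> {s0 - \<delta>..s0 + \<delta>}" for s
    using \<delta>(2) that by (auto simp: cball_eq_atLeastAtMost)
  have "2 < \<bar>gx m\<bar>" "1 < \<bar>gy m\<bar>" using sub[OF m(1)] assms by auto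
  then have "0 < curvature gam m" by (rule cpos)
  then show ?thesis using \<delta>(1) m sub
    by (intro exI[of _ "s0 - \<delta>"] exI[of _ "s0 + \<delta>"] exI[of _ "curvature gam m"]) (auto simp: gam_def)
qed

lemma connected_M: "connected M\<^sub>\<Omega>"
  using connected_continuous_image[of UNIV gam] closed_curve_paramD(1)[OF closed_curve_param_mono[OF gam_param]] range_gam
  by auto

subsection \<open>Unique nearest points\<close>

text \<open>Special to the plane, where the vectors orthogonal to \<open>v\<close> form a
  line.\<close>

lemma parallel_if_orthogonal_to_common:
  fixes G w v :: "real^2"
  assumes "v \<noteq> 0" "G \<bullet> v = 0" "w \<bullet> v = 0" "G \<noteq> 0"
  shows "\<exists>m. w = m *\<^sub>R G"
proof -
  have G: "G$1 * v$1 + G$2 * v$2 = 0" and w: "w$1 * v$1 + w$2 * v$2 = 0" using assms by (auto simp: inner2)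
  have "(w$1 * G$2 - w$2 * G$1) * v$1 = 0" "(w$1 * G$2 - w$2 * G$1) * v$2 = 0" using G w by algebra+
  moreover have "v$1 \<noteq> 0 \<or> v$2 \<noteq> 0" using assms(1) by (auto simp: vec_eq_iff forall_2)
  ultimately have c: "w$1 * G$2 = w$2 * G$1" by auto
  have n: "(norm G)^2 \<noteq> 0" using assms(4) by simp
  have e: "w$1 * (norm G)^2 = (w \<bullet> G) * G$1" "w$2 * (norm G)^2 = (w \<bullet> G) * G$2"
    using c unfolding norm2_sq inner2 by algebra+
  have "w = ((w \<bullet> G) / (norm G)^2) *\<^sub>R G"
    unfolding vec_eq_iff forall_2 using e n by (simp add: field_simps)
  then show ?thesis by blast
qed

text \<open>The squared distance along \<open>gam\<close> has a minimum at \<open>p\<close>, so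
  \<open>x - p\<close> is orthogonal to the tangent there, and so is the gradient.\<close>

lemma normal_at_nearest_point:
  assumes p: "p \<in> M\<^sub>\<Omega>" and near: "\<And>q. q \<in> M\<^sub>\<Omega> \<Longrightarrow> dist x p \<le> dist x q"
  shows "\<exists>m. x - p = m *\<^sub>R GF p"
proof -
  obtain s where s: "gam s = p" using p range_gam by (metis imageE)
  obtain x' where dx: "(gx has_real_derivative x') (at s)" using Ck_gam(1) by (force simp: eval_nat_numeral)
  obtain y' where dy: "(gy has_real_derivative y') (at s)" using Ck_gam(2) by (force simp: eval_nat_numeral)
  define f where "f u = (x$1 - gx u)^2 + (x$2 - gy u)^2" for u
  have f: "f u = (dist x (gam u))^2" for u by (simp add: f_def dist_norm norm2_sq gam_def)
  have "(f has_real_derivative 2 * (x$1 - gx s) * (- x') + 2 * (x$2 - gy s) * (- y')) (at s)"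
    unfolding f_def[abs_def] by (auto intro!: derivative_eq_intros dx dy simp: algebra_simps)
  moreover have "f s \<le> f u" for u
    unfolding f s using near[of "gam u"] range_gam by (intro power_mono) auto
  ultimately have "2 * (x$1 - gx s) * (- x') + 2 * (x$2 - gy s) * (- y') = 0"
    by (intro DERIV_local_min[of f _ s 1]) auto
  then have "(x - p) \<bullet> pt x' y' = 0" using s by (simp add: inner2 gam_def algebra_simps flip: s)
  moreover have "GF p \<bullet> pt x' y' = 0" using FF_gam_deriv[OF dx dy] s by (simp add: GF_def inner2 gam_def flip: s)
  moreover have "pt x' y' \<noteq> 0" using gam_deriv_nonzero[OF dx dy] by (auto simp: vec_eq_iff forall_2)
  moreover have "GF p \<noteq> 0" using GF_lower(1)[OF p] by auto
  ultimately show ?thesis using parallel_if_orthogonal_to_common by blast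
qed

text \<open>Expanding \<open>dist x q = dist x p\<close> gives that the square of
  \<open>norm (q - p)\<close> is \<open>2 * m * (GF p \<bullet> (q - p))\<close>, while the inner
  product is itself quadratic in \<open>q - p\<close>. With \<open>\<bar>m\<bar>\<close> at most 4
  times the distance \<open>d\<close> to the curve, the right side has the factor
  \<open>2 * 4 * 432 * d = 3456 * d < 1\<close>.\<close>

lemma nearest_point_unique:
  assumes "p \<in> M\<^sub>\<Omega>" "q \<in> M\<^sub>\<Omega>" "dist x p = infdist x M\<^sub>\<Omega>" "dist x q = infdist x M\<^sub>\<Omega>"
    and small: "infdist x M\<^sub>\<Omega> < 1/4000"
  shows "p = q"
proof (rule ccontr)
  assume "p \<noteq> q"
  obtain m where m: "x - p = m *\<^sub>R GF p"
    using normal_at_nearest_point[OF assms(1), of x] assms(3) infdist_le[of _ "M\<^sub>\<Omega>" x] by auto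
  have "\<bar>m\<bar> * (1/4) \<le> \<bar>m\<bar> * norm (GF p)" using GF_lower(2)[OF assms(1)] by (intro mult_left_mono) auto
  also have "\<dots> = dist x p" unfolding dist_norm m by simp
  finally have ml: "\<bar>m\<bar> \<le> 4 * infdist x M\<^sub>\<Omega>" using assms(3) by simp
  have "(norm (x - q))^2 = (norm ((x - p) - (q - p)))^2" by simp
  also have "\<dots> = (norm (x - p))^2 - 2 * ((x - p) \<bullet> (q - p)) + (norm (q - p))^2"
    unfolding power2_norm_eq_inner by (simp only: inner_diff_left inner_diff_right inner_commute) simp
  finally have "(norm (q - p))^2 = 2 * (m * (GF p \<bullet> (q - p)))"
    using assms(3,4) unfolding dist_norm m by simp
  also have "\<dots> \<le> 2 * (\<bar>m\<bar> * \<bar>GF p \<bullet> (q - p)\<bar>)" by (metis abs_ge_self abs_mult mult_le_cancel_left_pos zero_less_numeral)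
  also have "\<dots> \<le> 2 * ((4 * infdist x M\<^sub>\<Omega>) * (432 * (norm (q - p))^2))"
    using ml normal_quadratic[OF assms(1,2)] by (intro mult_left_mono mult_mono) auto
  also have "\<dots> = (3456 * infdist x M\<^sub>\<Omega>) * (norm (q - p))^2" by simp
  also have "\<dots> < 1 * (norm (q - p))^2" using small \<open>p \<noteq> q\<close> by (intro mult_strict_right_mono) auto
  finally show False by simp
qed

lemma M_nonempty: "M\<^sub>\<Omega> \<noteq> {}" using range_gam by auto

lemma reach_M_pos: "0 < reach M\<^sub>\<Omega>"
proof -
  have "ereal (1/4000) \<le> reach M\<^sub>\<Omega>"
    unfolding reach_def
  proof (intro Sup_upper CollectI exI conjI allI impI)
    fix x :: "real^2" assume "infdist x M\<^sub>\<Omega> < 1/4000"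
    moreover obtain y where "y \<in> M\<^sub>\<Omega>" "infdist x M\<^sub>\<Omega> = dist x y"
      using infdist_attains_inf[OF compact_imp_closed[OF compact_M] M_nonempty] by metis
    ultimately show "\<exists>!y. y \<in> M\<^sub>\<Omega> \<and> dist x y = infdist x M\<^sub>\<Omega>"
      using nearest_point_unique[of _ _ x] by metis
  qed auto
  moreover have "(0::ereal) < ereal (1/4000)" by simp
  ultimately show ?thesis by (rule less_le_trans[rotated])
qed

subsection \<open>Hausdorff distance of the reconstruction\<close>

lemma bdd_above_infdist:
  fixes A B :: "'a::metric_space set"
  assumes "bounded A" "B \<noteq> {}" shows "bdd_above ((\<lambda>x. infdist x B) ` A)"
proof -
  obtain b where b: "b \<in> B" using assms(2) by blast
  obtain e where "\<And>x. x \<in> A \<Longrightarrow> dist b x \<le> e" using assms(1) unfolding bounded_any_center[of _ b] by blast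
  then show ?thesis using infdist_le[OF b] by (intro bdd_aboveI[of _ e]) (auto simp: dist_commute intro: order_trans)
qed

lemma infdist_le_hausdorff_dist:
  assumes "bounded A" "bounded B" "x \<in> A" "y \<in> B"
  shows "infdist x B \<le> hausdorff_dist A B" "infdist y A \<le> hausdorff_dist A B"
  using cSUP_upper[OF assms(3) bdd_above_infdist[OF assms(1), of B]]
    cSUP_upper[OF assms(4) bdd_above_infdist[OF assms(2), of A]] assms
  unfolding hausdorff_dist_def by (auto simp: le_max_iff_disj)

lemma hausdorff_dist_le:
  assumes "A \<noteq> {}" "B \<noteq> {}" "\<And>x. x \<in> A \<Longrightarrow> infdist x B \<le> e" "\<And>y. y \<in> B \<Longrightarrow> infdist y A \<le> e"
  shows "hausdorff_dist A B \<le> e"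
  unfolding hausdorff_dist_def using assms by (intro max.boundedI cSUP_least) auto

lemma sample_point:
  assumes "finite X" "X \<noteq> {}" "X \<subseteq> M\<^sub>\<Omega>" "hausdorff_dist X M\<^sub>\<Omega> \<le> e" "y \<in> M\<^sub>\<Omega>"
  shows "\<exists>x\<in>X. dist y x \<le> e"
proof -
  obtain x0 where "x0 \<in> X" using assms(2) by blast
  have "infdist y X \<le> e"
    using infdist_le_hausdorff_dist(2)[OF _ _ \<open>x0 \<in> X\<close> assms(5)] assms compact_imp_bounded[OF compact_M]
      finite_imp_bounded[OF assms(1)] by fastforce
  moreover obtain x where "x \<in> X" "infdist y X = dist y x"
    using infdist_attains_inf[OF finite_imp_closed[OF assms(1)] assms(2)] by metis
  ultimately show ?thesis by auto
qed

lemma rad_le: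
  assumes "finite \<sigma>" "\<sigma> \<noteq> {}" "\<And>x. x \<in> \<sigma> \<Longrightarrow> norm (x - z) \<le> t"
  shows "rad \<sigma> \<le> t"
proof -
  have "bdd_below (range (\<lambda>z. Max ((\<lambda>x. norm (x - z)) ` \<sigma>)))"
  proof (rule bdd_belowI2[of _ 0])
    fix z
    obtain x where "x \<in> \<sigma>" using assms(2) by blast
    then show "0 \<le> Max ((\<lambda>x. norm (x - z)) ` \<sigma>)"
      using assms(1) by (intro order_trans[OF norm_ge_zero[of "x - z"]] Max_ge) auto
  qed
  then have "rad \<sigma> \<le> Max ((\<lambda>x. norm (x - z)) ` \<sigma>)" unfolding rad_def by (rule cINF_lower) simp
  also have "\<dots> \<le> t" using assms by (intro Max.boundedI) auto
  finally show ?thesis .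
qed

lemma convex_hull_subset_Conv:
  assumes "finite \<sigma>" "\<sigma> \<noteq> {}" "\<sigma> \<subseteq> X" "\<And>x. x \<in> \<sigma> \<Longrightarrow> norm (x - z) \<le> t"
  shows "convex hull \<sigma> \<subseteq> Conv t X"
  using rad_le[OF assms(1,2,4)] assms unfolding Conv_def by blast

text \<open>The infimum in \<open>rad\<close> is replaced by a centre that works for the larger
  radius \<open>3/2 * t\<close>. The ball around it contains the vertices and hence
  \<open>a\<close>, so each vertex is within \<open>3 * t\<close> of \<open>a\<close>.\<close>

lemma Conv_obtain:
  fixes X :: "'a::real_normed_vector set"
  assumes "finite X" "a \<in> Conv t X" "0 < t"
  obtains \<sigma> where "\<sigma> \<noteq> {}" "\<sigma> \<subseteq> X" "a \<in> convex hull \<sigma>" "\<And>x. x \<in> \<sigma> \<Longrightarrow> norm (x - a) \<le> 3 * t"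
proof -
  obtain \<sigma> where s: "\<sigma> \<noteq> {}" "\<sigma> \<subseteq> X" "a \<in> convex hull \<sigma>" "rad \<sigma> \<le> t"
    using assms unfolding Conv_def by blast
  have fin: "finite \<sigma>" using s assms finite_subset by blast
  have "rad \<sigma> < 3/2 * t" using s assms by simp
  have "\<exists>z. Max ((\<lambda>x. norm (x - z)) ` \<sigma>) < 3/2 * t"
  proof (rule ccontr)
    assume "\<not> ?thesis"
    then have "3/2 * t \<le> rad \<sigma>" unfolding rad_def by (intro cINF_greatest) (auto simp: not_less)
    then show False using \<open>rad \<sigma> < 3/2 * t\<close> by simp
  qed
  then obtain z where z: "Max ((\<lambda>x. norm (x - z)) ` \<sigma>) < 3/2 * t" by blast
  have zx: "norm (x - z) \<le> 3/2 * t" if "x \<in> \<sigma>" for x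
  proof -
    have "norm (x - z) \<le> Max ((\<lambda>x. norm (x - z)) ` \<sigma>)" using fin that by (intro Max_ge) auto
    then show ?thesis using z by simp
  qed
  then have "\<sigma> \<subseteq> cball z (3/2 * t)" by (auto simp: dist_norm norm_minus_commute)
  then have "convex hull \<sigma> \<subseteq> cball z (3/2 * t)" by (intro hull_minimal convex_cball)
  then have az: "norm (z - a) \<le> 3/2 * t" using s by (auto simp: dist_norm)
  have "norm (x - a) \<le> 3 * t" if "x \<in> \<sigma>" for x
    using norm_triangle_ineq[of "x - z" "z - a"] zx[OF that] az by simp
  then show ?thesis using that s by blast
qed

lemma Conv_subset_Omega:
  assumes "X \<subseteq> M\<^sub>\<Omega>" shows "Conv t X \<subseteq> Omega"
proof -
  have "X \<subseteq> Omega" using assms by (auto simp: M_eq Omega_eq)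
  then have "convex hull \<sigma> \<subseteq> Omega" if "\<sigma> \<subseteq> X" for \<sigma> using that by (intro hull_minimal convex_Omega) auto
  then show ?thesis unfolding Conv_def by blast
qed

text \<open>Expanding \<open>F\<close> around \<open>a \<in> conv \<sigma>\<close>, every vertex of \<open>\<sigma>\<close> satisfies the affine inequality
  \<open>1 \<le> F a + \<nabla>F a \<cdot> (x - a) + O(t\<^sup>2)\<close>, hence so does \<open>a\<close>.\<close>

lemma FF_on_Conv:
  assumes "finite X" "X \<subseteq> M\<^sub>\<Omega>" "0 < t" "a \<in> Conv t X"
  shows "1 - 3888 * t^2 \<le> FF a"
proof -
  obtain \<sigma> where s: "\<sigma> \<noteq> {}" "\<sigma> \<subseteq> X" "a \<in> convex hull \<sigma>" "\<And>x. x \<in> \<sigma> \<Longrightarrow> norm (x - a) \<le> 3 * t"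
    using Conv_obtain[OF assms(1,4,3)] by blast
  have a1: "FF a \<le> 1" using Conv_subset_Omega[OF assms(2)] assms(4) by (auto simp: Omega_eq)
  have ab: "\<bar>a$1\<bar> \<le> 4" "\<bar>a$2\<bar> \<le> 4" using FF_le1_bounds[OF a1] by linarith+
  let ?H = "{x. GF a \<bullet> x \<ge> 1 - FF a + GF a \<bullet> a - 3888 * t^2}"
  have "\<sigma> \<subseteq> ?H"
  proof
    fix x assume x: "x \<in> \<sigma>"
    then have xM: "x \<in> M\<^sub>\<Omega>" using s assms by blast
    have xb: "\<bar>x$1\<bar> \<le> 4" "\<bar>x$2\<bar> \<le> 4" using M_bounds(1,2)[OF xM] by linarith+
    have "(norm (x - a))^2 \<le> (3 * t)^2" using s(4)[OF x] by (intro power_mono) auto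
    then have "(norm (x - a))^2 \<le> 9 * t^2" by (simp add: power_mult_distrib)
    then show "x \<in> ?H"
      using FF_taylor[OF ab xb] xM by (simp add: M_eq inner_diff_right)
  qed
  then have "convex hull \<sigma> \<subseteq> ?H" by (intro hull_minimal convex_halfspace_ge)
  then show ?thesis using s(3) by auto
qed

text \<open>Constants: 3888 is \<open>432 * 9\<close>, as vertices are within \<open>3 * t\<close>,
  and 62208 is \<open>16 * 3888\<close> after radial projection.\<close>

lemma Conv_near_M:
  assumes "finite X" "X \<subseteq> M\<^sub>\<Omega>" "0 < t" "t \<le> 1/100" "a \<in> Conv t X"
  shows "\<exists>y\<in>M\<^sub>\<Omega>. dist a y \<le> 62208 * t^2"
proof -
  have a1: "FF a \<le> 1" using Conv_subset_Omega[OF assms(2)] assms(5) by (auto simp: Omega_eq)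
  have "t^2 \<le> (1/100)^2" using assms by (intro power_mono) auto
  then have "3888 * t^2 \<le> 1/2" by (simp add: power2_eq_square)
  then show ?thesis using radial_projection[of a "3888 * t^2"] FF_on_Conv[OF assms(1,2,3,5)] a1 FF_le1_norm[OF a1]
    by auto
qed

definition perp :: "real^2 \<Rightarrow> real^2" where "perp v = pt (- (v$2)) (v$1)"

lemma perp: "perp v \<bullet> v = 0" "norm (perp v) = norm v"
  by (simp_all add: perp_def inner2 norm2 algebra_simps)

text \<open>A tangential step of length \<open>t\<close> changes the level by at most
  \<open>432 * t^2\<close>; radial projection returns to the curve at 16 times this cost.\<close>

lemma M_step:
  assumes p: "p \<in> M\<^sub>\<Omega>" and e: "norm e = 1" "GF p \<bullet> e = 0" and t: "0 < t" "t \<le> 1/100"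
  shows "\<exists>y\<in>M\<^sub>\<Omega>. norm (y - (p + t *\<^sub>R e)) \<le> 6912 * t^2"
proof -
  let ?v = "p + t *\<^sub>R e"
  have "\<bar>(t *\<^sub>R e)$i\<bar> \<le> 1" for i using component_le_norm_cart[of "t *\<^sub>R e" i] e t by simp
  then have c: "\<bar>(t *\<^sub>R e)$1\<bar> \<le> 1" "\<bar>(t *\<^sub>R e)$2\<bar> \<le> 1" by blast+
  have "\<bar>?v$1\<bar> \<le> \<bar>p$1\<bar> + \<bar>(t *\<^sub>R e)$1\<bar>" "\<bar>?v$2\<bar> \<le> \<bar>p$2\<bar> + \<bar>(t *\<^sub>R e)$2\<bar>"
    by (simp_all only: vector_add_component abs_triangle_ineq)
  then have b: "\<bar>?v$1\<bar> \<le> 4" "\<bar>?v$2\<bar> \<le> 4" "\<bar>p$1\<bar> \<le> 4" "\<bar>p$2\<bar> \<le> 4"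
    using M_bounds(1,2)[OF p] c by linarith+
  have "FF p = 1" using p by (simp add: M_eq)
  then have "\<bar>FF ?v - 1\<bar> \<le> 432 * t^2"
    using FF_taylor[OF b(3,4,1,2)] FF_tangent[of p ?v] e t by (simp add: power_mult_distrib)
  moreover have "t^2 \<le> (1/100)^2" using t by (intro power_mono) auto
  then have "432 * t^2 \<le> 1/2" by (simp add: power2_eq_square)
  moreover have "norm ?v \<le> 8" using norm_triangle_ineq[of p "t *\<^sub>R e"] M_bounds(3)[OF p] e t by simp
  ultimately obtain y where "y \<in> M\<^sub>\<Omega>" "dist ?v y \<le> 16 * (432 * t^2)" using radial_projection by blast
  then show ?thesis by (intro bexI[of _ y]) (auto simp: dist_norm norm_minus_commute)
qed

text \<open>There are sample points on both sides of the normal at \<open>p\<close>, within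
  \<open>t\<close> of \<open>p\<close>. The segment between them lies in the reconstruction and
  meets the normal line in a point \<open>a\<close>; its normal offset is a convex combination of
  offsets of sample points, which are quadratically small. The bound \<open>1/4 \<le> norm G\<close>
  turns \<open>432 * t^2\<close> into \<open>1728 * t^2\<close>.\<close>

lemma M_near_Conv:
  assumes X: "finite X" "X \<subseteq> M\<^sub>\<Omega>" and S: "\<And>y. y \<in> M\<^sub>\<Omega> \<Longrightarrow> \<exists>x\<in>X. dist y x \<le> \<eta> * t"
    and \<eta>: "\<eta> < 1/3" and t: "0 < t" "t \<le> 1/20000" and p: "p \<in> M\<^sub>\<Omega>"
  shows "\<exists>a\<in>Conv t X. dist p a \<le> 1728 * t^2"
proof -
  define G where "G = GF p"
  have G: "1/4 \<le> norm G" using GF_lower(2)[OF p] by (simp add: G_def)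
  then have G0: "0 < norm G" by linarith
  define e where "e = (1 / norm G) *\<^sub>R perp G"
  have e: "norm e = 1" "G \<bullet> e = 0" using G0 perp[of G] by (auto simp: e_def inner_commute)
  have sample: "\<exists>x\<in>X. 0 \<le> (x - p) \<bullet> f \<and> norm (x - p) \<le> t" if f: "norm f = 1" "G \<bullet> f = 0" for f
  proof -
    \<comment> \<open>A step of length \<open>t/2\<close>: the error \<open>t/6\<close> of returning
      to the curve and the sampling error \<open>t/3\<close> add up to \<open>t/2\<close>, so the
      sample neither crosses the normal nor leaves the ball of radius \<open>t\<close> around
      \<open>p\<close>.\<close>
    obtain y where y: "y \<in> M\<^sub>\<Omega>" "norm (y - (p + (t/2) *\<^sub>R f)) \<le> 6912 * (t/2)^2"
      using M_step[OF p f(1) f(2)[unfolded G_def], of "t/2"] t by auto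
    obtain x where x: "x \<in> X" "dist y x \<le> \<eta> * t" using S[OF y(1)] by blast
    have "6912 * (t/2)^2 = (1728 * t) * t" by (simp add: power2_eq_square)
    also have "\<dots> \<le> (1/6) * t" using t by (intro mult_right_mono) auto
    finally have y2: "norm (y - (p + (t/2) *\<^sub>R f)) \<le> t / 6" using y by simp
    have "\<eta> * t \<le> 1/3 * t" using \<eta> t by (intro mult_right_mono) auto
    then have x2: "norm (x - y) \<le> t / 3" using x by (simp add: dist_norm norm_minus_commute)
    define w where "w = (x - y) + (y - (p + (t/2) *\<^sub>R f))"
    have w: "norm w \<le> t / 2" using norm_triangle_ineq[of "x - y" "y - (p + (t/2) *\<^sub>R f)"] x2 y2 by (simp add: w_def)
    have xp: "x - p = w + (t/2) *\<^sub>R f" by (simp add: w_def)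
    have "f \<bullet> f = 1" using f(1) by (simp add: norm_eq_1)
    moreover have "\<bar>w \<bullet> f\<bar> \<le> t / 2" using Cauchy_Schwarz_ineq2[of w f] w f by simp
    ultimately have "0 \<le> (x - p) \<bullet> f" unfolding xp inner_add_left by simp
    moreover have "norm (x - p) \<le> t" unfolding xp using norm_triangle_ineq[of w "(t/2) *\<^sub>R f"] w f t by simp
    ultimately show ?thesis using x by blast
  qed
  obtain x where x: "x \<in> X" "0 \<le> (x - p) \<bullet> e" "norm (x - p) \<le> t" using sample[of e] e by blast
  obtain y where y: "y \<in> X" "(y - p) \<bullet> e \<le> 0" "norm (y - p) \<le> t" using sample[of "- e"] e by auto
  have "\<And>z. z \<in> {x, y} \<Longrightarrow> norm (z - p) \<le> t" using x y by blast
  then have sub: "closed_segment x y \<subseteq> Conv t X"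
    unfolding segment_convex_hull using x y by (intro convex_hull_subset_Conv) auto
  define h where "h c = ((1 - c) *\<^sub>R x + c *\<^sub>R y - p) \<bullet> e" for c
  have "continuous_on {0..1} h" unfolding h_def by (intro continuous_intros)
  moreover have "h 1 \<le> 0" "0 \<le> h 0" using x y by (auto simp: h_def)
  ultimately obtain c where c: "0 \<le> c" "c \<le> 1" "h c = 0" using IVT2'[of h 1 0 0] by auto
  define a where "a = (1 - c) *\<^sub>R x + c *\<^sub>R y"
  have aC: "a \<in> Conv t X" using sub c by (force simp: a_def closed_segment_def)
  have "(a - p) \<bullet> e = 0" using c by (simp add: h_def a_def)
  moreover have "e \<noteq> 0" using e by auto
  moreover have "G \<noteq> 0" using G0 by auto
  ultimately obtain m where m: "a - p = m *\<^sub>R G" using parallel_if_orthogonal_to_common[of e G "a - p"] e by blast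
  have q: "\<bar>G \<bullet> (z - p)\<bar> \<le> 432 * t^2" if "z \<in> X" "norm (z - p) \<le> t" for z
  proof -
    have "(norm (z - p))^2 \<le> t^2" using that by (intro power_mono) auto
    then show ?thesis using normal_quadratic[OF p, of z] that X by (force simp: G_def)
  qed
  have "G \<bullet> (a - p) = (1 - c) * (G \<bullet> (x - p)) + c * (G \<bullet> (y - p))"
    by (simp add: a_def inner_add_right inner_diff_right algebra_simps)
  then have "\<bar>G \<bullet> (a - p)\<bar> \<le> (1 - c) * \<bar>G \<bullet> (x - p)\<bar> + c * \<bar>G \<bullet> (y - p)\<bar>"
    using abs_triangle_ineq[of "(1 - c) * (G \<bullet> (x - p))" "c * (G \<bullet> (y - p))"] c by (simp add: abs_mult)
  also have "\<dots> \<le> (1 - c) * (432 * t^2) + c * (432 * t^2)" using q x y c by (intro add_mono mult_left_mono) auto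
  also have "\<dots> = 432 * t^2" by (simp add: algebra_simps)
  finally have 1: "\<bar>G \<bullet> (a - p)\<bar> \<le> 432 * t^2" .
  have "norm G * norm (a - p) = \<bar>G \<bullet> (a - p)\<bar>" unfolding m
    by (simp add: abs_mult power2_norm_eq_inner[symmetric] power2_eq_square)
  moreover have "1/4 * norm (a - p) \<le> norm G * norm (a - p)" using G by (intro mult_right_mono) auto
  ultimately have "norm (a - p) \<le> 1728 * t^2" using 1 by linarith
  then show ?thesis using aC by (intro bexI[of _ a]) (auto simp: dist_norm norm_minus_commute)
qed

lemma Conv_nonempty: assumes "finite X" "X \<noteq> {}" "0 \<le> t" shows "Conv t X \<noteq> {}"
proof -
  obtain x where "x \<in> X" using assms by blast
  then have "convex hull {x} \<subseteq> Conv t X" using assms by (intro convex_hull_subset_Conv[of _ _ x]) auto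
  then show ?thesis by auto
qed

lemma bounded_Conv: assumes "X \<subseteq> M\<^sub>\<Omega>" shows "bounded (Conv t X)"
  using Conv_subset_Omega[OF assms] compact_imp_bounded[OF compact_Omega] bounded_subset by blast

lemma hausdorff_Conv_le:
  assumes X: "finite X" "X \<noteq> {}" "X \<subseteq> M\<^sub>\<Omega>" and S: "\<And>y. y \<in> M\<^sub>\<Omega> \<Longrightarrow> \<exists>x\<in>X. dist y x \<le> \<eta> * t"
    and \<eta>: "\<eta> < 1/3" and t: "0 < t" "t \<le> 1/20000"
  shows "hausdorff_dist (Conv t X) M\<^sub>\<Omega> \<le> 62208 * t^2"
proof (rule hausdorff_dist_le)
  fix x assume "x \<in> Conv t X"
  then obtain y where "y \<in> M\<^sub>\<Omega>" "dist x y \<le> 62208 * t^2" using Conv_near_M[OF X(1,3) t(1), of x] t by auto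
  then show "infdist x M\<^sub>\<Omega> \<le> 62208 * t^2" by (meson infdist_le2)
next
  fix y assume "y \<in> M\<^sub>\<Omega>"
  then obtain a where "a \<in> Conv t X" "dist y a \<le> 1728 * t^2" using M_near_Conv[OF X(1,3) S \<eta> t] by auto
  moreover have "1728 * t^2 \<le> 62208 * t^2" by simp
  ultimately show "infdist y (Conv t X) \<le> 62208 * t^2" by (meson infdist_le2 order_trans)
next
  show "Conv t X \<noteq> {}" using Conv_nonempty[OF X(1,2)] t by simp
qed (rule M_nonempty)

subsection \<open>The upper arc as a graph\<close>

text \<open>The height of the upper arc over \<open>\<bar>x\<bar> < 3\<close>: the solution
  \<open>y > 1\<close> of \<open>qq 2 x + (y - 1)^4 = 1\<close>.\<close>

definition qt :: "real \<Rightarrow> real" where "qt x = 1 + (1 - qq 2 x) powr (1/4)"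

definition dqt :: "real \<Rightarrow> real" where "dqt x = - dqq 2 x / (4 * (qt x - 1)^3)"

lemma qq2_less_1: assumes "\<bar>x\<bar> < 3" shows "qq 2 x < 1"
proof -
  have "(max (\<bar>x\<bar> - 2) 0)^4 < 1^4" using assms by (intro power_strict_mono) auto
  then show ?thesis by (simp add: qq_abs)
qed

lemma qt_gt_1: "\<bar>x\<bar> < 3 \<Longrightarrow> 1 < qt x" using qq2_less_1[of x] by (simp add: qt_def)

lemma powr_quarter_power: "0 < z \<Longrightarrow> (z powr (1/4))^4 = (z::real)"
  using powr_realpow[of "z powr (1/4)" 4] by (simp add: powr_powr)

lemma qt_power: "\<bar>x\<bar> < 3 \<Longrightarrow> (qt x - 1)^4 = 1 - qq 2 x"
  using qq2_less_1[of x] by (simp add: qt_def powr_quarter_power)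

lemma qt_le_2: assumes "\<bar>x\<bar> < 3" shows "qt x \<le> 2"
proof (rule ccontr)
  assume "\<not> qt x \<le> 2"
  then have "1^4 < (qt x - 1)^4" by (intro power_strict_mono) auto
  then show False using qt_power[OF assms] qq_nonneg[of 2 x] by simp
qed

lemma pt_top_in_M_iff:
  assumes "\<bar>x\<bar> < 3" "1 < y" shows "pt x y \<in> M\<^sub>\<Omega> \<longleftrightarrow> y = qt x"
proof -
  have p: "0 \<le> y - 1" "0 \<le> qt x - 1" using assms(2) qt_gt_1[OF assms(1)] by linarith+
  have "pt x y \<in> M\<^sub>\<Omega> \<longleftrightarrow> (y - 1)^4 = (qt x - 1)^4"
    unfolding top_point_iff[OF assms(2)] qt_power[OF assms(1)] by linarith
  also have "\<dots> \<longleftrightarrow> y - 1 = qt x - 1" by (rule power_eq_iff_eq_base[OF _ p]) simp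
  finally show ?thesis by simp
qed

lemma qt_in_M: "\<bar>x\<bar> < 3 \<Longrightarrow> pt x (qt x) \<in> M\<^sub>\<Omega>"
  using pt_top_in_M_iff[of x "qt x"] qt_gt_1 by blast

lemma DERIV_qt: assumes "\<bar>x\<bar> < 3" shows "(qt has_real_derivative dqt x) (at x)"
proof -
  let ?z = "1 - qq 2 x"
  have z: "0 < ?z" using qq2_less_1[OF assms] by simp
  have "((\<lambda>x. 1 - qq 2 x) has_real_derivative (0 - dqq 2 x)) (at x)"
    by (intro DERIV_diff DERIV_const DERIV_qq)
  then have "((\<lambda>x. (1 - qq 2 x) powr (1/4)) has_real_derivative (1/4 * ?z powr (1/4 - of_nat 1) * (0 - dqq 2 x))) (at x)"
    by (rule DERIV_fun_powr[where g="\<lambda>x. 1 - qq 2 x", OF _ z])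
  then have "(qt has_real_derivative (0 + 1/4 * ?z powr (1/4 - of_nat 1) * (0 - dqq 2 x))) (at x)"
    unfolding qt_def[abs_def] by (intro DERIV_add DERIV_const)
  moreover have "?z powr (1/4 - of_nat 1) = 1 / (qt x - 1)^3"
    using z powr_realpow[of "?z powr (1/4)" 3] by (simp add: qt_def powr_powr powr_minus_divide[of _ "3/4", simplified])
  ultimately show ?thesis by (simp add: dqt_def mult.commute)
qed

lemma qt_flat: "\<bar>x\<bar> \<le> 2 \<Longrightarrow> qt x = 2" "\<bar>x\<bar> \<le> 2 \<Longrightarrow> dqt x = 0"
  by (simp_all add: qt_def dqt_def qq_abs) (simp add: dqq_def)

lemma qt_corner:
  assumes "2 \<le> x" "x \<le> 5/2"
  shows "qt x \<ge> 3/2" "dqt x = - ((x - 2)^3) / (qt x - 1)^3"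
proof -
  have qx: "qq 2 x = (x - 2)^4" using assms by (simp add: qq_abs)
  have "(x - 2)^4 \<le> (1/2)^4" using assms by (intro power_mono) auto
  then have "qq 2 x \<le> 1/16" by (simp add: qx power_divide)
  then have "(1/2)^4 \<le> (qt x - 1)^4" using qt_power[of x] assms by (simp add: power_divide)
  then show "qt x \<ge> 3/2" using power_mono_iff[of "1/2" "qt x - 1" 4] qt_gt_1[of x] assms by simp
  show "dqt x = - ((x - 2)^3) / (qt x - 1)^3" using assms by (simp add: dqt_def dqq_def)
qed

text \<open>The left side is the quotient rule for \<open>dqt\<close>, with \<open>w = x - 2\<close>
  and \<open>Q = qt x - 1\<close>. One more factor \<open>Q\<close> in the numerator produces
  \<open>Q^4 + w^4\<close>, which is 1 on the curve.\<close>

lemma corner_second_derivative_eq: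
  fixes w Q :: real
  assumes Q: "0 < Q" and q4: "Q^4 = 1 - w^4"
  shows "(- (12 * w^2) * (4 * Q^3) - (- (4 * w^3)) * (4 * (3 * Q^2 * (- (w^3) / Q^3)))) / ((4 * Q^3) * (4 * Q^3)) = - 3 * w^2 / Q^7"
proof -
  define d where "d = - (w^3) / Q^3"
  have d: "d * Q^3 = - (w^3)" using Q by (simp add: d_def)
  define N where "N = - (12 * w^2) * (4 * Q^3) - (- (4 * w^3)) * (4 * (3 * Q^2 * d))"
  have "N * Q = - 48 * w^2 * (Q^4 + w^4)" using d unfolding N_def by algebra
  then have N: "N * Q = - 48 * w^2" using q4 by simp
  have "N / ((4 * Q^3) * (4 * Q^3)) = (N * Q) / (16 * Q^7)" using Q by (simp add: divide_simps) algebra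
  also have "\<dots> = - 3 * w^2 / Q^7" unfolding N by simp
  finally show ?thesis unfolding N_def d_def .
qed

lemma DERIV_dqt:
  assumes "2 \<le> x" "x \<le> 5/2"
  shows "(dqt has_real_derivative - 3 * (x - 2)^2 / (qt x - 1)^7) (at x)"
proof -
  let ?w = "x - 2" and ?Q = "qt x - 1"
  have Q: "?Q > 0" using qt_corner(1)[OF assms] by simp
  have q4: "?Q^4 = 1 - ?w^4" using qt_power[of x] assms by (simp add: qq_abs)
  have d: "(dqq 2 has_real_derivative 12 * ?w^2) (at x)" using DERIV_dqq[of 2 x] assms by simp
  have d1: "((\<lambda>x. - dqq 2 x) has_real_derivative - (12 * ?w^2)) (at x)" by (rule DERIV_minus[OF d])
  have d2: "((\<lambda>x. 4 * (qt x - 1)^3) has_real_derivative 4 * (3 * ?Q^2 * (dqt x))) (at x)"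
    using DERIV_qt[of x] assms by (auto intro!: derivative_eq_intros)
  have "(dqt has_real_derivative (- (12 * ?w^2) * (4 * ?Q^3) - (- dqq 2 x) * (4 * (3 * ?Q^2 * (dqt x)))) / ((4 * ?Q^3) * (4 * ?Q^3))) (at x)"
    unfolding dqt_def[abs_def] using Q by (intro DERIV_divide d1 d2[unfolded dqt_def]) auto
  moreover have "dqq 2 x = 4 * ?w^3" using assms by (simp add: dqq_def)
  moreover note corner_second_derivative_eq[OF Q q4]
  ultimately show ?thesis by (simp add: qt_corner(2)[OF assms])
qed

text \<open>In this range \<open>qt x - 1\<close> lies between 1/2 and 1. So the second derivative
  is at most 96 in absolute value, and its absolute value is at least \<open>3 * (x - 2)^2\<close>:
  the curvature vanishes only at the junction \<open>x = 2\<close>.\<close>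

lemma dqt_bounds:
  assumes "2 \<le> x" "x \<le> 5/2"
  shows "\<bar>dqt x\<bar> \<le> 8 * (x - 2)^3" "3 * (x - 2)^2 / (qt x - 1)^7 \<le> 96" "3 * (x - 2)^2 \<le> 3 * (x - 2)^2 / (qt x - 1)^7"
proof -
  let ?w = "x - 2" and ?Q = "qt x - 1"
  have Q: "1/2 \<le> ?Q" "?Q \<le> 1" using qt_corner(1)[OF assms] qt_le_2[of x] assms by auto
  have Q3: "(1/2)^3 \<le> ?Q^3" and Q7: "(1/2)^7 \<le> ?Q^7" using Q by (auto intro!: power_mono)
  have w: "0 \<le> ?w^3" "?w^2 \<le> (1/2)^2" using assms by (auto intro!: power_mono)
  have "\<bar>dqt x\<bar> = ?w^3 / ?Q^3" using qt_corner(2)[OF assms] w Q by (simp add: abs_div_pos)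
  also have "\<dots> \<le> ?w^3 / (1/2)^3" using Q3 w Q by (intro divide_left_mono mult_pos_pos zero_less_power) auto
  finally show "\<bar>dqt x\<bar> \<le> 8 * ?w^3" by (simp add: power_divide)
  have "3 * ?w^2 / ?Q^7 \<le> (3 * (1/2)^2) / (1/2)^7" using Q7 w by (intro frac_le) auto
  then show "3 * ?w^2 / ?Q^7 \<le> 96" by (simp add: power_divide)
  have "?Q^7 \<le> 1" "0 < ?Q^7" using Q by (auto intro!: power_le_one)
  then show "3 * ?w^2 \<le> 3 * ?w^2 / ?Q^7" by (simp add: le_divide_eq mult_left_le)
qed

subsection \<open>Hulls of sample points on a concave graph\<close>

text \<open>\<open>L\<close> bounds the variation of the slope from above, \<open>k\<close> is a
  modulus of strict concavity and \<open>m\<close> bounds the slope. The first controls errors, the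
  second the thickness of triangles, the third chord lengths.\<close>

locale concave_graph =
  fixes q q' :: "real \<Rightarrow> real" and a b L k m :: real
  assumes deriv: "\<And>x. x \<in> {a..b} \<Longrightarrow> (q has_real_derivative q' x) (at x)"
    and lip: "\<And>x y. x \<in> {a..b} \<Longrightarrow> y \<in> {a..b} \<Longrightarrow> \<bar>q' x - q' y\<bar> \<le> L * \<bar>x - y\<bar>"
    and conc: "\<And>x y. x \<in> {a..b} \<Longrightarrow> y \<in> {a..b} \<Longrightarrow> x \<le> y \<Longrightarrow> q' y + k * (y - x) \<le> q' x"
    and slope: "\<And>x. x \<in> {a..b} \<Longrightarrow> \<bar>q' x\<bar> \<le> m"
    and pos: "0 < L" "0 < k" "0 \<le> m"
begin

definition sl :: "real \<Rightarrow> real \<Rightarrow> real" where "sl x y = (q y - q x) / (y - x)"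

lemma sl_mvt: assumes "a \<le> x" "x < y" "y \<le> b" obtains z where "x < z" "z < y" "sl x y = q' z"
proof -
  have "\<And>z. x \<le> z \<Longrightarrow> z \<le> y \<Longrightarrow> (q has_real_derivative q' z) (at z)" using deriv assms by auto
  from MVT2[OF assms(2) this] obtain z where "x < z" "z < y" "q y - q x = (y - x) * q' z" by auto
  then show ?thesis using that assms by (simp add: sl_def)
qed

lemma sl_near:
  assumes "a \<le> x" "x < y" "y \<le> b" "a \<le> u" "u \<le> b" "\<bar>x - u\<bar> \<le> t" "\<bar>y - u\<bar> \<le> t"
  shows "\<bar>sl x y - q' u\<bar> \<le> L * t"
proof -
  obtain z where z: "x < z" "z < y" "sl x y = q' z" using sl_mvt[OF assms(1-3)] by blast
  have "\<bar>q' z - q' u\<bar> \<le> L * \<bar>z - u\<bar>" using z assms by (intro lip) auto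
  also have "\<dots> \<le> L * t" using z assms pos by (intro mult_left_mono) auto
  finally show ?thesis by (simp add: z)
qed

lemma sl_eq: "x \<noteq> y \<Longrightarrow> q y = q x + sl x y * (y - x)" by (simp add: sl_def)

text \<open>The mean value theorem applied to the concave function \<open>q x + k x\<^sup>2 / 2\<close> on both sides of \<open>y\<close>.\<close>

lemma sl_gap:
  assumes "a \<le> x" "x < y" "y < z" "z \<le> b"
  shows "k / 2 * (z - x) \<le> sl x y - sl y z"
proof -
  define h where "h u = q u + k / 2 * u^2" for u
  have h: "(h has_real_derivative q' u + k * u) (at u)" if "a \<le> u" "u \<le> b" for u
    unfolding h_def using deriv[of u] that by (auto intro!: derivative_eq_intros)
  obtain u where u: "x < u" "u < y" "h y - h x = (y - x) * (q' u + k * u)"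
    using MVT2[OF assms(2), of h "\<lambda>u. q' u + k * u"] h assms by auto
  obtain v where v: "y < v" "v < z" "h z - h y = (z - y) * (q' v + k * v)"
    using MVT2[OF assms(3), of h "\<lambda>u. q' u + k * u"] h assms by auto
  have 1: "sl x y + k / 2 * (x + y) = q' u + k * u"
    using u assms unfolding sl_def h_def by (simp add: field_simps power2_eq_square)
  have 2: "sl y z + k / 2 * (y + z) = q' v + k * v"
    using v assms unfolding sl_def h_def by (simp add: field_simps power2_eq_square)
  have "q' v + k * (v - u) \<le> q' u" using u v assms by (intro conc) auto
  then have "q' v + k * v \<le> q' u + k * u" by (simp add: right_diff_distrib)
  moreover have "k / 2 * (y + z) = k / 2 * (x + y) + k / 2 * (z - x)" by (simp add: field_simps)
  ultimately show ?thesis using 1 2 by linarith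
qed

lemma taylor:
  assumes "x \<in> {a..b}" "x + d \<in> {a..b}"
  shows "\<bar>q (x + d) - q x - q' x * d\<bar> \<le> L * d^2"
proof -
  have *: "\<bar>q y - q z - q' x * (y - z)\<bar> \<le> L * \<bar>y - z\<bar> * \<bar>y - z\<bar>"
    if "a \<le> z" "z < y" "y \<le> b" "x = z \<or> x = y" for y z
  proof -
    have "\<bar>sl z y - q' x\<bar> \<le> L * (y - z)" using that by (intro sl_near) auto
    then have "\<bar>(sl z y - q' x) * (y - z)\<bar> \<le> L * (y - z) * (y - z)" using that by (simp add: abs_mult mult_right_mono)
    then show ?thesis using sl_eq[of z y] that by (simp add: algebra_simps)
  qed
  consider "d = 0" | "d > 0" | "d < 0" by linarith
  then show ?thesis
  proof cases
    case 2 then show ?thesis using *[of x "x + d"] assms by (simp add: power2_eq_square)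
  next
    case 3
    have "\<bar>q x - q (x + d) - q' x * (x - (x + d))\<bar> \<le> L * \<bar>x - (x + d)\<bar> * \<bar>x - (x + d)\<bar>"
      using *[of "x + d" x] assms 3 by simp
    moreover have "q x - q (x + d) - q' x * (x - (x + d)) = - (q (x + d) - q x - q' x * d)" by (simp add: algebra_simps)
    ultimately show ?thesis by (simp only: abs_minus_cancel) (simp add: power2_eq_square abs_mult_self_eq mult.assoc)
  qed simp
qed

lemma q_lipschitz:
  assumes "x \<in> {a..b}" "y \<in> {a..b}" shows "\<bar>q y - q x\<bar> \<le> m * \<bar>y - x\<bar>"
proof -
  have *: "\<bar>q y - q x\<bar> \<le> m * \<bar>y - x\<bar>" if h: "a \<le> x" "x < y" "y \<le> b" for x y
  proof -
    obtain z where z: "x < z" "z < y" "sl x y = q' z" using sl_mvt[OF h] by blast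
    have "\<bar>sl x y\<bar> * \<bar>y - x\<bar> \<le> m * \<bar>y - x\<bar>" unfolding z(3) using z h by (intro mult_right_mono slope) auto
    then show ?thesis using sl_eq[of x y] h by (simp add: abs_mult)
  qed
  then show ?thesis using *[of x y] *[of y x] assms by (cases x y rule: linorder_cases) (auto simp: abs_minus_commute)
qed


text \<open>The slice at \<open>x\<close> of the triangle spanned by three points of the graph, with abscissas \<open>u < v < w\<close>;
  \<open>u\<close> and \<open>w\<close> lie on different sides of \<open>x\<close>.\<close>

lemma triangle_slice:
  assumes ord: "a \<le> u" "u + c \<le> v" "v + c \<le> w" "w \<le> b" and x: "u + c \<le> x" "x + c \<le> w" and c: "0 < c"
    and t: "x - t \<le> u" "w \<le> x + t"
    and A: "convex hull {pt u (q u), pt v (q v), pt w (q w)} \<subseteq> A"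
  shows "\<exists>yl yu. q x - 2 * L * t^2 \<le> yl \<and> yl + k / 2 * c^2 \<le> yu \<and> yu \<le> q x \<and>
    (\<forall>y\<in>{yl..yu}. pt x y \<in> A) \<and>
    (\<forall>d. \<bar>d\<bar> \<le> c \<longrightarrow> (\<exists>y. pt (x + d) y \<in> A \<and> \<bar>y - yu - q' x * d\<bar> \<le> L * t * \<bar>d\<bar>)
       \<and> (\<exists>y. pt (x + d) y \<in> A \<and> \<bar>y - yl - q' x * d\<bar> \<le> L * t * \<bar>d\<bar>))"
proof -
  have o: "u < v" "v < w" "u < x" "x < w" "u < w" "a \<le> x" "x \<le> b" "0 < t" using ord x c t by linarith+
  let ?H = "convex hull {pt u (q u), pt v (q v), pt w (q w)}"
  have vert: "pt u (q u) \<in> ?H" "pt v (q v) \<in> ?H" "pt w (q w) \<in> ?H" by (simp_all add: hull_inc)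
  have seg: "pt z (q y1 + sl y1 y2 * (z - y1)) \<in> ?H"
    if y: "pt y1 (q y1) \<in> ?H" "pt y2 (q y2) \<in> ?H" "y1 < y2" "y1 \<le> z" "z \<le> y2" for y1 y2 z
  proof -
    define l where "l = (z - y1) / (y2 - y1)"
    have l: "0 \<le> l" "l \<le> 1" using y by (auto simp: l_def)
    have lz: "l * (y2 - y1) = z - y1" using y by (simp add: l_def)
    have "q y2 - q y1 = sl y1 y2 * (y2 - y1)" using y by (simp add: sl_def)
    then have "(1 - l) * q y1 + l * q y2 = q y1 + sl y1 y2 * (l * (y2 - y1))" by algebra
    moreover have "(1 - l) * y1 + l * y2 = z" using lz by algebra
    ultimately have "(1 - l) *\<^sub>R pt y1 (q y1) + l *\<^sub>R pt y2 (q y2) = pt z (q y1 + sl y1 y2 * (z - y1))"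
      unfolding lz by (simp add: vec_eq_iff forall_2)
    moreover have "(1 - l) *\<^sub>R pt y1 (q y1) + l *\<^sub>R pt y2 (q y2) \<in> ?H"
      using convexD[OF convex_convex_hull y(1,2)] l by simp
    ultimately show ?thesis by simp
  qed
  define s1 where "s1 = sl u v"
  define s2 where "s2 = sl v w"
  define s3 where "s3 = sl u w"
  have s: "\<bar>s1 - q' x\<bar> \<le> L * t" "\<bar>s2 - q' x\<bar> \<le> L * t" "\<bar>s3 - q' x\<bar> \<le> L * t"
    unfolding s1_def s2_def s3_def using ord o t by (intro sl_near; linarith)+
  have g: "k / 2 * (w - u) \<le> s1 - s2" unfolding s1_def s2_def using ord o by (intro sl_gap) auto
  have qv: "q v = q u + s1 * (v - u)" "q w = q v + s2 * (w - v)" "q w = q u + s3 * (w - u)"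
    unfolding s1_def s2_def s3_def using o by (auto simp: sl_def)
  \<comment> \<open>The upper boundary of the triangle: since \<open>s2 \<le> s1\<close>, the
    minimum picks the left chord before \<open>v\<close> and the right chord after it. As a minimum
    of two lines it inherits their slope estimates without cases.\<close>
  define pu where "pu z = min (q v + s1 * (z - v)) (q v + s2 * (z - v))" for z
  define pl where "pl z = q u + s3 * (z - u)" for z
  have s12: "s2 \<le> s1" using g mult_pos_pos[of "k/2" "w - u"] pos o by linarith
  have pu1: "pu z = q v + s1 * (z - v)" if "z \<le> v" for z
    using mult_right_mono_neg[OF s12, of "z - v"] that by (simp add: pu_def min_def)
  have pu2: "pu z = q v + s2 * (z - v)" if "v \<le> z" for z
    using mult_right_mono[OF s12, of "z - v"] that by (simp add: pu_def min_def)
  have puH: "pt z (pu z) \<in> ?H" if "u \<le> z" "z \<le> w" for z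
  proof (cases "z \<le> v")
    case True
    have "pu z = q u + sl u v * (z - u)" using pu1[OF True] qv(1) unfolding s1_def by algebra
    then show ?thesis using seg[OF vert(1,2), of z] o that True by simp
  next
    case False
    then have "pu z = q v + sl v w * (z - v)" using pu2[of z] by (simp add: s2_def)
    then show ?thesis using seg[OF vert(2,3), of z] o that False by simp
  qed
  have plH: "pt z (pl z) \<in> ?H" if "u \<le> z" "z \<le> w" for z
    using seg[OF vert(1,3), of z] o that by (simp add: pl_def s3_def)
  \<comment> \<open>The height of the triangle over \<open>x\<close> times its width is the drop of
    slope times two horizontal lengths, each at least \<open>c\<close>; \<open>sl_gap\<close> bounds
    the drop by a multiple of the width, which then cancels.\<close>
  have gap: "k / 2 * c^2 \<le> pu x - pl x"
  proof (cases "x \<le> v")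
    case True
    have e: "(pu x - pl x) * (w - u) = (s1 - s2) * (w - v) * (x - u)"
      using qv unfolding pu1[OF True] pl_def by algebra
    have "k / 2 * c^2 * (w - u) = k / 2 * (w - u) * c * c" by algebra
    also have "\<dots> \<le> (s1 - s2) * (w - v) * (x - u)"
      using g ord x c pos o s12 by (intro mult_mono mult_nonneg_nonneg) auto
    finally show ?thesis using o by (simp flip: e)
  next
    case False
    then have vx: "v \<le> x" by simp
    have e: "(pu x - pl x) * (w - u) = (s1 - s2) * (v - u) * (w - x)"
      using qv unfolding pu2[OF vx] pl_def by algebra
    have "k / 2 * c^2 * (w - u) = k / 2 * (w - u) * c * c" by algebra
    also have "\<dots> \<le> (s1 - s2) * (v - u) * (w - x)"
      using g ord x c pos o s12 by (intro mult_mono mult_nonneg_nonneg) auto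
    finally show ?thesis using o by (simp flip: e)
  qed
  have up: "pu x \<le> q x"
  proof (cases "x < v")
    case True
    have "0 \<le> k / 2 * (v - u)" using pos o by simp
    then have "sl x v \<le> sl u x" using sl_gap[of u x v] ord o True by linarith
    moreover have "s1 * (v - u) = sl u x * (x - u) + sl x v * (v - x)"
      unfolding s1_def using o True by (simp add: sl_def)
    ultimately have "s1 * (v - u) \<le> sl u x * (x - u) + sl u x * (v - x)"
      using True mult_right_mono[of "sl x v" "sl u x" "v - x"] by simp
    also have "\<dots> = sl u x * (v - u)" by algebra
    finally have "s1 \<le> sl u x" using o by simp
    then have "s1 * (x - u) \<le> sl u x * (x - u)" using o by (intro mult_right_mono) auto
    moreover have "q x = q u + sl u x * (x - u)" using o by (intro sl_eq) auto
    moreover have "pu x = q u + s1 * (x - u)" using pu1[of x] qv(1) True by (simp add: algebra_simps)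
    ultimately show ?thesis by simp
  next
    case False
    show ?thesis
    proof (cases "x = v")
      case True then show ?thesis by (simp add: pu_def)
    next
      case ne: False
      have vx: "v < x" using False ne by simp
      have "0 \<le> k / 2 * (w - v)" using pos o by simp
      then have "sl x w \<le> sl v x" using sl_gap[of v x w] ord o vx by linarith
      moreover have "s2 * (w - v) = sl v x * (x - v) + sl x w * (w - x)"
        unfolding s2_def using o vx by (simp add: sl_def)
      ultimately have "s2 * (w - v) \<le> sl v x * (x - v) + sl v x * (w - x)"
        using o mult_right_mono[of "sl x w" "sl v x" "w - x"] by simp
      also have "\<dots> = sl v x * (w - v)" by algebra
      finally have "s2 \<le> sl v x" using o by simp
      then have "s2 * (x - v) \<le> sl v x * (x - v)" using vx by (intro mult_right_mono) auto
      moreover have "q x = q v + sl v x * (x - v)" using vx by (intro sl_eq) auto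
      ultimately show ?thesis using pu2[of x] vx by simp
    qed
  qed
  have low: "q x - 2 * L * t^2 \<le> pl x"
  proof -
    have "q x = q u + sl u x * (x - u)" using o by (intro sl_eq) auto
    then have e: "q x - pl x = (sl u x - s3) * (x - u)" by (simp add: pl_def algebra_simps)
    have "\<bar>sl u x - q' x\<bar> \<le> L * t" using ord o t by (intro sl_near) auto
    then have "sl u x - s3 \<le> 2 * (L * t)" using s(3) by linarith
    then have "(sl u x - s3) * (x - u) \<le> 2 * (L * t) * (x - u)" using o by (intro mult_right_mono) auto
    also have "\<dots> \<le> 2 * (L * t) * t" using pos o t by (intro mult_left_mono) auto
    also have "\<dots> = 2 * L * t^2" by (simp add: power2_eq_square)
    finally show ?thesis using e by linarith
  qed
  have slice: "pt x y \<in> A" if "y \<in> {pl x..pu x}" for y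
  proof -
    have "pt x y \<in> closed_segment (pt x (pl x)) (pt x (pu x))"
    proof -
      have "y \<in> closed_segment (pl x) (pu x)" using that by (simp add: closed_segment_eq_real_ivl)
      then obtain l where "0 \<le> l" "l \<le> 1" "y = (1 - l) *\<^sub>R pl x + l *\<^sub>R pu x" unfolding closed_segment_def by blast
      moreover from this have "pt x y = (1 - l) *\<^sub>R pt x (pl x) + l *\<^sub>R pt x (pu x)"
        by (simp add: vec_eq_iff forall_2 algebra_simps)
      ultimately show ?thesis unfolding closed_segment_def by blast
    qed
    also have "\<dots> \<subseteq> ?H" using plH[of x] puH[of x] o by (intro closed_segment_subset convex_convex_hull) auto
    finally show ?thesis using A by blast
  qed
  have dl: "\<bar>pl (x + d) - pl x - q' x * d\<bar> \<le> L * t * \<bar>d\<bar>" for d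
  proof -
    have "pl (x + d) - pl x - q' x * d = (s3 - q' x) * d" by (simp add: pl_def algebra_simps)
    then show ?thesis using mult_right_mono[OF s(3), of "\<bar>d\<bar>"] by (simp add: abs_mult)
  qed
  have du: "\<bar>pu (x + d) - pu x - q' x * d\<bar> \<le> L * t * \<bar>d\<bar>" for d
  proof -
    have 1: "\<bar>(s1 - q' x) * d\<bar> \<le> L * t * \<bar>d\<bar>" "\<bar>(s2 - q' x) * d\<bar> \<le> L * t * \<bar>d\<bar>"
      using mult_right_mono[OF s(1), of "\<bar>d\<bar>"] mult_right_mono[OF s(2), of "\<bar>d\<bar>"] by (simp_all add: abs_mult)
    have minlip: "\<bar>min p1 p2 - min r1 r2 - e\<bar> \<le> B"
      if "\<bar>p1 - r1 - e\<bar> \<le> B" "\<bar>p2 - r2 - e\<bar> \<le> B" for p1 p2 r1 r2 e B :: real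
      using that by linarith
    show ?thesis unfolding pu_def
    proof (rule minlip)
      have "q v + s1 * (x + d - v) - (q v + s1 * (x - v)) - q' x * d = (s1 - q' x) * d" by algebra
      then show "\<bar>q v + s1 * (x + d - v) - (q v + s1 * (x - v)) - q' x * d\<bar> \<le> L * t * \<bar>d\<bar>" using 1 by simp
      have "q v + s2 * (x + d - v) - (q v + s2 * (x - v)) - q' x * d = (s2 - q' x) * d" by algebra
      then show "\<bar>q v + s2 * (x + d - v) - (q v + s2 * (x - v)) - q' x * d\<bar> \<le> L * t * \<bar>d\<bar>" using 1 by simp
    qed
  qed
  have shift: "(\<exists>y. pt (x + d) y \<in> A \<and> \<bar>y - pu x - q' x * d\<bar> \<le> L * t * \<bar>d\<bar>)
       \<and> (\<exists>y. pt (x + d) y \<in> A \<and> \<bar>y - pl x - q' x * d\<bar> \<le> L * t * \<bar>d\<bar>)" if "\<bar>d\<bar> \<le> c" for d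
  proof -
    have d: "u \<le> x + d" "x + d \<le> w" using that x by linarith+
    show ?thesis using puH[OF d] plH[OF d] A du dl by blast
  qed
  have "pl x + k / 2 * c^2 \<le> pu x" using gap by simp
  then show ?thesis using up low slice shift by blast
qed

text \<open>A point at vertical offset \<open>v\<close> from a line of slope \<open>m0\<close> has
  distance \<open>v / sqrt (1 + m0^2)\<close> from it. For \<open>v \<le> c * t\<close> the boundary
  of the triangle follows this line as far as the foot. For larger \<open>v\<close> the foot may
  have left the triangle, and a point of \<open>A\<close> near the graph replaces it; the error of
  order \<open>t^2\<close> is then at most of order \<open>t * v / c\<close>.\<close>

lemma infdist_slice_end:
  assumes c: "0 < c" and t: "0 < t" and x: "a + h \<le> x" "x + h \<le> b" and v: "0 \<le> v" "v \<le> h" and C1: "0 \<le> C1"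
    and near: "\<And>z. z \<in> {a..b} \<Longrightarrow> \<exists>p\<in>A. dist (pt z (q z)) p \<le> C1 * t^2"
    and y0: "\<bar>y0 - q x\<bar> \<le> 2 * L * t^2"
    and shift: "\<And>d. \<bar>d\<bar> \<le> c * t \<Longrightarrow> \<exists>y. pt (x + d) y \<in> A \<and> \<bar>y - y0 - q' x * d\<bar> \<le> L * t * \<bar>d\<bar>"
    and \<sigma>: "\<sigma> = 1 \<or> \<sigma> = -1"
  shows "infdist (pt x (y0 + \<sigma> * v)) A \<le> v * (1 / sqrt (1 + (q' x)^2) + (L + 2 * L / c + C1 / c) * (t + v))"
proof -
  define m0 where "m0 = q' x"
  define D where "D = 1 + m0^2"
  have D: "1 \<le> D" by (simp add: D_def)
  \<comment> \<open>\<open>(d, m0 d)\<close> is the foot of the perpendicular from \<open>(0, \<sigma> v)\<close> on the line of slope \<open>m0\<close>\<close>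
  define d where "d = \<sigma> * v * m0 / D"
  have dD: "d * D = \<sigma> * v * m0" using D by (simp add: d_def)
  have s2: "\<sigma>^2 = 1" using \<sigma> by auto
  have e1: "(\<sigma> * v - m0 * d) * D = \<sigma> * v" using dD D_def by algebra
  have "(d^2 + (\<sigma> * v - m0 * d)^2) * D^2 = (d * D)^2 + ((\<sigma> * v - m0 * d) * D)^2" by algebra
  also have "\<dots> = v^2 * D" unfolding dD e1 by (simp add: power_mult_distrib s2 D_def distrib_left)
  finally have "(d^2 + (\<sigma> * v - m0 * d)^2) * D^2 = v^2 * D" .
  then have "(d^2 + (\<sigma> * v - m0 * d)^2) * D = v^2" using D by (simp add: power2_eq_square)
  then have nn: "d^2 + (\<sigma> * v - m0 * d)^2 = v^2 / D" using D by (simp add: field_simps)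
  have n: "norm (pt (- d) (\<sigma> * v - m0 * d)) = v * (1 / sqrt D)"
    using v D nn by (simp add: norm2 real_sqrt_divide)
  have "\<bar>m0\<bar> \<le> D"
  proof -
    have "0 \<le> (\<bar>m0\<bar> - 1)^2" by simp
    also have "\<dots> = m0^2 - 2 * \<bar>m0\<bar> + 1" by (simp add: power2_diff)
    finally show ?thesis unfolding D_def using abs_ge_zero[of m0] by linarith
  qed
  then have "v * \<bar>m0\<bar> \<le> v * D" using v by (intro mult_left_mono) auto
  moreover have "\<bar>d\<bar> * D = \<bar>d * D\<bar>" using D by (simp add: abs_mult)
  moreover have "\<bar>d * D\<bar> = v * \<bar>m0\<bar>" unfolding dD abs_mult using \<sigma> v by auto
  ultimately have "\<bar>d\<bar> * D \<le> v * D" by simp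
  then have dv: "\<bar>d\<bar> \<le> v" using D by simp
  have split: "dist (pt x (y0 + \<sigma> * v)) (pt (x + d) y) \<le> v * (1 / sqrt D) + \<bar>y - y0 - m0 * d\<bar>" for y
  proof -
    have "pt x (y0 + \<sigma> * v) - pt (x + d) y = pt (- d) (\<sigma> * v - m0 * d) + pt 0 (- (y - y0 - m0 * d))"
      by (simp add: vec_eq_iff forall_2)
    moreover have "norm (pt 0 (- (y - y0 - m0 * d))) = \<bar>y - y0 - m0 * d\<bar>" by (simp add: norm2)
    ultimately show ?thesis using norm_triangle_ineq[of "pt (- d) (\<sigma> * v - m0 * d)" "pt 0 (- (y - y0 - m0 * d))"] n
      by (simp add: dist_norm)
  qed
  have L: "0 < L" using pos by simp
  show ?thesis
  proof (cases "v \<le> c * t")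
    case True
    then have "\<bar>d\<bar> \<le> c * t" using dv by linarith
    then obtain y where y: "pt (x + d) y \<in> A" "\<bar>y - y0 - m0 * d\<bar> \<le> L * t * \<bar>d\<bar>" using shift[of d] by (auto simp: m0_def)
    have "infdist (pt x (y0 + \<sigma> * v)) A \<le> v * (1 / sqrt D) + L * t * \<bar>d\<bar>"
      using infdist_le2[OF y(1) split[of y]] y(2) by linarith
    also have "L * t * \<bar>d\<bar> \<le> L * t * v" using dv L t by (intro mult_left_mono) auto
    also have "L * t * v = v * (L * t)" by simp
    also have "v * (L * t) \<le> v * ((L + 2 * L / c + C1 / c) * (t + v))"
      using L c C1 t v by (intro mult_left_mono mult_mono) auto
    finally show ?thesis by (simp add: D_def m0_def distrib_left)
  next
    case False
    have xd: "x \<in> {a..b}" "x + d \<in> {a..b}" using dv x v by auto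
    obtain p where p: "p \<in> A" "dist (pt (x + d) (q (x + d))) p \<le> C1 * t^2" using near[OF xd(2)] by blast
    have "\<bar>q (x + d) - q x - m0 * d\<bar> \<le> L * d^2" using taylor[OF xd] by (simp add: m0_def)
    also have "\<dots> \<le> L * v^2" using dv L v by (intro mult_left_mono) (auto intro: power2_le_iff_abs_le[THEN iffD2])
    finally have "\<bar>q (x + d) - y0 - m0 * d\<bar> \<le> L * v^2 + 2 * L * t^2" using y0 by linarith
    then have "infdist (pt x (y0 + \<sigma> * v)) A \<le> v * (1 / sqrt D) + (L * v^2 + 2 * L * t^2) + C1 * t^2"
      using infdist_le2[OF p(1) order_trans[OF dist_triangle add_mono[OF split p(2)]]] by linarith
    also have "\<dots> = v * (1 / sqrt D) + (L * v^2 + (2 * L + C1) * t^2)" by (simp add: algebra_simps)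
    also have "(2 * L + C1) * t^2 \<le> (2 * L + C1) * (t * (v / c))"
    proof (rule mult_left_mono)
      have "t \<le> v / c" using False c by (simp add: field_simps)
      then show "t^2 \<le> t * (v / c)" using mult_left_mono[of t "v / c" t] t by (simp only: power2_eq_square)
    qed (use L C1 in auto)
    also have "L * v^2 + (2 * L + C1) * (t * (v / c)) = v * (L * v + (2 * L / c + C1 / c) * t)"
      using c by (simp add: field_simps power2_eq_square)
    also have "\<dots> \<le> v * ((L + 2 * L / c + C1 / c) * (t + v))"
    proof (intro mult_left_mono v)
      have gen: "L * v + E * t \<le> (L + E) * (t + v)" if "0 \<le> L * t" "0 \<le> E * v" for E
        using that by (simp add: algebra_simps)
      have "0 \<le> L * t" "0 \<le> (2 * L / c + C1 / c) * v" using L c C1 t v by auto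
      from gen[OF this] show "L * v + (2 * L / c + C1 / c) * t \<le> (L + 2 * L / c + C1 / c) * (t + v)"
        by (simp only: add.assoc)
    qed
    finally show ?thesis by (simp add: D_def m0_def distrib_left)
  qed
qed

end

subsection \<open>Corner slices of the reconstruction\<close>

text \<open>The interval keeps distance \<open>\<epsilon>\<close> from the junction, where the
  curvature vanishes: the concavity is of order \<open>\<epsilon>^2\<close>, the slope only of order
  \<open>\<epsilon>^3\<close>, with
  \<open>64 * \<epsilon>^3 = 8 * (2 * \<epsilon>)^3\<close>.\<close>

lemma corner_concave_graph:
  assumes "0 < \<epsilon>" "\<epsilon> \<le> 1/4"
  shows "concave_graph qt dqt (2 + \<epsilon>) (2 + 2 * \<epsilon>) 96 (3 * \<epsilon>^2) (64 * \<epsilon>^3)"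
proof
  define d2 where "d2 x = - 3 * (x - 2)^2 / (qt x - 1)^7" for x
  have in': "2 \<le> x" "x \<le> 5/2" "2 + \<epsilon> \<le> x" "x \<le> 2 + 2 * \<epsilon>" if "x \<in> {2 + \<epsilon>..2 + 2 * \<epsilon>}" for x using that assms by auto
  have d2: "\<bar>d2 x\<bar> \<le> 96" "d2 x \<le> - 3 * \<epsilon>^2" if "x \<in> {2 + \<epsilon>..2 + 2 * \<epsilon>}" for x
  proof -
    note b = dqt_bounds[OF in'(1,2)[OF that]]
    have "\<epsilon>^2 \<le> (x - 2)^2" using that assms by (intro power_mono) auto
    then have "3 * \<epsilon>^2 \<le> 3 * (x - 2)^2 / (qt x - 1)^7" using b(3) by linarith
    moreover have "0 \<le> 3 * \<epsilon>^2" by simp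
    moreover have "d2 x = - (3 * (x - 2)^2 / (qt x - 1)^7)" by (simp add: d2_def)
    ultimately show "\<bar>d2 x\<bar> \<le> 96" "d2 x \<le> - 3 * \<epsilon>^2" using b(2) by linarith+
  qed
  have mvt: "\<exists>z. x < z \<and> z < y \<and> dqt y - dqt x = (y - x) * d2 z"
    if "x \<in> {2 + \<epsilon>..2 + 2 * \<epsilon>}" "y \<in> {2 + \<epsilon>..2 + 2 * \<epsilon>}" "x < y" for x y
    unfolding d2_def using that assms by (intro MVT2 DERIV_dqt) auto
  show "(qt has_real_derivative dqt x) (at x)" if "x \<in> {2 + \<epsilon>..2 + 2 * \<epsilon>}" for x
    using in'[OF that] by (intro DERIV_qt) auto
  have lip: "\<bar>dqt x - dqt y\<bar> \<le> 96 * \<bar>x - y\<bar>"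
    if xy: "x \<in> {2 + \<epsilon>..2 + 2 * \<epsilon>}" "y \<in> {2 + \<epsilon>..2 + 2 * \<epsilon>}" "x < y" for x y
  proof -
    obtain z where z: "x < z" "z < y" "dqt y - dqt x = (y - x) * d2 z" using mvt[OF xy] by blast
    have "\<bar>d2 z\<bar> \<le> 96" using z xy by (intro d2) auto
    then have "\<bar>dqt y - dqt x\<bar> \<le> \<bar>y - x\<bar> * 96" unfolding z(3) abs_mult by (intro mult_left_mono) auto
    then show ?thesis by (simp add: abs_minus_commute)
  qed
  show "\<bar>dqt x - dqt y\<bar> \<le> 96 * \<bar>x - y\<bar>"
    if xy: "x \<in> {2 + \<epsilon>..2 + 2 * \<epsilon>}" "y \<in> {2 + \<epsilon>..2 + 2 * \<epsilon>}" for x y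
    using lip[OF xy] lip[OF xy(2,1)] by (cases x y rule: linorder_cases) (auto simp: abs_minus_commute)
  show "dqt y + 3 * \<epsilon>^2 * (y - x) \<le> dqt x"
    if xy: "x \<in> {2 + \<epsilon>..2 + 2 * \<epsilon>}" "y \<in> {2 + \<epsilon>..2 + 2 * \<epsilon>}" "x \<le> y" for x y
  proof (cases "x = y")
    case False
    then obtain z where z: "x < z" "z < y" "dqt y - dqt x = (y - x) * d2 z" using mvt[OF xy(1,2)] xy(3) by force
    have "d2 z \<le> - 3 * \<epsilon>^2" using z xy by (intro d2) auto
    then have "(y - x) * d2 z \<le> (y - x) * (- 3 * \<epsilon>^2)" using xy by (intro mult_left_mono) auto
    then show ?thesis using z(3) by (simp add: algebra_simps)
  qed simp
  show "\<bar>dqt x\<bar> \<le> 64 * \<epsilon>^3" if x: "x \<in> {2 + \<epsilon>..2 + 2 * \<epsilon>}" for x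
  proof -
    have "(x - 2)^3 \<le> (2 * \<epsilon>)^3" using in'[OF x] by (intro power_mono) auto
    then show ?thesis using dqt_bounds(1)[OF in'(1,2)[OF x]] by (simp add: power_mult_distrib)
  qed
qed (use assms in auto)

text \<open>Near the straight edge the slope is small, so chord length and abscissa difference nearly agree;
  three sample points close to the abscissas \<open>x - \<ell>\<close>, \<open>x\<close>, \<open>x + \<ell>\<close> with \<open>\<ell> \<approx> (1 - \<eta>) t\<close> then lie
  in one ball of radius \<open>t\<close>, and they are separated because \<open>\<eta> < 1/3\<close> gives \<open>\<ell> > 2 \<eta> t\<close>.\<close>

lemma corner_geometry:
  assumes \<eta>: "0 < \<eta>" "\<eta> < 1/3"
  obtains a b c C t0 h where "2 < a" "a < b" "b < 5/2" "0 < c" "0 < C" "0 < t0" "0 < h"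
    "\<And>t X x. 0 < t \<Longrightarrow> t < t0 \<Longrightarrow> finite X \<Longrightarrow> X \<subseteq> M\<^sub>\<Omega> \<Longrightarrow>
       (\<And>y. y \<in> M\<^sub>\<Omega> \<Longrightarrow> \<exists>x\<in>X. dist y x \<le> \<eta> * t) \<Longrightarrow> x \<in> {a..b} \<Longrightarrow>
       \<exists>yl yu. qt x - C * t^2 \<le> yl \<and> yl + c * t^2 \<le> yu \<and> yu \<le> qt x \<and>
         (\<forall>y\<in>{yl..yu}. pt x y \<in> Conv t X) \<and>
         (\<forall>v. 0 \<le> v \<and> v \<le> h \<longrightarrow>
            infdist (pt x (yu + v)) (Conv t X) \<le> v * (1 / sqrt (1 + (dqt x)^2) + C * (t + v)) \<and>
            infdist (pt x (yl - v)) (Conv t X) \<le> v * (1 / sqrt (1 + (dqt x)^2) + C * (t + v)))"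
proof -
  \<comment> \<open>This gives \<open>m \<le> 64 * \<epsilon>\<close>, at most half of
    \<open>(1 - 3 * \<eta>) / (2 * \<eta>)\<close>, which is the margin between 1 and
    \<open>(1 - \<eta>) / (2 * \<eta>)\<close>.\<close>
  define \<epsilon> where "\<epsilon> = min (1/4) ((1 - 3 * \<eta>) / (2 * \<eta>) / 128)"
  have pos\<eta>: "0 < (1 - 3 * \<eta>) / (2 * \<eta>)" using \<eta> by simp
  have \<epsilon>: "0 < \<epsilon>" "\<epsilon> \<le> 1/4" "\<epsilon> \<le> (1 - 3 * \<eta>) / (2 * \<eta>) / 128" using pos\<eta> by (auto simp: \<epsilon>_def)
  define m where "m = 64 * \<epsilon>^3"
  interpret concave_graph qt dqt "2 + \<epsilon>" "2 + 2 * \<epsilon>" 96 "3 * \<epsilon>^2" m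
    unfolding m_def by (rule corner_concave_graph[OF \<epsilon>(1,2)])
  have "\<epsilon>^3 \<le> \<epsilon>^1" using \<epsilon> by (intro power_decreasing) auto
  then have m: "0 \<le> m" "m < (1 - 3 * \<eta>) / (2 * \<eta>)" using \<epsilon> pos\<eta> by (auto simp: m_def)
  \<comment> \<open>Bounds the ratio of chord length to difference of abscissas.\<close>
  define L0 where "L0 = sqrt (1 + m^2)"
  have "1 + m^2 \<le> (1 + m)^2" using m by (simp add: power2_sum)
  then have L0: "1 \<le> L0" "L0 \<le> 1 + m" using m by (auto simp: L0_def intro: real_le_lsqrt)
  then have "L0 < 1 + (1 - 3 * \<eta>) / (2 * \<eta>)" using m by linarith
  then have "L0 < (1 - \<eta>) / (2 * \<eta>)" using \<eta> by (simp add: field_simps)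
  then have "2 * \<eta> < (1 - \<eta>) / L0" using L0 \<eta> by (simp add: field_simps)
  \<comment> \<open>The gap, in units of \<open>t\<close>, that remains between neighbouring sample
    abscissas when each is off by up to \<open>\<eta> * t\<close>.\<close>
  define c0 where "c0 = (1 - \<eta>) / L0 - 2 * \<eta>"
  have c0: "0 < c0" using \<open>2 * \<eta> < (1 - \<eta>) / L0\<close> by (simp add: c0_def)
  have lL: "(1 - \<eta>) / L0 \<le> 1 - \<eta>" using divide_left_mono[of 1 L0 "1 - \<eta>"] L0 \<eta> by simp
  \<comment> \<open>The constant of \<open>infdist_slice_end\<close> with \<open>L = 96\<close> and
    the hull distance 1728 from \<open>M_near_Conv\<close>.\<close>
  define C where "C = 96 + 2 * 96 / c0 + 1728 / c0"
  have C192: "192 \<le> C" 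
  proof -
    have "c0 \<le> 1" using lL \<eta> by (simp add: c0_def)
    then have "1728 \<le> 1728 / c0" using c0 by (simp add: field_simps)
    moreover have "0 \<le> 2 * 96 / c0" using c0 by simp
    ultimately show ?thesis unfolding C_def by linarith
  qed
  define h where "h = \<epsilon> / 4"
  define t0 where "t0 = min h (1/20000)"
  have h: "0 < h" and t0: "0 < t0" using \<epsilon> by (auto simp: h_def t0_def)
  have main: "\<exists>yl yu. qt x - C * t^2 \<le> yl \<and> yl + (3 * \<epsilon>^2 / 2 * c0^2) * t^2 \<le> yu \<and> yu \<le> qt x \<and>
         (\<forall>y\<in>{yl..yu}. pt x y \<in> Conv t X) \<and>
         (\<forall>v. 0 \<le> v \<and> v \<le> h \<longrightarrow>
            infdist (pt x (yu + v)) (Conv t X) \<le> v * (1 / sqrt (1 + (dqt x)^2) + C * (t + v)) \<and>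
            infdist (pt x (yl - v)) (Conv t X) \<le> v * (1 / sqrt (1 + (dqt x)^2) + C * (t + v)))"
    if t: "0 < t" "t < t0" and X: "finite X" "X \<subseteq> M\<^sub>\<Omega>"
      and S: "\<And>y. y \<in> M\<^sub>\<Omega> \<Longrightarrow> \<exists>x\<in>X. dist y x \<le> \<eta> * t" and x: "x \<in> {2 + \<epsilon> + h..2 + 2 * \<epsilon> - h}"
    for t X x
  proof -
    have th: "t < h" "t \<le> 1/20000" using t by (auto simp: t0_def)
    have \<eta>t: "\<eta> * t \<le> 1/3 * t" "0 < \<eta> * t" using \<eta> t by (auto intro: mult_right_mono)
    \<comment> \<open>Chords over this abscissa difference are at most
      \<open>(1 - \<eta>) * t\<close> long, which leaves \<open>\<eta> * t\<close> for the sampling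
      error inside the ball of radius \<open>t\<close>.\<close>
    define l where "l = (1 - \<eta>) / L0 * t"
    have l: "l = 2 * (\<eta> * t) + c0 * t" by (simp add: l_def c0_def algebra_simps)
    have lt: "l + \<eta> * t \<le> t" using mult_right_mono[OF lL, of t] t by (simp add: l_def algebra_simps)
    have c0t: "0 < c0 * t" using c0 t by simp
    have xab: "x \<in> {2 + \<epsilon>..2 + 2 * \<epsilon>}" using x h by auto
    have node: "\<exists>\<xi>. pt \<xi> (qt \<xi>) \<in> X \<and> \<bar>\<xi> - u\<bar> \<le> \<eta> * t \<and> norm (pt \<xi> (qt \<xi>) - pt x (qt x)) \<le> t"
      if u: "\<bar>u - x\<bar> \<le> l" for u
    proof -
      have "\<bar>u - x\<bar> \<le> t" using u lt \<eta>t by linarith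
      then have uab: "u \<in> {2 + \<epsilon>..2 + 2 * \<epsilon>}" using x th by auto
      then have u3: "\<bar>u\<bar> < 3" "2 \<le> u" "u \<le> 5/2" using \<epsilon> by auto
      obtain p where p: "p \<in> X" "dist (pt u (qt u)) p \<le> \<eta> * t" using S[OF qt_in_M[OF u3(1)]] by blast
      have n: "norm (p - pt u (qt u)) \<le> \<eta> * t" using p by (simp add: dist_norm norm_minus_commute)
      have "\<bar>(p - pt u (qt u))$1\<bar> \<le> \<eta> * t" "\<bar>(p - pt u (qt u))$2\<bar> \<le> \<eta> * t"
        using n component_le_norm_cart[of "p - pt u (qt u)"] order_trans by blast+
      then have p1: "\<bar>p$1 - u\<bar> \<le> \<eta> * t" and p2: "\<bar>p$2 - qt u\<bar> \<le> \<eta> * t" by simp_all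
      \<comment> \<open>The sample is so close that it stays on the upper arc and is itself a graph
        point.\<close>
      have "\<bar>p$1\<bar> < 3" using p1 u3 \<eta>t th by linarith
      moreover have "1 < p$2" using p2 qt_corner(1)[OF u3(2,3)] \<eta>t th by linarith
      moreover have "pt (p$1) (p$2) \<in> M\<^sub>\<Omega>" unfolding pt_components using p X by blast
      ultimately have "p$2 = qt (p$1)" using pt_top_in_M_iff by blast
      then have pe: "p = pt (p$1) (qt (p$1))" using pt_components[of p] by simp
      have "norm (pt u (qt u) - pt x (qt x)) = sqrt ((u - x)^2 + (qt u - qt x)^2)" by (simp add: norm2)
      also have "\<dots> \<le> sqrt (l^2 * (1 + m^2))"
      proof (rule real_sqrt_le_mono)
        have 1: "(u - x)^2 \<le> l^2" using u by (metis abs_ge_zero power2_abs power_mono)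
        have "\<bar>qt u - qt x\<bar> \<le> m * \<bar>u - x\<bar>" by (rule q_lipschitz[OF xab uab])
        also have "\<dots> \<le> m * l" using u m by (intro mult_left_mono) auto
        finally have "(qt u - qt x)^2 \<le> (m * l)^2" by (metis abs_ge_zero power2_abs power_mono)
        then show "(u - x)^2 + (qt u - qt x)^2 \<le> l^2 * (1 + m^2)" using 1 by (simp add: algebra_simps)
      qed
      also have "\<dots> = l * L0" using c0t \<eta>t by (simp add: real_sqrt_mult L0_def l)
      also have "\<dots> = (1 - \<eta>) * t" using L0 by (simp add: l_def)
      finally have "norm (p - pt x (qt x)) \<le> t"
        using norm_triangle_ineq[of "p - pt u (qt u)" "pt u (qt u) - pt x (qt x)"] n by (simp add: algebra_simps)
      then show ?thesis using p1 p(1) pe by metis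
    qed
    obtain \<xi>0 where 0: "pt \<xi>0 (qt \<xi>0) \<in> X" "\<bar>\<xi>0 - (x - l)\<bar> \<le> \<eta> * t" "norm (pt \<xi>0 (qt \<xi>0) - pt x (qt x)) \<le> t"
      using node[of "x - l"] l c0t \<eta>t by auto
    obtain \<xi>1 where 1: "pt \<xi>1 (qt \<xi>1) \<in> X" "\<bar>\<xi>1 - x\<bar> \<le> \<eta> * t" "norm (pt \<xi>1 (qt \<xi>1) - pt x (qt x)) \<le> t"
      using node[of x] l c0t \<eta>t by auto
    obtain \<xi>2 where 2: "pt \<xi>2 (qt \<xi>2) \<in> X" "\<bar>\<xi>2 - (x + l)\<bar> \<le> \<eta> * t" "norm (pt \<xi>2 (qt \<xi>2) - pt x (qt x)) \<le> t"
      using node[of "x + l"] l c0t \<eta>t by auto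
    have ord: "2 + \<epsilon> \<le> \<xi>0" "\<xi>0 + c0 * t \<le> \<xi>1" "\<xi>1 + c0 * t \<le> \<xi>2" "\<xi>2 \<le> 2 + 2 * \<epsilon>" "\<xi>0 + c0 * t \<le> x" "x + c0 * t \<le> \<xi>2"
      "x - t \<le> \<xi>0" "\<xi>2 \<le> x + t"
      using 0(2) 1(2) 2(2) l lt x th \<eta>t c0t by (simp_all add: abs_le_iff)
    have "\<And>p. p \<in> {pt \<xi>0 (qt \<xi>0), pt \<xi>1 (qt \<xi>1), pt \<xi>2 (qt \<xi>2)} \<Longrightarrow> norm (p - pt x (qt x)) \<le> t" using 0 1 2 by blast
    then have "convex hull {pt \<xi>0 (qt \<xi>0), pt \<xi>1 (qt \<xi>1), pt \<xi>2 (qt \<xi>2)} \<subseteq> Conv t X"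
      using 0 1 2 by (intro convex_hull_subset_Conv) auto
    from triangle_slice[OF ord(1-6) c0t ord(7,8) this]
    obtain yl yu where y: "qt x - 2 * 96 * t^2 \<le> yl" "yl + 3 * \<epsilon>^2 / 2 * (c0 * t)^2 \<le> yu" "yu \<le> qt x"
      "\<forall>y\<in>{yl..yu}. pt x y \<in> Conv t X"
      and sh: "\<And>d. \<bar>d\<bar> \<le> c0 * t \<Longrightarrow> \<exists>y. pt (x + d) y \<in> Conv t X \<and> \<bar>y - yu - dqt x * d\<bar> \<le> 96 * t * \<bar>d\<bar>"
        "\<And>d. \<bar>d\<bar> \<le> c0 * t \<Longrightarrow> \<exists>y. pt (x + d) y \<in> Conv t X \<and> \<bar>y - yl - dqt x * d\<bar> \<le> 96 * t * \<bar>d\<bar>"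
      by blast
    have gap0: "0 \<le> 3 * \<epsilon>^2 / 2 * (c0 * t)^2" by simp
    have yu': "\<bar>yu - qt x\<bar> \<le> 2 * 96 * t^2" and yl': "\<bar>yl - qt x\<bar> \<le> 2 * 96 * t^2" using y(1,2,3) gap0 by linarith+
    have near: "\<exists>p\<in>Conv t X. dist (pt z (qt z)) p \<le> 1728 * t^2" if "z \<in> {2 + \<epsilon>..2 + 2 * \<epsilon>}" for z
      using that \<epsilon> by (intro M_near_Conv[OF X S \<eta>(2) t(1) th(2)] qt_in_M) auto
    have x': "2 + \<epsilon> + h \<le> x" "x + h \<le> 2 + 2 * \<epsilon>" using x by auto
    have d: "infdist (pt x (yu + v)) (Conv t X) \<le> v * (1 / sqrt (1 + (dqt x)^2) + C * (t + v))"
      "infdist (pt x (yl - v)) (Conv t X) \<le> v * (1 / sqrt (1 + (dqt x)^2) + C * (t + v))"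
      if v: "0 \<le> v" "v \<le> h" for v
      using infdist_slice_end[OF c0 t(1) x' v _ near yu' sh(1), where \<sigma>=1]
        infdist_slice_end[OF c0 t(1) x' v _ near yl' sh(2), where \<sigma>="-1"]
      by (simp_all add: C_def)
    have "192 * t^2 \<le> C * t^2" using C192 by (intro mult_right_mono) auto
    then have "qt x - C * t^2 \<le> yl" using y(1) by linarith
    moreover have "yl + (3 * \<epsilon>^2 / 2 * c0^2) * t^2 \<le> yu" using y(2) by (simp add: power_mult_distrib mult.assoc)
    ultimately show ?thesis using y(3,4) d by blast
  qed
  show ?thesis
    by (rule that[of "2 + \<epsilon> + h" "2 + 2 * \<epsilon> - h" "3 * \<epsilon>^2 / 2 * c0^2" C t0 h])
       (use \<epsilon> h t0 c0 C192 main in \<open>auto simp: h_def\<close>)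
qed

text \<open>Vertical depth below the arc costs level: \<open>FF\<close> falls short of 1 by at least
  1/8 of the depth. By the tangent inequality at any curve point and
  \<open>norm (GF p) \<le> 8\<close>, the shortfall is at most 8 times the distance.\<close>

lemma infdist_M_corner_ge:
  assumes x: "2 \<le> x" "x \<le> 5/2" and y: "1 \<le> y" "y \<le> qt x"
  shows "(qt x - y) / 64 \<le> infdist (pt x y) M\<^sub>\<Omega>"
proof -
  have x3: "\<bar>x\<bar> < 3" using x by simp
  have Q: "1/2 \<le> qt x - 1" using qt_corner(1)[OF x] by simp
  have "(qt x - y) * (1/8) \<le> (qt x - y) * (qt x - 1)^3"
  proof (rule mult_left_mono)
    have "(1/2)^3 \<le> (qt x - 1)^3" using Q by (intro power_mono) auto
    then show "1/8 \<le> (qt x - 1)^3" by (simp add: power_divide)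
  qed (use y in auto)
  also have "\<dots> \<le> (qt x - 1)^4 - (y - 1)^4"
  proof -
    have "(y - 1) * (y - 1)^3 \<le> (y - 1) * (qt x - 1)^3" using y by (intro mult_left_mono power_mono) auto
    moreover have "(qt x - 1)^4 = (qt x - 1) * (qt x - 1)^3" "(y - 1)^4 = (y - 1) * (y - 1)^3" by algebra+
    ultimately show ?thesis by (simp add: algebra_simps)
  qed
  also have "\<dots> = 1 - FF (pt x y)" using y qt_power[OF x3] by (simp add: FF_def qq_abs[of 1])
  finally have F: "(qt x - y) / 8 \<le> 1 - FF (pt x y)" by simp
  have "(qt x - y) / 64 \<le> dist (pt x y) p" if p: "p \<in> M\<^sub>\<Omega>" for p
  proof -
    have cube: "\<bar>4 * (max u 0)^3 - 4 * (max v 0)^3\<bar> \<le> 4" if "u \<le> 1" "v \<le> 1" for u v :: real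
    proof -
      have "0 \<le> (max u 0)^3" "(max u 0)^3 \<le> 1" "0 \<le> (max v 0)^3" "(max v 0)^3 \<le> 1"
        using that by (auto intro!: power_le_one)
      then show ?thesis by linarith
    qed
    have "\<bar>dqq 2 (p$1)\<bar> \<le> 4" "\<bar>dqq 1 (p$2)\<bar> \<le> 4"
      unfolding dqq_def using M_bounds(1,2)[OF p] by (intro cube; linarith)+
    then have G: "norm (GF p) \<le> 8" using norm_le_abs_sum2[of "GF p"] by (simp add: GF_def)
    have "1 - FF (pt x y) \<le> - (GF p \<bullet> (pt x y - p))" using FF_tangent[of p "pt x y"] p by (simp add: M_eq)
    also have "\<dots> \<le> norm (GF p) * norm (pt x y - p)" using Cauchy_Schwarz_ineq2[of "GF p" "pt x y - p"] by linarith
    also have "\<dots> \<le> 8 * norm (pt x y - p)" using G by (intro mult_right_mono) auto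
    finally show ?thesis using F by (simp add: dist_norm)
  qed
  then have "(qt x - y) / 64 \<le> (INF p\<in>M\<^sub>\<Omega>. dist (pt x y) p)" by (intro cINF_greatest M_nonempty)
  then show ?thesis using M_nonempty by (simp add: infdist_def)
qed

section \<open>Fubini's theorem in the plane\<close>

lemma measurable_pt[measurable]: "(\<lambda>(x, y). pt x y) \<in> borel_measurable (lborel \<Otimes>\<^sub>M lborel)"
proof -
  have "continuous_on UNIV (\<lambda>z::real \<times> real. pt (fst z) (snd z))" by (intro continuous_intros)
  then have "(\<lambda>z::real \<times> real. pt (fst z) (snd z)) \<in> borel_measurable borel" by (rule borel_measurable_continuous_onI)
  then show ?thesis by (simp add: lborel_prod case_prod_beta')
qed

lemma Basis_real2: "(Basis :: (real^2) set) = {axis 1 1, axis 2 1}"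
  by (simp add: Basis_vec_def UNIV_2 insert_commute)

lemma lborel_real2: "(lborel :: (real^2) measure) = distr (lborel \<Otimes>\<^sub>M lborel) borel (\<lambda>(x, y). pt x y)"
proof (rule lborel_eqI)
  fix l u :: "real^2" assume le: "\<And>b. b \<in> Basis \<Longrightarrow> l \<bullet> b \<le> u \<bullet> b"
  have ne: "axis 1 1 \<noteq> (axis 2 1 :: real^2)" by (simp add: vec_eq_iff forall_2 axis_def)
  have ax: "v \<bullet> axis i 1 = v$i" for v :: "real^2" and i by (simp add: inner_axis)
  have le': "l$1 \<le> u$1" "l$2 \<le> u$2" using le[of "axis 1 1"] le[of "axis 2 1"] by (auto simp: Basis_real2 ax)
  have pre: "(\<lambda>(x, y). pt x y) -` box l u \<inter> space (lborel \<Otimes>\<^sub>M lborel) = {l$1<..<u$1} \<times> {l$2<..<u$2}"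
    by (auto simp: space_pair_measure mem_box_cart forall_2)
  have "emeasure (distr (lborel \<Otimes>\<^sub>M lborel) borel (\<lambda>(x, y). pt x y)) (box l u)
      = emeasure (lborel \<Otimes>\<^sub>M lborel) ({l$1<..<u$1} \<times> {l$2<..<u$2})"
    unfolding pre[symmetric] by (rule emeasure_distr[OF measurable_pt]) simp
  also have "\<dots> = emeasure lborel {l$1<..<u$1} * emeasure lborel {l$2<..<u$2}"
    by (rule lborel.emeasure_pair_measure_Times) auto
  also have "\<dots> = ennreal (u$1 - l$1) * ennreal (u$2 - l$2)" using le' by simp
  also have "\<dots> = ennreal ((u$1 - l$1) * (u$2 - l$2))" using le' by (simp add: ennreal_mult)
  also have "(u$1 - l$1) * (u$2 - l$2) = (\<Prod>b\<in>Basis. (u - l) \<bullet> b)"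
    using ne by (simp add: Basis_real2 ax)
  finally show "emeasure (distr (lborel \<Otimes>\<^sub>M lborel) borel (\<lambda>(x, y). pt x y)) (box l u) = (\<Prod>b\<in>Basis. (u - l) \<bullet> b)"
    by simp
qed simp

lemma integral_real2:
  fixes f :: "real^2 \<Rightarrow> real"
  assumes f: "integrable lborel f"
  shows "integrable lborel (\<lambda>x. LINT y|lborel. f (pt x y))"
    and "(LINT p|lborel. f p) = (LINT x|lborel. LINT y|lborel. f (pt x y))"
proof -
  have [measurable]: "f \<in> borel_measurable borel" using f by simp
  have f': "integrable (lborel \<Otimes>\<^sub>M lborel) (\<lambda>z. f (case z of (x, y) \<Rightarrow> pt x y))"
    using f by (subst (asm) lborel_real2) (simp add: integrable_distr_eq)
  show "integrable lborel (\<lambda>x. LINT y|lborel. f (pt x y))"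
    using lborel_pair.integrable_fst'[OF f'] by simp
  have "(LINT p|lborel. f p) = (LINT z|(lborel \<Otimes>\<^sub>M lborel). f (case z of (x, y) \<Rightarrow> pt x y))"
    by (subst lborel_real2) (simp add: integral_distr)
  also have "\<dots> = (LINT x|lborel. LINT y|lborel. f (pt x y))"
    using lborel_pair.integral_fst'[OF f'] by simp
  finally show "(LINT p|lborel. f p) = (LINT x|lborel. LINT y|lborel. f (pt x y))" .
qed

subsection \<open>Lower bounds for the Wasserstein distance\<close>

lemma product_in_couplings:
  assumes "prob_space \<mu>" "prob_space \<nu>" shows "\<mu> \<Otimes>\<^sub>M \<nu> \<in> couplings \<mu> \<nu>"
proof -
  interpret m: prob_space \<mu> by fact
  interpret n: prob_space \<nu> by fact
  have "distr (\<mu> \<Otimes>\<^sub>M \<nu>) \<nu> snd = \<nu>"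
  proof (intro measure_eqI)
    fix A assume A: "A \<in> sets (distr (\<mu> \<Otimes>\<^sub>M \<nu>) \<nu> snd)"
    then have "emeasure (distr (\<mu> \<Otimes>\<^sub>M \<nu>) \<nu> snd) A = emeasure (\<mu> \<Otimes>\<^sub>M \<nu>) (space \<mu> \<times> A)"
      by (auto simp add: emeasure_distr space_pair_measure dest: sets.sets_into_space intro!: arg_cong2[where f=emeasure])
    with A show "emeasure (distr (\<mu> \<Otimes>\<^sub>M \<nu>) \<nu> snd) A = emeasure \<nu> A"
      by (simp add: n.emeasure_pair_measure_Times m.emeasure_space_1)
  qed simp
  then show ?thesis unfolding couplings_def using n.distr_pair_fst[of \<mu>] by simp
qed

text \<open>Under a coupling the difference of the means is the integral of
  \<open>f x - f y\<close>, hence at most the mean distance, which the root mean square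
  dominates.\<close>

lemma coupling_cost_ge:
  fixes f :: "real^2 \<Rightarrow> real"
  assumes P: "P \<in> couplings \<mu> \<nu>" and pr: "prob_space \<mu>" and sets: "sets \<mu> = sets borel" "sets \<nu> = sets borel"
    and f: "integrable \<mu> f" "integrable \<nu> f" and lip: "\<And>x y. \<bar>f x - f y\<bar> \<le> norm (x - y)"
  shows "ennreal ((integral\<^sup>L \<mu> f - integral\<^sup>L \<nu> f)^2) \<le> (\<integral>\<^sup>+ (x, y). ennreal ((norm (x - y))\<^sup>2) \<partial>P)"
proof -
  have sp: "space \<mu> = UNIV" "space \<nu> = UNIV" using sets[THEN sets_eq_imp_space_eq] by auto
  have sP: "sets P = sets (borel \<Otimes>\<^sub>M borel)" and d: "distr P \<mu> fst = \<mu>" "distr P \<nu> snd = \<nu>"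
    using P sets by (auto simp: couplings_def cong: sets_pair_measure_cong)
  have mP: "measurable P M = measurable (borel \<Otimes>\<^sub>M borel) M" for M :: "'c measure"
    by (rule measurable_cong_sets[OF sP refl])
  have fst_m: "fst \<in> measurable P \<mu>" and snd_m: "snd \<in> measurable P \<nu>"
    unfolding mP using measurable_fst[of borel borel] measurable_snd[of borel borel]
    by (simp_all add: measurable_cong_sets[OF refl sets(1)] measurable_cong_sets[OF refl sets(2)])
  have fm: "f \<in> borel_measurable \<mu>" "f \<in> borel_measurable \<nu>" using f by auto
  have pP: "prob_space P"
  proof
    have "emeasure \<mu> (space \<mu>) = 1" using pr by (simp add: prob_space.emeasure_space_1)
    then have "emeasure (distr P \<mu> fst) (space \<mu>) = 1" using d by simp
    moreover have "fst -` space \<mu> \<inter> space P = space P" by (simp add: sp)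
    ultimately show "emeasure P (space P) = 1" using fst_m by (simp add: emeasure_distr)
  qed
  interpret prob_space P by fact
  let ?n = "\<lambda>z::(real^2) \<times> (real^2). norm (fst z - snd z)"
  have nm[measurable]: "?n \<in> borel_measurable P" unfolding mP by measurable
  have e: "(\<integral>\<^sup>+ (x, y). ennreal ((norm (x - y))\<^sup>2) \<partial>P) = (\<integral>\<^sup>+ z. ennreal ((?n z)\<^sup>2) \<partial>P)"
    by (simp add: case_prod_beta')
  show ?thesis
  proof (cases "(\<integral>\<^sup>+ z. ennreal ((?n z)\<^sup>2) \<partial>P) < \<infinity>")
    case False then show ?thesis unfolding e by (simp add: not_less top_unique)
  next
    case True
    have i2: "integrable P (\<lambda>z. (?n z)^2)" by (rule integrableI_bounded) (use True in auto)
    have i1: "integrable P ?n"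
    proof (rule Bochner_Integration.integrable_bound)
      show "integrable P (\<lambda>z. 1 + (?n z)^2)" using i2 by simp
      have "u \<le> 1 + u^2" for u :: real
      proof -
        have "2 * u \<le> u^2 + 1" using zero_le_power2[of "u - 1"] by (simp add: power2_diff)
        moreover have "0 \<le> u^2" by simp
        ultimately show ?thesis by linarith
      qed
      then show "AE z in P. norm (?n z) \<le> norm (1 + (?n z)^2)" by (intro AE_I2) simp
    qed simp
    have if1: "integrable P (\<lambda>z. f (fst z))" "integral\<^sup>L \<mu> f = (LINT z|P. f (fst z))"
      using f(1) integrable_distr_eq[OF fst_m fm(1)] integral_distr[OF fst_m fm(1)] by (simp_all add: d)
    have if2: "integrable P (\<lambda>z. f (snd z))" "integral\<^sup>L \<nu> f = (LINT z|P. f (snd z))"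
      using f(2) integrable_distr_eq[OF snd_m fm(2)] integral_distr[OF snd_m fm(2)] by (simp_all add: d)
    define D where "D = \<bar>integral\<^sup>L \<mu> f - integral\<^sup>L \<nu> f\<bar>"
    have "D = \<bar>LINT z|P. f (fst z) - f (snd z)\<bar>" using if1 if2 by (simp add: D_def)
    also have "\<dots> \<le> (LINT z|P. \<bar>f (fst z) - f (snd z)\<bar>)" by (rule integral_abs_bound)
    also have "\<dots> \<le> (LINT z|P. ?n z)" using if1(1) if2(1) i1 lip by (intro integral_mono) auto
    finally have D: "D \<le> (LINT z|P. ?n z)" "0 \<le> D" by (auto simp: D_def)
    \<comment> \<open>Expanding this square takes the place of Jensen's inequality.\<close>
    have "0 \<le> (LINT z|P. (?n z - D)^2)" by simp
    also have "\<dots> = (LINT z|P. (?n z)^2 - 2 * D * ?n z + D^2)" by (simp add: power2_diff algebra_simps)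
    also have "\<dots> = (LINT z|P. (?n z)^2) - 2 * D * (LINT z|P. ?n z) + D^2" using i1 i2 by (simp add: prob_space)
    finally have "D * (2 * (LINT z|P. ?n z)) - D^2 \<le> (LINT z|P. (?n z)^2)" by (simp add: algebra_simps)
    moreover have "D * (2 * D) \<le> D * (2 * (LINT z|P. ?n z))" using D by (intro mult_left_mono) auto
    ultimately have "D^2 \<le> (LINT z|P. (?n z)^2)" by (simp add: power2_eq_square)
    moreover have "(\<integral>\<^sup>+ z. ennreal ((?n z)\<^sup>2) \<partial>P) = ennreal (LINT z|P. (?n z)^2)"
      using i2 by (intro nn_integral_eq_integral) auto
    ultimately show ?thesis unfolding e D_def by (simp add: ennreal_leI)
  qed
qed

lemma W2_ge_integral_diff:
  fixes f :: "real^2 \<Rightarrow> real"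
  assumes pr: "prob_space \<mu>" "prob_space \<nu>" and sets: "sets \<mu> = sets borel" "sets \<nu> = sets borel"
    and bd: "AE x in \<mu>. norm x \<le> B" "AE x in \<nu>. norm x \<le> B"
    and f: "integrable \<mu> f" "integrable \<nu> f" and lip: "\<And>x y. \<bar>f x - f y\<bar> \<le> L * norm (x - y)" and L: "0 < L"
  shows "\<bar>integral\<^sup>L \<mu> f - integral\<^sup>L \<nu> f\<bar> \<le> L * W2 \<mu> \<nu>"
proof -
  interpret m: prob_space \<mu> by fact
  interpret n: prob_space \<nu> by fact
  interpret pair_prob_space \<mu> \<nu> ..
  let ?c = "\<lambda>P. \<integral>\<^sup>+ (x, y). ennreal ((norm (x - y))\<^sup>2) \<partial>(P::((real^2) \<times> (real^2)) measure)"
  let ?I = "INF P\<in>couplings \<mu> \<nu>. ?c P"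
  let ?D = "integral\<^sup>L \<mu> (\<lambda>x. f x / L) - integral\<^sup>L \<nu> (\<lambda>x. f x / L)"
  have "ennreal (?D^2) \<le> ?I"
  proof (rule INF_greatest)
    fix P assume "P \<in> couplings \<mu> \<nu>"
    then show "ennreal (?D^2) \<le> ?c P"
    proof (rule coupling_cost_ge[OF _ pr(1) sets])
      show "\<bar>f x / L - f y / L\<bar> \<le> norm (x - y)" for x y
        using lip[of x y] L by (simp add: field_simps flip: diff_divide_distrib)
    qed (use f in auto)
  qed
  \<comment> \<open>\<open>enn2real\<close> maps infinity to 0, so a lower bound for
    \<open>W2\<close> needs a finite infimum; the product coupling costs at most the square of
    \<open>2 * B\<close>.\<close>
  moreover have "?I < \<infinity>"
  proof -
    have "AE z in \<mu> \<Otimes>\<^sub>M \<nu>. norm (fst z - snd z) \<le> 2 * B"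
    proof (rule AE_pair_measure)
      have s: "sets (\<mu> \<Otimes>\<^sub>M \<nu>) = sets (borel \<Otimes>\<^sub>M borel)" using sets by (intro sets_pair_measure_cong) auto
      have "{z \<in> space (borel \<Otimes>\<^sub>M borel). norm (fst z - snd z :: real^2) \<le> 2 * B} \<in> sets (borel \<Otimes>\<^sub>M borel)" by measurable
      then show "{z \<in> space (\<mu> \<Otimes>\<^sub>M \<nu>). norm (fst z - snd z) \<le> 2 * B} \<in> sets (\<mu> \<Otimes>\<^sub>M \<nu>)"
        using s sets_eq_imp_space_eq[OF s] by simp
      show "AE x in \<mu>. AE y in \<nu>. norm (fst (x, y) - snd (x, y)) \<le> 2 * B"
        using bd(1)
      proof eventually_elim
        case (elim x)
        show ?case using bd(2)
          by eventually_elim (use elim in \<open>auto intro: order_trans[OF norm_triangle_ineq4]\<close>)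
      qed
    qed
    then have "AE z in \<mu> \<Otimes>\<^sub>M \<nu>. ennreal ((norm (fst z - snd z))^2) \<le> ennreal ((2 * B)^2)"
      by eventually_elim (rule ennreal_leI[OF power_mono[OF _ norm_ge_zero]])
    then have "(\<integral>\<^sup>+ z. ennreal ((norm (fst z - snd z))^2) \<partial>(\<mu> \<Otimes>\<^sub>M \<nu>)) \<le> (\<integral>\<^sup>+ z. ennreal ((2 * B)^2) \<partial>(\<mu> \<Otimes>\<^sub>M \<nu>))"
      by (rule nn_integral_mono_AE)
    also have "\<dots> = ennreal ((2 * B)^2)" by (simp add: emeasure_space_1)
    finally have "?c (\<mu> \<Otimes>\<^sub>M \<nu>) < \<infinity>" by (auto simp: case_prod_beta' intro: le_less_trans)
    then show ?thesis using product_in_couplings[OF pr] by (auto intro: le_less_trans[OF INF_lower])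
  qed
  ultimately have "?D^2 \<le> enn2real ?I" by (metis enn2real_ennreal enn2real_mono infinity_ennreal_def zero_le_power2)
  then have "\<bar>?D\<bar> \<le> W2 \<mu> \<nu>" unfolding W2_def by (metis real_sqrt_abs real_sqrt_le_mono)
  moreover have "?D = (integral\<^sup>L \<mu> f - integral\<^sup>L \<nu> f) / L" by (simp add: diff_divide_distrib)
  ultimately show ?thesis using L by (simp add: field_simps)
qed

lemma gibbs_law:
  fixes V :: "real^2 \<Rightarrow> real"
  assumes m: "(\<lambda>x. indicator S x * exp (- V x) :: real) \<in> borel_measurable \<mu>" and int: "integrable \<mu> (\<lambda>x. indicator S x * exp (- V x))"
    and Z: "Z = (LINT x|\<mu>. indicator S x * exp (- V x))" "0 < Z"
  shows "prob_space (gibbs \<mu> S V)" "sets (gibbs \<mu> S V) = sets \<mu>" "AE x in gibbs \<mu> S V. x \<in> S"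
    and "f \<in> borel_measurable \<mu> \<Longrightarrow> integrable \<mu> (\<lambda>x. indicator S x * exp (- V x) * f x) \<Longrightarrow>
       integrable (gibbs \<mu> S V) f \<and> integral\<^sup>L (gibbs \<mu> S V) f = (LINT x|\<mu>. indicator S x * exp (- V x) * f x) / Z"
proof -
  have g: "gibbs \<mu> S V = density \<mu> (\<lambda>x. ennreal (indicator S x * exp (- V x) / Z))"
    unfolding gibbs_def Z set_lebesgue_integral_def by simp
  have m': "(\<lambda>x. indicator S x * exp (- V x) / Z) \<in> borel_measurable \<mu>" using m by measurable
  have nn: "AE x in \<mu>. 0 \<le> indicator S x * exp (- V x) / Z" using Z by auto
  show "sets (gibbs \<mu> S V) = sets \<mu>" by (simp add: g)
  show "prob_space (gibbs \<mu> S V)"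
  proof
    have "emeasure (gibbs \<mu> S V) (space (gibbs \<mu> S V)) = (\<integral>\<^sup>+x. ennreal (indicator S x * exp (- V x) / Z) \<partial>\<mu>)"
      unfolding g using m' by (subst emeasure_density) (auto intro!: nn_integral_cong)
    also have "\<dots> = ennreal (LINT x|\<mu>. indicator S x * exp (- V x) / Z)"
      using int nn by (intro nn_integral_eq_integral) auto
    also have "(LINT x|\<mu>. indicator S x * exp (- V x) / Z) = 1" using Z by simp
    finally show "emeasure (gibbs \<mu> S V) (space (gibbs \<mu> S V)) = 1" by simp
  qed
  show "AE x in gibbs \<mu> S V. x \<in> S"
    unfolding g using m' by (subst AE_density) (auto simp: indicator_def)
  assume f: "f \<in> borel_measurable \<mu>" "integrable \<mu> (\<lambda>x. indicator S x * exp (- V x) * f x)"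
  then have "integrable \<mu> (\<lambda>x. indicator S x * exp (- V x) / Z * f x)"
    using integrable_divide[OF f(2), of Z] by simp
  then show "integrable (gibbs \<mu> S V) f \<and> integral\<^sup>L (gibbs \<mu> S V) f = (LINT x|\<mu>. indicator S x * exp (- V x) * f x) / Z"
    unfolding g using integrable_real_density[OF m' nn f(1)] integral_real_density[OF m' nn f(1)] by simp
qed

subsection \<open>Gaussian moments\<close>

text \<open>One shape for both regimes: an affine factor bounds the edge slices from above, a cubic
  one bounds the corner slices from below.\<close>

definition gpoly :: "real \<Rightarrow> real \<Rightarrow> real \<Rightarrow> real \<Rightarrow> real \<Rightarrow> real \<Rightarrow> real" where
  "gpoly \<sigma> a0 a1 a2 a3 v = exp (- (v^2) / (2 * \<sigma>^2)) * (a0 + a1 * \<bar>v\<bar> + a2 * v^2 + a3 * \<bar>v\<bar>^3)"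

lemma gaussian_moments:
  assumes \<sigma>: "0 < \<sigma>"
  shows "has_bochner_integral lborel (gpoly \<sigma> a0 a1 a2 a3)
    (sqrt (2 * pi) * \<sigma> * (a0 + sqrt (2 / pi) * a1 * \<sigma> + a2 * \<sigma>^2 + 2 * sqrt (2 / pi) * a3 * \<sigma>^3))"
proof -
  let ?n = "normal_density 0 \<sigma>"
  have m0: "has_bochner_integral lborel (\<lambda>v. ?n v * a0) (1 * a0)"
    using has_bochner_integral_mult_left[OF normal_moment_even[OF \<sigma>, of 0 0], of a0] by simp
  have m1: "has_bochner_integral lborel (\<lambda>v. ?n v * \<bar>v\<bar> * a1) (\<sigma> * sqrt (2 / pi) * a1)"
    using has_bochner_integral_mult_left[OF normal_moment_abs_odd[OF \<sigma>, of 0 0], of a1] by simp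
  have m2: "has_bochner_integral lborel (\<lambda>v. ?n v * v^2 * a2) (\<sigma>^2 * a2)"
    using has_bochner_integral_mult_left[OF normal_moment_even[OF \<sigma>, of 0 1], of a2] by simp
  have m3: "has_bochner_integral lborel (\<lambda>v. ?n v * \<bar>v\<bar>^3 * a3) (2 * \<sigma>^3 * sqrt (2 / pi) * a3)"
    using has_bochner_integral_mult_left[OF normal_moment_abs_odd[OF \<sigma>, of 0 1], of a3] by (simp add: eval_nat_numeral)
  have nd: "sqrt (2 * pi) * \<sigma> * ?n v = exp (- (v^2) / (2 * \<sigma>^2))" for v
    using \<sigma> by (simp add: normal_density_def real_sqrt_mult)
  have "gpoly \<sigma> a0 a1 a2 a3 = (\<lambda>v. (sqrt (2 * pi) * \<sigma>) * (?n v * a0 + ?n v * \<bar>v\<bar> * a1 + ?n v * v^2 * a2 + ?n v * \<bar>v\<bar>^3 * a3))"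
    unfolding gpoly_def nd[symmetric] by (simp add: algebra_simps)
  moreover have "has_bochner_integral lborel (\<lambda>v. (sqrt (2 * pi) * \<sigma>) * (?n v * a0 + ?n v * \<bar>v\<bar> * a1 + ?n v * v^2 * a2 + ?n v * \<bar>v\<bar>^3 * a3))
     ((sqrt (2 * pi) * \<sigma>) * (1 * a0 + \<sigma> * sqrt (2 / pi) * a1 + \<sigma>^2 * a2 + 2 * \<sigma>^3 * sqrt (2 / pi) * a3))"
    by (intro has_bochner_integral_mult_right has_bochner_integral_add m0 m1 m2 m3)
  ultimately show ?thesis by (simp add: algebra_simps)
qed

lemma sqrt_2_over_pi_le_1: "sqrt (2 / pi) \<le> 1"
  using pi_gt3 by simp

lemma gaussian_upper:
  assumes "0 < \<sigma>" "0 \<le> a1"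
  shows "integrable lborel (gpoly \<sigma> a0 a1 0 0)" "(LINT v|lborel. gpoly \<sigma> a0 a1 0 0 v) \<le> sqrt (2 * pi) * \<sigma> * (a0 + a1 * \<sigma>)"
proof -
  note h = gaussian_moments[OF assms(1), of a0 a1 0 0]
  show "integrable lborel (gpoly \<sigma> a0 a1 0 0)" using h by (simp add: has_bochner_integral_iff)
  have "sqrt (2 / pi) * (a1 * \<sigma>) \<le> 1 * (a1 * \<sigma>)" using assms sqrt_2_over_pi_le_1 by (intro mult_right_mono) auto
  then show "(LINT v|lborel. gpoly \<sigma> a0 a1 0 0 v) \<le> sqrt (2 * pi) * \<sigma> * (a0 + a1 * \<sigma>)"
    unfolding has_bochner_integral_integral_eq[OF h] using assms by (intro mult_left_mono) (auto simp: mult.assoc)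
qed

lemma gaussian_lower:
  assumes "0 < \<sigma>" "0 \<le> a1" "0 \<le> a3"
  shows "integrable lborel (gpoly \<sigma> a0 (- a1) (- a2) (- a3))"
    "sqrt (2 * pi) * \<sigma> * (a0 - a1 * \<sigma> - a2 * \<sigma>^2 - 2 * a3 * \<sigma>^3) \<le> (LINT v|lborel. gpoly \<sigma> a0 (- a1) (- a2) (- a3) v)"
proof -
  note h = gaussian_moments[OF assms(1), of a0 "- a1" "- a2" "- a3"]
  show "integrable lborel (gpoly \<sigma> a0 (- a1) (- a2) (- a3))" using h by (simp add: has_bochner_integral_iff)
  have "sqrt (2 / pi) * (a1 * \<sigma>) \<le> 1 * (a1 * \<sigma>)" "sqrt (2 / pi) * (2 * a3 * \<sigma>^3) \<le> 1 * (2 * a3 * \<sigma>^3)"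
    using assms sqrt_2_over_pi_le_1 by (intro mult_right_mono; simp)+
  then show "sqrt (2 * pi) * \<sigma> * (a0 - a1 * \<sigma> - a2 * \<sigma>^2 - 2 * a3 * \<sigma>^3) \<le> (LINT v|lborel. gpoly \<sigma> a0 (- a1) (- a2) (- a3) v)"
    unfolding has_bochner_integral_integral_eq[OF h]
  proof (intro mult_left_mono)
    let ?k = "sqrt (2 / pi)"
    assume k: "?k * (a1 * \<sigma>) \<le> 1 * (a1 * \<sigma>)" "?k * (2 * a3 * \<sigma>^3) \<le> 1 * (2 * a3 * \<sigma>^3)"
    have "?k * (- a1) * \<sigma> = - (?k * (a1 * \<sigma>))" "2 * ?k * (- a3) * \<sigma>^3 = - (?k * (2 * a3 * \<sigma>^3))"
      "- a2 * \<sigma>^2 = - (a2 * \<sigma>^2)" by algebra+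
    then show "a0 - a1 * \<sigma> - a2 * \<sigma>^2 - 2 * a3 * \<sigma>^3 \<le> a0 + ?k * (- a1) * \<sigma> + - a2 * \<sigma>^2 + 2 * ?k * (- a3) * \<sigma>^3"
      using k by linarith
  qed (use assms in auto)
qed


subsection \<open>Arclength\<close>

definition gspeed :: "real \<Rightarrow> real" where "gspeed s = norm (vector_derivative gam (at s))"

lemma gspeed_nonneg: "0 \<le> gspeed s" by (simp add: gspeed_def)

lemma gam_param1: "closed_curve_param 1 gam M\<^sub>\<Omega>"
  by (rule closed_curve_param_mono[OF gam_param]) simp

lemma gam_has_derivative: "(gam has_vector_derivative vector_derivative gam (at s)) (at s)"
  by (rule closed_curve_paramD(2)[OF gam_param1])

lemma continuous_gspeed: "continuous_on S gspeed"
  unfolding gspeed_def using continuous_on_subset[OF closed_curve_paramD(3)[OF gam_param1] subset_UNIV]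
  by (rule continuous_on_norm)

lemma continuous_gam: "continuous_on S gam"
  using continuous_on_subset[OF closed_curve_paramD(1)[OF gam_param1] subset_UNIV] .

lemma gam_measurable[measurable]: "gam \<in> borel_measurable borel"
  using continuous_gam by (rule borel_measurable_continuous_onI)

lemma gspeed_measurable[measurable]: "gspeed \<in> borel_measurable borel"
  using continuous_gspeed by (rule borel_measurable_continuous_onI)

lemma Vol_M: "Vol M\<^sub>\<Omega> = distr (density lborel (\<lambda>s. ennreal (indicator {0..<1} s * gspeed s))) borel gam"
  unfolding Vol_eq_curve_measure[OF gam_param1] curve_measure_def gspeed_def
  by (intro arg_cong[where f="\<lambda>f. distr (density lborel f) borel gam"] ext) (simp add: indicator_def)

lemma Vol_integral:
  fixes F :: "real^2 \<Rightarrow> real"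
  assumes F[measurable]: "F \<in> borel_measurable borel" and B: "\<And>p. p \<in> M\<^sub>\<Omega> \<Longrightarrow> \<bar>F p\<bar> \<le> B"
  shows "integrable (Vol M\<^sub>\<Omega>) F" "integral\<^sup>L (Vol M\<^sub>\<Omega>) F = (LINT s|lborel. indicator {0..<1} s * gspeed s * F (gam s))"
    "integrable lborel (\<lambda>s. indicator {0..<1} s * gspeed s * F (gam s))"
proof -
  obtain C where C: "\<And>s. s \<in> {0..1} \<Longrightarrow> gspeed s \<le> C"
    using continuous_attains_sup[of "{0..1::real}" gspeed] continuous_gspeed by fastforce
  have C0: "0 \<le> C" using order_trans[OF gspeed_nonneg C[of 0]] by simp
  have MR: "gam s \<in> M\<^sub>\<Omega>" for s using range_gam by auto
  then have B0: "0 \<le> B" using B[of "gam 0"] by (meson abs_ge_zero order_trans)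
  show i: "integrable lborel (\<lambda>s. indicator {0..<1} s * gspeed s * F (gam s))"
  proof (rule Bochner_Integration.integrable_bound)
    show "integrable lborel (\<lambda>s::real. indicator {0..1} s * (C * B))" by simp
    have "gspeed s * \<bar>F (gam s)\<bar> \<le> C * B" if "0 \<le> s" "s < 1" for s
      using C[of s] B[OF MR] that C0 by (intro mult_mono) (auto simp: gspeed_def)
    then show "AE s in lborel. norm (indicator {0..<1} s * gspeed s * F (gam s)) \<le> norm (indicator {0..1} s * (C * B))"
      using C0 B0 by (intro AE_I2) (auto simp: indicator_def abs_mult gspeed_def)
  qed measurable
  have nn: "AE s in lborel. 0 \<le> indicator {0..<1} s * gspeed s" by (intro AE_I2) (simp add: gspeed_def)
  show "integrable (Vol M\<^sub>\<Omega>) F" unfolding Vol_M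
    using i nn by (subst integrable_distr_eq) (auto simp: integrable_real_density)
  show "integral\<^sup>L (Vol M\<^sub>\<Omega>) F = (LINT s|lborel. indicator {0..<1} s * gspeed s * F (gam s))" unfolding Vol_M
    using nn by (subst integral_distr) (auto simp: integral_real_density)
qed

text \<open>The parameter at which \<open>gam\<close> passes over \<open>x\<close>: 1/4 belongs to
  the top point over 0, and \<open>arctan\<close> adds the angle from the second axis as a fraction
  of a full turn.\<close>

definition top_angle :: "real \<Rightarrow> real" where "top_angle x = 1/4 + arctan (x / qt x) / (2 * pi)"

lemma gam_top_angle: assumes "\<bar>x\<bar> < 3" shows "gam (top_angle x) = pt x (qt x)"
proof -
  let ?a = "arctan (x / qt x)"
  have q: "0 < qt x" using qt_gt_1[OF assms] by simp
  define c where "c = sqrt (1 + (x / qt x)^2)"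
  have c: "0 < c" by (simp add: c_def add_pos_nonneg)
  have ang: "2 * pi * top_angle x = pi / 2 + ?a" by (simp add: top_angle_def field_simps)
  have "cos (pi / 2 + ?a) = - sin ?a" "sin (pi / 2 + ?a) = cos ?a" by (simp_all add: sin_add cos_add)
  then have d: "dir (2 * pi * top_angle x) = pt (x / qt x / c) (1 / c)"
    unfolding dir_def ang by (simp add: sin_arctan cos_arctan c_def)
  then have e: "(qt x * c) *\<^sub>R dir (2 * pi * top_angle x) = pt x (qt x)" using q c by (simp add: vec_eq_iff forall_2)
  moreover have "radius (2 * pi * top_angle x) = qt x * c"
    using qt_in_M[OF assms] q c e by (intro radius_eqI) (auto simp: M_eq)
  ultimately show ?thesis by (simp add: gam_eq)
qed

lemma top_angle_range: assumes "\<bar>x\<bar> < 3" shows "0 < top_angle x" "top_angle x < 1/2"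
proof -
  have "- (1/4) < arctan (x / qt x) / (2 * pi)" "arctan (x / qt x) / (2 * pi) < 1/4"
    using arctan_bounded[of "x / qt x"] pi_gt_zero by (simp_all add: field_simps)
  then show "0 < top_angle x" "top_angle x < 1/2" unfolding top_angle_def by linarith+
qed

definition dtop_angle :: "real \<Rightarrow> real" where
  "dtop_angle x = inverse (1 + (x / qt x)^2) * ((1 * qt x - x * dqt x) / (qt x * qt x)) / (2 * pi)"

lemma DERIV_top_angle: assumes "\<bar>x\<bar> < 3" shows "(top_angle has_real_derivative dtop_angle x) (at x)"
proof -
  have q: "qt x \<noteq> 0" using qt_gt_1[OF assms] by simp
  have "((\<lambda>x. x / qt x) has_real_derivative (1 * qt x - x * dqt x) / (qt x * qt x)) (at x)"
    by (rule DERIV_divide[OF DERIV_ident DERIV_qt[OF assms] q])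
  from DERIV_chain2[OF DERIV_arctan this]
  have "((\<lambda>x. 1/4 + arctan (x / qt x) / (2 * pi)) has_real_derivative
      0 + inverse (1 + (x / qt x)^2) * ((1 * qt x - x * dqt x) / (qt x * qt x)) / (2 * pi)) (at x)"
    by (intro DERIV_add DERIV_const DERIV_cdivide)
  then show ?thesis by (simp add: top_angle_def[abs_def] dtop_angle_def)
qed

lemma dtop_angle_nonneg: assumes "\<bar>x\<bar> < 3" shows "0 \<le> dtop_angle x"
proof -
  have q: "0 < qt x - 1" using qt_gt_1[OF assms] by simp
  have "0 \<le> x * dqq 2 x"
    by (cases "x \<ge> 0") (auto simp: dqq_def max_def intro: mult_nonpos_nonneg)
  then have "x * dqt x \<le> 0" using q by (simp add: dqt_def divide_nonneg_pos)
  then show ?thesis using q unfolding dtop_angle_def by (intro divide_nonneg_pos mult_nonneg_nonneg) auto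
qed

lemma continuous_qt: "continuous_on {-5/2..5/2} qt"
  by (rule continuous_at_imp_continuous_on) (auto intro!: DERIV_isCont[OF DERIV_qt])

lemma continuous_dqt: "continuous_on {-5/2..5/2} dqt"
proof -
  have "continuous_on {-5/2..5/2} (dqq 2)" using Ck_continuous[OF Ck_dqq] continuous_on_subset by blast
  moreover have "qt x \<noteq> 1" if "x \<in> {-5/2..5/2}" for x
  proof -
    have "\<bar>x\<bar> < 3" using that unfolding abs_less_iff by auto
    then show ?thesis using qt_gt_1[of x] by simp
  qed
  ultimately show ?thesis unfolding dqt_def[abs_def] by (intro continuous_intros continuous_qt) auto
qed

text \<open>The upper arc is both \<open>gam (top_angle x)\<close> and \<open>pt x (qt x)\<close>;
  the norms of the two derivatives agree.\<close>

lemma graph_speed: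
  assumes "\<bar>x\<bar> < 3" shows "gspeed (top_angle x) * dtop_angle x = sqrt (1 + (dqt x)^2)"
proof -
  let ?v = "vector_derivative gam (at (top_angle x))"
  have "((\<lambda>x. gam (top_angle x)) has_vector_derivative dtop_angle x *\<^sub>R ?v) (at x)"
    using vector_diff_chain_at[of top_angle "dtop_angle x" x gam ?v] DERIV_top_angle[OF assms] gam_has_derivative
    by (simp add: has_real_derivative_iff_has_vector_derivative o_def)
  moreover have "((\<lambda>x. pt x (qt x)) has_vector_derivative pt 1 (dqt x)) (at x)"
    by (intro has_vector_derivative_pt DERIV_ident DERIV_qt assms)
  then have "((\<lambda>x. gam (top_angle x)) has_vector_derivative pt 1 (dqt x)) (at x)"
  proof (rule has_vector_derivative_transform_within_open[of _ _ _ "{-3<..<3}"])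
    show "\<And>y. y \<in> {-3<..<3} \<Longrightarrow> pt y (qt y) = gam (top_angle y)" using gam_top_angle by (simp add: abs_less_iff)
  qed (use assms in auto)
  ultimately have "dtop_angle x *\<^sub>R ?v = pt 1 (dqt x)" by (rule vector_derivative_unique_at)
  then have "norm (dtop_angle x *\<^sub>R ?v) = norm (pt 1 (dqt x))" by simp
  moreover have "norm (dtop_angle x *\<^sub>R ?v) = gspeed (top_angle x) * dtop_angle x"
    using dtop_angle_nonneg[OF assms] by (simp add: gspeed_def)
  moreover have "norm (pt 1 (dqt x)) = sqrt (1 + (dqt x)^2)" by (simp add: norm2)
  ultimately show ?thesis by simp
qed

text \<open>Injectivity of \<open>gam\<close> on a period shows that only parameters
  \<open>top_angle x\<close> with \<open>x\<close> in the interval contribute; monotone substitution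
  then changes the variable to the abscissa.\<close>

lemma Vol_integral_graph:
  fixes F :: "real^2 \<Rightarrow> real"
  assumes F[measurable]: "F \<in> borel_measurable borel" and B: "\<And>p. p \<in> M\<^sub>\<Omega> \<Longrightarrow> \<bar>F p\<bar> \<le> B"
    and ab: "-5/2 \<le> a" "a \<le> b" "b \<le> 5/2"
    and supp: "\<And>p. p \<in> M\<^sub>\<Omega> \<Longrightarrow> F p \<noteq> 0 \<Longrightarrow> \<exists>x\<in>{a..b}. p = pt x (qt x)"
  shows "integrable lborel (\<lambda>x. F (pt x (qt x)) * sqrt (1 + (dqt x)^2) * indicator {a..b} x)"
    "integral\<^sup>L (Vol M\<^sub>\<Omega>) F = (LINT x|lborel. F (pt x (qt x)) * sqrt (1 + (dqt x)^2) * indicator {a..b} x)"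
proof -
  define f where "f s = gspeed s * F (gam s)" for s
  have x3: "\<bar>x\<bar> < 3" if "x \<in> {a..b}" for x using that ab by auto
  have mono': "top_angle u \<le> top_angle v" if "a \<le> u" "u \<le> v" "v \<le> b" for u v
  proof (rule DERIV_nonneg_imp_nondecreasing[OF that(2)])
    fix x assume "u \<le> x" "x \<le> v"
    then have "\<bar>x\<bar> < 3" using that by (intro x3) auto
    then show "\<exists>y. (top_angle has_real_derivative y) (at x) \<and> 0 \<le> y"
      using DERIV_top_angle dtop_angle_nonneg by blast
  qed
  have mono: "top_angle a \<le> top_angle x" "top_angle x \<le> top_angle b" if "x \<in> {a..b}" for x
    using that by (auto intro: mono')
  have r: "0 < top_angle a" "top_angle b < 1/2" using top_angle_range x3[of a] x3[of b] ab by auto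
  have eq: "indicator {0..<1} s * gspeed s * F (gam s) = f s * indicator {top_angle a..top_angle b} s" for s
  proof (cases "s \<in> {0..<1} \<and> F (gam s) \<noteq> 0")
    case True
    then obtain x where x: "x \<in> {a..b}" "gam s = pt x (qt x)" using supp[of "gam s"] range_gam by blast
    then have "gam s = gam (top_angle x)" using gam_top_angle x3 by simp
    then have "s = top_angle x" using inj_onD[OF inj_gam, of s "top_angle x"] top_angle_range[OF x3[OF x(1)]] True by auto
    then show ?thesis using mono[OF x(1)] True by (simp add: f_def)
  next
    case False
    then show ?thesis using r by (auto simp: f_def indicator_def)
  qed
  note i = Vol_integral[OF F B]
  have si: "set_integrable lborel {top_angle a..top_angle b} f"
    using i(3) unfolding set_integrable_def eq by (simp add: mult.commute)
  have contd: "continuous_on {a..b} dtop_angle"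
  proof -
    have "continuous_on {a..b} qt" "continuous_on {a..b} dqt"
      by (rule continuous_on_subset[OF continuous_qt] continuous_on_subset[OF continuous_dqt], use ab in auto)+
    moreover have "qt x \<noteq> 0" if "x \<in> {a..b}" for x using qt_gt_1[OF x3[OF that]] by simp
    moreover have "1 + (x / qt x)^2 \<noteq> 0" for x using zero_le_power2[of "x / qt x"] by linarith
    ultimately show ?thesis unfolding dtop_angle_def[abs_def] by (intro continuous_intros) auto
  qed
  note sub = integral_substitution[OF si DERIV_top_angle contd dtop_angle_nonneg ab(2)]
  have e: "f (top_angle x) * dtop_angle x * indicator {a..b} x = F (pt x (qt x)) * sqrt (1 + (dqt x)^2) * indicator {a..b} x" for x
    using graph_speed[OF x3, of x] gam_top_angle[OF x3, of x]
    by (cases "x \<in> {a..b}") (auto simp: f_def algebra_simps simp del: One_nat_def)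
  show "integrable lborel (\<lambda>x. F (pt x (qt x)) * sqrt (1 + (dqt x)^2) * indicator {a..b} x)"
    using sub(1)[OF x3 x3] unfolding set_integrable_def e[symmetric] by (simp add: mult.commute)
  have "integral\<^sup>L (Vol M\<^sub>\<Omega>) F = (LINT s|lborel. f s * indicator {top_angle a..top_angle b} s)"
    by (simp only: i(2) eq)
  also have "\<dots> = (LINT x|lborel. f (top_angle x) * dtop_angle x * indicator {a..b} x)"
    by (rule sub(2)[OF x3 x3])
  finally show "integral\<^sup>L (Vol M\<^sub>\<Omega>) F = (LINT x|lborel. F (pt x (qt x)) * sqrt (1 + (dqt x)^2) * indicator {a..b} x)"
    by (simp only: e)
qed

subsection \<open>Bump functions\<close>

text \<open>A cone over a ball: exactly 1-Lipschitz, which is what the duality bound asks of a test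
  function.\<close>

definition bump :: "real^2 \<Rightarrow> real \<Rightarrow> real^2 \<Rightarrow> real" where
  "bump p \<rho> x = max 0 (\<rho> - dist x p)"

lemma bump_lipschitz: "\<bar>bump p \<rho> x - bump p \<rho> y\<bar> \<le> norm (x - y)"
proof -
  have "\<bar>dist x p - dist y p\<bar> \<le> norm (x - y)"
    using dist_triangle2[of x p y] dist_triangle[of y p x] by (simp add: dist_norm norm_minus_commute abs_le_iff)
  moreover have "\<bar>max 0 (\<rho> - a) - max 0 (\<rho> - b)\<bar> \<le> \<bar>a - b\<bar>" for a b :: real by linarith
  ultimately show ?thesis unfolding bump_def by (meson order_trans)
qed

lemma bump_nonneg: "0 \<le> bump p \<rho> x" by (simp add: bump_def)

lemma bump_le: "0 \<le> \<rho> \<Longrightarrow> bump p \<rho> x \<le> \<rho>" by (simp add: bump_def)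

lemma bump_abs_le: "0 \<le> \<rho> \<Longrightarrow> \<bar>bump p \<rho> x\<bar> \<le> \<rho>" by (simp add: bump_def)

lemma bump_support: "bump p \<rho> x \<noteq> 0 \<Longrightarrow> dist x p < \<rho>" by (auto simp: bump_def max_def split: if_splits)

lemma continuous_bump: "continuous_on S (bump p \<rho>)"
  unfolding bump_def by (intro continuous_intros)

lemma bump_measurable[measurable]: "bump p \<rho> \<in> borel_measurable borel"
  using continuous_bump by (rule borel_measurable_continuous_onI)

lemma dist_pt_ge: "\<bar>x - x'\<bar> \<le> dist (pt x y) (pt x' y')" "\<bar>y - y'\<bar> \<le> dist (pt x y) (pt x' y')"
  using component_le_norm_cart[of "pt x y - pt x' y'" 1] component_le_norm_cart[of "pt x y - pt x' y'" 2]
  by (auto simp: dist_norm)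

lemma dist_pt_le: "dist (pt x y) (pt x' y') \<le> \<bar>x - x'\<bar> + \<bar>y - y'\<bar>"
  using norm_le_abs_sum2[of "pt x y - pt x' y'"] by (simp add: dist_norm)

lemma dist_pt_vertical: "dist (pt x y) (pt x y') = \<bar>y - y'\<bar>" by (simp add: dist_norm norm2)

lemma infdist_ge:
  assumes "A \<noteq> {}" "\<And>a. a \<in> A \<Longrightarrow> d \<le> dist x a" shows "d \<le> infdist x A"
  using assms by (simp add: infdist_notempty cINF_greatest)

lemma M_flat_point: "p \<in> M\<^sub>\<Omega> \<Longrightarrow> \<bar>p$1\<bar> \<le> 2 \<Longrightarrow> 1 < p$2 \<Longrightarrow> p$2 = 2"
  using pt_top_in_M_iff[of "p$1" "p$2"] qt_flat(1)[of "p$1"] by (simp add: pt_components)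

lemma flat_point_in_M: "\<bar>x\<bar> \<le> 2 \<Longrightarrow> pt x 2 \<in> M\<^sub>\<Omega>"
  using qt_in_M[of x] qt_flat(1)[of x] by simp

text \<open>A hull point within 1/4 of \<open>pt x y\<close> has all its vertices within
  \<open>3 * t\<close>, hence on the flat part, so its own second coordinate is 2. All other hull
  points are too far away to matter, as \<open>\<bar>y - 2\<bar> \<le> 1/4\<close>.\<close>

lemma infdist_Conv_flat:
  assumes X: "finite X" "X \<noteq> {}" "X \<subseteq> M\<^sub>\<Omega>" and t: "0 < t" "t \<le> 1/20" and xy: "\<bar>x\<bar> \<le> 1/4" "\<bar>y - 2\<bar> \<le> 1/4"
  shows "\<bar>y - 2\<bar> \<le> infdist (pt x y) (Conv t X)"
proof (rule infdist_ge)
  show "Conv t X \<noteq> {}" using Conv_nonempty[OF X(1,2)] t by simp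
  fix a assume a: "a \<in> Conv t X"
  obtain \<sigma> where s: "\<sigma> \<noteq> {}" "\<sigma> \<subseteq> X" "a \<in> convex hull \<sigma>" "\<And>x. x \<in> \<sigma> \<Longrightarrow> norm (x - a) \<le> 3 * t"
    using Conv_obtain[OF X(1) a t(1)] by blast
  show "\<bar>y - 2\<bar> \<le> dist (pt x y) a"
  proof (cases "dist (pt x y) a \<le> 1/4")
    case True
    have a12: "\<bar>x - a$1\<bar> \<le> 1/4" "\<bar>y - a$2\<bar> \<le> 1/4"
      using dist_pt_ge(1)[of x "a$1" y "a$2"] dist_pt_ge(2)[of y "a$2" x "a$1"] True by (auto simp: pt_components)
    have "\<sigma> \<subseteq> {z. axis 2 1 \<bullet> z = 2}"
    proof
      fix z assume z: "z \<in> \<sigma>"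
      have "\<bar>(z - a)$1\<bar> \<le> 3 * t" "\<bar>(z - a)$2\<bar> \<le> 3 * t"
        using s(4)[OF z] component_le_norm_cart[of "z - a"] order_trans by blast+
      then have zz: "\<bar>z$1 - a$1\<bar> \<le> 3 * t" "\<bar>z$2 - a$2\<bar> \<le> 3 * t" by simp_all
      have "z \<in> M\<^sub>\<Omega>" using z s X by blast
      moreover have "\<bar>z$1\<bar> \<le> 2" using zz(1) a12(1) xy(1) t by linarith
      moreover have "1 < z$2" using zz(2) a12(2) xy(2) t by linarith
      ultimately have "z$2 = 2" by (rule M_flat_point)
      then show "z \<in> {z. axis 2 1 \<bullet> z = 2}" by (simp add: inner_axis')
    qed
    then have "convex hull \<sigma> \<subseteq> {z. axis 2 1 \<bullet> z = 2}" by (intro hull_minimal convex_hyperplane)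
    then have "a$2 = 2" using s(3) by (auto simp: inner_axis')
    then show ?thesis using dist_pt_ge(2)[of y "a$2" x "a$1"] unfolding pt_components by simp
  next
    case False then show ?thesis using xy by linarith
  qed
qed

subsection \<open>The penalized and the target law\<close>

text \<open>The quantitative content of the assumptions on \<open>K\<close>, the potential and the
  cutoff. The density \<open>exp (- g)\<close> rather than \<open>g\<close> is taken as the bounded
  and Lipschitz object, since it is what multiplies test functions.\<close>

locale tube =
  fixes K :: "(real^2) set" and g :: "real^2 \<Rightarrow> real" and \<phi> :: "real \<Rightarrow> real" and r E0 E1 \<Lambda> :: real
  assumes compact_K: "compact K" and r: "0 < r" and nbhd: "\<And>m x. m \<in> M\<^sub>\<Omega> \<Longrightarrow> dist x m \<le> 3 * r \<Longrightarrow> x \<in> K"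
    and cont_g: "continuous_on K g"
    and E: "\<And>x. x \<in> K \<Longrightarrow> E0 \<le> exp (- g x)" "\<And>x. x \<in> K \<Longrightarrow> exp (- g x) \<le> E1" "0 < E0"
    and lip: "\<And>x y. x \<in> K \<Longrightarrow> y \<in> K \<Longrightarrow> \<bar>exp (- g x) - exp (- g y)\<bar> \<le> \<Lambda> * norm (x - y)"
    and cont_\<phi>: "continuous_on {0..} \<phi>" and mono_\<phi>: "mono_on {0..} \<phi>" and \<phi>_id: "\<And>s. 0 \<le> s \<Longrightarrow> s \<le> r^2 \<Longrightarrow> \<phi> s = s"
begin

lemma M_subset_K: "M\<^sub>\<Omega> \<subseteq> K" using nbhd r by force

lemma \<phi>_nonneg: "0 \<le> s \<Longrightarrow> 0 \<le> \<phi> s"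
  using mono_onD[OF mono_\<phi>, of 0 s] \<phi>_id[of 0] by simp

lemma \<Lambda>_nonneg: "0 \<le> \<Lambda>"
proof -
  have "pt 0 2 \<in> K" "pt 1 2 \<in> K" using flat_point_in_M[of 0] flat_point_in_M[of 1] M_subset_K by auto
  then have "0 \<le> \<Lambda> * norm (pt 0 2 - pt 1 2)" using lip by (meson abs_ge_zero order_trans)
  moreover have "norm (pt 0 2 - pt 1 2) = 1" by (simp add: norm2)
  ultimately show ?thesis by simp
qed

lemma E01: "E0 \<le> E1"
proof -
  have "pt 0 2 \<in> K" using flat_point_in_M[of 0] M_subset_K by auto
  then show ?thesis using E(1,2) by (meson order_trans)
qed

definition wt :: "(real^2) set \<Rightarrow> real \<Rightarrow> real^2 \<Rightarrow> real" where
  "wt A \<kappa> x = indicator K x * exp (- (g x + \<kappa> / 2 * \<phi> ((infdist x A)^2)))"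

text \<open>An unnormalized mean: dividing by \<open>W A \<kappa> (\<lambda>_. 1)\<close> gives the
  mean under the penalized law. \<open>vol\<close> below plays the same part for the target
  law.\<close>

definition W :: "(real^2) set \<Rightarrow> real \<Rightarrow> (real^2 \<Rightarrow> real) \<Rightarrow> real" where
  "W A \<kappa> f = (LINT x|lborel. wt A \<kappa> x * f x)"

lemma continuous_penalty: "continuous_on S (\<lambda>x. \<phi> ((infdist x A)^2))"
  by (rule continuous_on_compose2[OF cont_\<phi>]) (auto intro!: continuous_intros)

lemma wt_measurable[measurable]: "wt A \<kappa> \<in> borel_measurable borel"
proof -
  have "continuous_on K (\<lambda>x. exp (- (g x + \<kappa> / 2 * \<phi> ((infdist x A)^2))))"
    by (intro continuous_intros cont_g continuous_penalty)
  from borel_measurable_continuous_on_indicator[OF _ this] compact_K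
  show ?thesis unfolding wt_def[abs_def] by (simp add: compact_imp_closed borel_closed)
qed

lemma wt_nonneg: "0 \<le> wt A \<kappa> x" by (simp add: wt_def)

lemma wt_le: assumes "0 \<le> \<kappa>" shows "wt A \<kappa> x \<le> indicator K x * E1"
proof (cases "x \<in> K")
  case True
  have "exp (- (g x + \<kappa> / 2 * \<phi> ((infdist x A)^2))) \<le> exp (- g x)" using assms \<phi>_nonneg by simp
  from order_trans[OF this E(2)[OF True]] show ?thesis unfolding wt_def using True by simp
qed (simp add: wt_def)

lemma integrable_wt:
  assumes "0 \<le> \<kappa>" and f[measurable]: "f \<in> borel_measurable borel" and B: "\<And>x. \<bar>f x\<bar> \<le> B"
  shows "integrable lborel (\<lambda>x. wt A \<kappa> x * f x)"
proof (rule Bochner_Integration.integrable_bound)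
  have "emeasure lborel K < \<infinity>" using compact_K emeasure_compact_finite by blast
  then show "integrable lborel (\<lambda>x. indicator K x * (E1 * B))"
    using compact_K by (intro integrable_mult_left integrable_real_indicator) (auto simp: compact_imp_closed borel_closed)
  have B0: "0 \<le> B" using B[of 0] by linarith
  have "wt A \<kappa> x * \<bar>f x\<bar> \<le> indicator K x * E1 * B" for x
    using wt_le[OF assms(1)] B[of x] wt_nonneg E01 E(3) by (intro mult_mono) auto
  then show "AE x in lborel. norm (wt A \<kappa> x * f x) \<le> norm (indicator K x * (E1 * B))"
    using wt_nonneg E01 E(3) B0 by (intro AE_I2) (simp add: abs_mult mult.assoc)
qed measurable

lemma W_cmult: "W A \<kappa> (\<lambda>x. c * f x) = c * W A \<kappa> f"
  unfolding W_def by (simp add: mult.left_commute)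

definition vol :: "(real^2 \<Rightarrow> real) \<Rightarrow> real" where
  "vol f = (LINT p|Vol M\<^sub>\<Omega>. indicator M\<^sub>\<Omega> p * exp (- g p) * f p)"

lemma mass_measurable[measurable]: "(\<lambda>p. indicator M\<^sub>\<Omega> p * exp (- g p) :: real) \<in> borel_measurable borel"
proof -
  have "continuous_on M\<^sub>\<Omega> (\<lambda>p. exp (- g p))" by (intro continuous_intros continuous_on_subset[OF cont_g M_subset_K])
  from borel_measurable_continuous_on_indicator[OF _ this] compact_M
  show ?thesis by (simp add: compact_imp_closed borel_closed)
qed

lemma mass_bound:
  assumes "p \<in> M\<^sub>\<Omega>" "\<bar>f p\<bar> \<le> B" shows "\<bar>indicator M\<^sub>\<Omega> p * exp (- g p) * f p\<bar> \<le> E1 * B"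
proof -
  have "exp (- g p) * \<bar>f p\<bar> \<le> E1 * B" using E(2)[of p] assms M_subset_K E(3) E01 by (intro mult_mono) auto
  then show ?thesis using assms(1) by (simp add: abs_mult)
qed

lemma integrable_mass:
  assumes [measurable]: "f \<in> borel_measurable borel" and B: "\<And>p. \<bar>f p\<bar> \<le> B"
  shows "integrable (Vol M\<^sub>\<Omega>) (\<lambda>p. indicator M\<^sub>\<Omega> p * exp (- g p) * f p)"
  by (rule Vol_integral(1)[of _ "E1 * B"]) (use mass_bound B in auto)

lemma vol_mono:
  assumes "f \<in> borel_measurable borel" "h \<in> borel_measurable borel" "\<And>p. \<bar>f p\<bar> \<le> B" "\<And>p. \<bar>h p\<bar> \<le> B" "\<And>p. f p \<le> h p"
  shows "vol f \<le> vol h"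
  unfolding vol_def using assms by (intro integral_mono integrable_mass mult_left_mono) auto

lemma W_one_pos: assumes "0 \<le> \<kappa>" shows "0 < W A \<kappa> (\<lambda>_. 1)"
proof -
  have "compact ((\<lambda>x. \<phi> ((infdist x A)^2)) ` K)"
    by (rule compact_continuous_image[OF continuous_penalty compact_K])
  from compact_imp_bounded[OF this] obtain P where "\<forall>y\<in>(\<lambda>x. \<phi> ((infdist x A)^2)) ` K. \<bar>y\<bar> \<le> P"
    unfolding bounded_real by blast
  then have P: "\<phi> ((infdist x A)^2) \<le> P" if "x \<in> K" for x using that by (blast intro: abs_le_D1)
  let ?c = "E0 * exp (- (\<kappa> / 2 * P))" and ?B = "ball (pt 0 2) r"
  have BK: "?B \<subseteq> K" using nbhd[OF flat_point_in_M[of 0]] r by (auto simp: dist_commute)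
  have w: "indicator ?B x * ?c \<le> wt A \<kappa> x * 1" for x
  proof (cases "x \<in> ?B")
    case True
    then have x: "x \<in> K" using BK by blast
    have "\<kappa> / 2 * \<phi> ((infdist x A)^2) \<le> \<kappa> / 2 * P" using P[OF x] assms by (intro mult_left_mono) auto
    then have "?c \<le> exp (- g x) * exp (- (\<kappa> / 2 * \<phi> ((infdist x A)^2)))"
      using E(1)[OF x] E(3) by (intro mult_mono) auto
    also have "\<dots> = wt A \<kappa> x" using x by (simp add: wt_def exp_add[symmetric])
    finally show ?thesis using True by simp
  next
    case False then show ?thesis using wt_nonneg by simp
  qed
  have "emeasure lborel ?B < \<infinity>" by (rule emeasure_bounded_finite[OF bounded_ball])
  then have "(LINT x|lborel. indicator ?B x * ?c) \<le> W A \<kappa> (\<lambda>_. 1)"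
    unfolding W_def using w assms by (intro integral_mono integrable_wt[of _ _ 1] integrable_mult_left) auto
  moreover have "(LINT x|lborel. indicator ?B x * ?c) = measure lborel ?B * ?c" by simp
  moreover have "0 < measure lborel ?B" using r content_ball_pos by simp
  ultimately show ?thesis using E(3) by (smt (verit) exp_gt_zero mult_pos_pos)
qed

lemma W2_test:
  assumes \<kappa>: "0 < \<kappa>" and vol1: "0 < vol (\<lambda>_. 1)" and B: "\<And>x. \<bar>f x\<bar> \<le> B"
    and L: "\<And>x y. \<bar>f x - f y\<bar> \<le> L * norm (x - y)" "0 < L"
  shows "\<bar>W A \<kappa> f / W A \<kappa> (\<lambda>_. 1) - vol f / vol (\<lambda>_. 1)\<bar> \<le> L * W2 (penalized_law K g \<phi> A \<kappa>) (target_law g M\<^sub>\<Omega>)"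
proof -
  have cf: "continuous_on UNIV f"
  proof (rule lipschitz_on_continuous_on[of L])
    show "L-lipschitz_on UNIV f" using L by (intro lipschitz_onI) (auto simp: dist_norm)
  qed
  have fm[measurable]: "f \<in> borel_measurable borel" by (rule borel_measurable_continuous_onI[OF cf])
  note G = gibbs_law[where \<mu>=lborel and S=K and V="\<lambda>x. g x + \<kappa> / 2 * \<phi> ((infdist x A)^2)" and Z="W A \<kappa> (\<lambda>_. 1)", folded wt_def]
  have i1: "integrable lborel (wt A \<kappa>)" using integrable_wt[of \<kappa> "\<lambda>_. 1" 1 A] \<kappa> by simp
  have W1: "W A \<kappa> (\<lambda>_. 1) = integral\<^sup>L lborel (wt A \<kappa>)" by (simp add: W_def)
  have Gw: "prob_space (penalized_law K g \<phi> A \<kappa>)" "sets (penalized_law K g \<phi> A \<kappa>) = sets lborel"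
    "AE x in penalized_law K g \<phi> A \<kappa>. x \<in> K"
    "integrable (penalized_law K g \<phi> A \<kappa>) f \<and> integral\<^sup>L (penalized_law K g \<phi> A \<kappa>) f = W A \<kappa> f / W A \<kappa> (\<lambda>_. 1)"
    using G(1-3) G(4)[of f] i1 W1 W_one_pos[of \<kappa> A] \<kappa> integrable_wt[of \<kappa> f B A] B
    unfolding penalized_law_def by (simp_all add: W_def[of _ _ f])
  note H = gibbs_law[where \<mu>="Vol M\<^sub>\<Omega>" and S="M\<^sub>\<Omega>" and V=g and Z="vol (\<lambda>_. 1)"]
  have sV: "sets (Vol M\<^sub>\<Omega>) = sets borel" by (simp add: Vol_M)
  have mV: "h \<in> borel_measurable (Vol M\<^sub>\<Omega>)" if "h \<in> borel_measurable borel" for h :: "real^2 \<Rightarrow> real"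
    using that measurable_cong_sets[OF sV refl] by blast
  have Hw: "prob_space (target_law g M\<^sub>\<Omega>)" "sets (target_law g M\<^sub>\<Omega>) = sets (Vol M\<^sub>\<Omega>)"
    "AE x in target_law g M\<^sub>\<Omega>. x \<in> M\<^sub>\<Omega>"
    "integrable (target_law g M\<^sub>\<Omega>) f \<and> integral\<^sup>L (target_law g M\<^sub>\<Omega>) f = vol f / vol (\<lambda>_. 1)"
    using H(1-3) H(4)[of f] mV[OF mass_measurable] mV[OF fm] vol1 integrable_mass[of "\<lambda>_. 1" 1] integrable_mass[OF fm B]
    unfolding target_law_def by (simp_all add: vol_def)
  obtain R where R: "\<And>x. x \<in> K \<Longrightarrow> norm x \<le> R" using compact_imp_bounded[OF compact_K] bounded_iff by blast
  have "AE x in penalized_law K g \<phi> A \<kappa>. norm x \<le> R" using Gw(3) by eventually_elim (rule R)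
  moreover have "AE x in target_law g M\<^sub>\<Omega>. norm x \<le> R" using Hw(3) by eventually_elim (use R M_subset_K in blast)
  ultimately show ?thesis
    using W2_ge_integral_diff[OF Gw(1) Hw(1) _ _ _ _ _ _ L] Gw(2,4) Hw(2,4) sV by simp
qed

text \<open>The Lipschitz constant on \<open>K\<close> of
  \<open>exp (- g x) * bump p \<rho> x\<close>, by the product rule with a bump that is 1-Lipschitz
  and at most \<open>\<rho>\<close>.\<close>

definition \<Lambda>1 :: "real \<Rightarrow> real" where "\<Lambda>1 \<rho> = \<rho> * \<Lambda> + E1"

lemma \<Lambda>1_nonneg: "0 \<le> \<rho> \<Longrightarrow> 0 \<le> \<Lambda>1 \<rho>" using \<Lambda>_nonneg E01 E(3) by (simp add: \<Lambda>1_def)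

lemma weighted_bump_lipschitz:
  assumes "x \<in> K" "y \<in> K" "0 \<le> \<rho>"
  shows "\<bar>exp (- g x) * bump p \<rho> x - exp (- g y) * bump p \<rho> y\<bar> \<le> \<Lambda>1 \<rho> * norm (x - y)"
proof -
  have "exp (- g x) * bump p \<rho> x - exp (- g y) * bump p \<rho> y
      = (exp (- g x) - exp (- g y)) * bump p \<rho> x + exp (- g y) * (bump p \<rho> x - bump p \<rho> y)" by algebra
  then have "\<bar>exp (- g x) * bump p \<rho> x - exp (- g y) * bump p \<rho> y\<bar>
      \<le> \<bar>exp (- g x) - exp (- g y)\<bar> * bump p \<rho> x + exp (- g y) * \<bar>bump p \<rho> x - bump p \<rho> y\<bar>"
    using abs_triangle_ineq[of "(exp (- g x) - exp (- g y)) * bump p \<rho> x" "exp (- g y) * (bump p \<rho> x - bump p \<rho> y)"]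
    by (simp add: abs_mult bump_nonneg)
  also have "\<dots> \<le> (\<Lambda> * norm (x - y)) * \<rho> + E1 * norm (x - y)"
    using lip[OF assms(1,2)] E(2)[OF assms(2)] E(3) E01 bump_le[OF assms(3)] bump_nonneg bump_lipschitz \<Lambda>_nonneg
    by (intro add_mono mult_mono) auto
  also have "\<dots> = \<Lambda>1 \<rho> * norm (x - y)" by (simp add: \<Lambda>1_def algebra_simps)
  finally show ?thesis .
qed

lemma vol_bump_graph:
  assumes \<rho>: "0 < \<rho>" "\<rho> \<le> 1/4" and c: "- 2 \<le> c" "c + \<rho> \<le> 5/2"
  shows "integrable lborel (\<lambda>x. exp (- g (pt x (qt x))) * bump (pt c (qt c)) \<rho> (pt x (qt x)) * sqrt (1 + (dqt x)^2) * indicator {c-\<rho>..c+\<rho>} x)"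
    "vol (bump (pt c (qt c)) \<rho>)
      = (LINT x|lborel. exp (- g (pt x (qt x))) * bump (pt c (qt c)) \<rho> (pt x (qt x)) * sqrt (1 + (dqt x)^2) * indicator {c-\<rho>..c+\<rho>} x)"
proof -
  let ?F = "\<lambda>p. indicator M\<^sub>\<Omega> p * exp (- g p) * bump (pt c (qt c)) \<rho> p"
  have m: "?F \<in> borel_measurable borel" by measurable
  \<comment> \<open>With \<open>\<rho> \<le> 1/4\<close> the support of the bump stays above height
    1 and meets the curve only in the upper arc.\<close>
  have qc: "3/2 \<le> qt c" using qt_flat(1)[of c] qt_corner(1)[of c] c \<rho> by (cases "c \<le> 2") auto
  have supp: "\<exists>x\<in>{c-\<rho>..c+\<rho>}. p = pt x (qt x)" if p: "p \<in> M\<^sub>\<Omega>" "?F p \<noteq> 0" for p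
  proof -
    have "dist p (pt c (qt c)) < \<rho>" using p bump_support by simp
    then have d: "\<bar>p$1 - c\<bar> < \<rho>" "\<bar>p$2 - qt c\<bar> < \<rho>"
      using dist_pt_ge(1)[of "p$1" c "p$2" "qt c"] dist_pt_ge(2)[of "p$2" "qt c" "p$1" c] by (auto simp: pt_components)
    have "\<bar>p$1\<bar> < 3" using d(1) c \<rho> by linarith
    moreover have "1 < p$2" using d(2) qc \<rho> by linarith
    moreover have "pt (p$1) (p$2) \<in> M\<^sub>\<Omega>" using p by (simp add: pt_components)
    ultimately have "p$2 = qt (p$1)" using pt_top_in_M_iff by blast
    then have "p = pt (p$1) (qt (p$1))" using pt_components[of p] by simp
    moreover have "p$1 \<in> {c-\<rho>..c+\<rho>}" using d(1) by auto
    ultimately show ?thesis by blast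
  qed
  have B: "\<bar>?F p\<bar> \<le> E1 * \<rho>" if "p \<in> M\<^sub>\<Omega>" for p using mass_bound[of p "bump (pt c (qt c)) \<rho>" \<rho>, OF that bump_abs_le] \<rho> by simp
  have ab: "- 5/2 \<le> c - \<rho>" "c - \<rho> \<le> c + \<rho>" "c + \<rho> \<le> 5/2" using c \<rho> by auto
  have e: "?F (pt x (qt x)) * sqrt (1 + (dqt x)^2) * indicator {c-\<rho>..c+\<rho>} x
     = exp (- g (pt x (qt x))) * bump (pt c (qt c)) \<rho> (pt x (qt x)) * sqrt (1 + (dqt x)^2) * indicator {c-\<rho>..c+\<rho>} x" for x
    using qt_in_M[of x] ab by (cases "x \<in> {c-\<rho>..c+\<rho>}") auto
  show "integrable lborel (\<lambda>x. exp (- g (pt x (qt x))) * bump (pt c (qt c)) \<rho> (pt x (qt x)) * sqrt (1 + (dqt x)^2) * indicator {c-\<rho>..c+\<rho>} x)"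
    using Vol_integral_graph(1)[OF m B ab supp] unfolding e .
  show "vol (bump (pt c (qt c)) \<rho>)
      = (LINT x|lborel. exp (- g (pt x (qt x))) * bump (pt c (qt c)) \<rho> (pt x (qt x)) * sqrt (1 + (dqt x)^2) * indicator {c-\<rho>..c+\<rho>} x)"
    using Vol_integral_graph(2)[OF m B ab supp] unfolding e vol_def .
qed


lemma pt_measurable_snd[measurable]: "(\<lambda>y. pt x y) \<in> borel_measurable borel"
  by (intro borel_measurable_continuous_onI continuous_intros)

lemma slice_integrable:
  assumes "0 \<le> \<kappa>" and f[measurable]: "f \<in> borel_measurable borel" and B: "\<And>x. \<bar>f x\<bar> \<le> B"
  shows "integrable lborel (\<lambda>y. wt A \<kappa> (pt x y) * f (pt x y))"
proof -
  obtain R where R: "\<And>x. x \<in> K \<Longrightarrow> norm x \<le> R" using compact_imp_bounded[OF compact_K] bounded_iff by blast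
  have i: "integrable lborel (\<lambda>y. indicator {-R..R} y * (E1 * B))"
    by (intro integrable_mult_left integrable_real_indicator) (auto simp: emeasure_lborel_Icc_eq)
  have B0: "0 \<le> B" using B[of 0] by linarith
  have "wt A \<kappa> (pt x y) * \<bar>f (pt x y)\<bar> \<le> indicator {-R..R} y * (E1 * B)" for y
  proof (cases "pt x y \<in> K")
    case True
    have "\<bar>y\<bar> \<le> R" using R[OF True] component_le_norm_cart[of "pt x y" 2] by simp
    then have "y \<in> {-R..R}" by auto
    moreover have "wt A \<kappa> (pt x y) * \<bar>f (pt x y)\<bar> \<le> E1 * B"
      using wt_le[OF assms(1), of A "pt x y"] True B wt_nonneg E01 E(3) by (intro mult_mono) auto
    ultimately show ?thesis by simp
  next
    case False
    then show ?thesis using B0 E01 E(3) by (simp add: wt_def)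
  qed
  then have ae: "AE y in lborel. norm (wt A \<kappa> (pt x y) * f (pt x y)) \<le> norm (indicator {-R..R} y * (E1 * B))"
    using wt_nonneg E01 E(3) B0 by (intro AE_I2) (simp add: abs_mult)
  show ?thesis by (rule Bochner_Integration.integrable_bound[OF i _ ae]) measurable
qed

subsection \<open>Mass over a straight edge\<close>

text \<open>Over each abscissa the distance to the hull is at least
  \<open>\<bar>y - 2\<bar>\<close>, so the density is dominated by a Gaussian of standard deviation
  \<open>s\<close>. Freezing the weight at its value on the edge costs
  \<open>\<Lambda>1 \<rho> * \<bar>y - 2\<bar>\<close>, whose Gaussian integral is of order
  \<open>s^2\<close>.\<close>

lemma flat_upper:
  assumes s: "0 < s" and \<rho>: "0 < \<rho>" "\<rho> \<le> 1/4" "\<rho> \<le> r" and t: "0 < t" "t \<le> 1/20"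
    and X: "finite X" "X \<noteq> {}" "X \<subseteq> M\<^sub>\<Omega>"
  shows "W (Conv t X) (1 / s^2) (bump (pt 0 2) \<rho>)
    \<le> sqrt (2 * pi) * s * vol (bump (pt 0 2) \<rho>) + sqrt (2 * pi) * (2 * \<rho> * \<Lambda>1 \<rho>) * s^2"
proof -
  let ?A = "Conv t X" and ?\<kappa> = "1 / s^2" and ?f = "bump (pt 0 2) \<rho>"
  let ?G = "\<lambda>x. exp (- g (pt x (qt x))) * ?f (pt x (qt x))"
  let ?L = "\<Lambda>1 \<rho>"
  have \<kappa>: "0 \<le> ?\<kappa>" by simp
  have L0: "0 \<le> ?L" using \<Lambda>1_nonneg \<rho> by simp
  have G0: "0 \<le> ?G x" for x by (simp add: bump_nonneg)
  have iw: "integrable lborel (\<lambda>x. wt ?A ?\<kappa> x * ?f x)"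
    by (rule integrable_wt[OF \<kappa> bump_measurable bump_abs_le]) (use \<rho> in simp)
  have pw: "wt ?A ?\<kappa> (pt x y) * ?f (pt x y) \<le> gpoly s (?G x) ?L 0 0 (y - 2)" if x: "\<bar>x\<bar> \<le> \<rho>" for x y
  proof (cases "?f (pt x y) = 0")
    case True then show ?thesis using G0[of x] L0 by (simp add: gpoly_def)
  next
    case False
    then have d: "dist (pt x y) (pt 0 2) < \<rho>" by (rule bump_support)
    then have y: "\<bar>y - 2\<bar> < \<rho>" using dist_pt_ge(2)[of y 2 x 0] by linarith
    have M2: "pt 0 2 \<in> M\<^sub>\<Omega>" "pt x 2 \<in> M\<^sub>\<Omega>" using flat_point_in_M x \<rho> by auto
    have xy: "pt x y \<in> K" using nbhd[OF M2(1)] d \<rho> r by simp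
    have x2: "pt x 2 \<in> K" using M2 M_subset_K by blast
    have qx: "qt x = 2" using qt_flat(1)[of x] x \<rho> by simp
    have "\<bar>y - 2\<bar> \<le> infdist (pt x y) ?A" using x y \<rho> by (intro infdist_Conv_flat[OF X t]) auto
    then have le: "(y - 2)^2 \<le> (infdist (pt x y) ?A)^2" by (metis abs_ge_zero power2_abs power_mono)
    \<comment> \<open>Only \<open>\<bar>y - 2\<bar>\<close> is known to be at most \<open>r\<close>,
      where \<open>\<phi>\<close> is the identity; monotonicity passes on to the possibly larger
      distance from the hull.\<close>
    have "\<bar>y - 2\<bar>^2 \<le> r^2" using y \<rho> by (intro power_mono) auto
    then have "(y - 2)^2 = \<phi> ((y - 2)^2)" by (simp add: \<phi>_id)
    also have "\<dots> \<le> \<phi> ((infdist (pt x y) ?A)^2)" using le by (intro mono_onD[OF mono_\<phi>]) auto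
    finally have "?\<kappa> / 2 * (y - 2)^2 \<le> ?\<kappa> / 2 * \<phi> ((infdist (pt x y) ?A)^2)" by (intro mult_left_mono) auto
    then have "wt ?A ?\<kappa> (pt x y) \<le> exp (- g (pt x y)) * exp (- ((y - 2)^2) / (2 * s^2))"
      using xy by (simp add: wt_def flip: exp_add)
    then have "wt ?A ?\<kappa> (pt x y) * ?f (pt x y) \<le> exp (- g (pt x y)) * exp (- ((y - 2)^2) / (2 * s^2)) * ?f (pt x y)"
      by (intro mult_right_mono bump_nonneg)
    also have "\<dots> = exp (- ((y - 2)^2) / (2 * s^2)) * (exp (- g (pt x y)) * ?f (pt x y))" by simp
    also have "\<dots> \<le> exp (- ((y - 2)^2) / (2 * s^2)) * (?G x + ?L * \<bar>y - 2\<bar>)"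
    proof (rule mult_left_mono)
      have "\<bar>exp (- g (pt x y)) * ?f (pt x y) - exp (- g (pt x 2)) * ?f (pt x 2)\<bar> \<le> ?L * norm (pt x y - pt x 2)"
        using \<rho> by (intro weighted_bump_lipschitz xy x2) auto
      then show "exp (- g (pt x y)) * ?f (pt x y) \<le> ?G x + ?L * \<bar>y - 2\<bar>"
        using dist_pt_vertical[of x y 2] unfolding qx dist_norm by simp
    qed simp
    finally show ?thesis by (simp add: gpoly_def)
  qed
  define S where "S x = (LINT y|lborel. wt ?A ?\<kappa> (pt x y) * ?f (pt x y))" for x
  have S: "S x \<le> indicator {-\<rho>..\<rho>} x * (sqrt (2 * pi) * s * (?G x + ?L * s))" for x
  proof (cases "\<bar>x\<bar> \<le> \<rho>")
    case True
    note gu = gaussian_upper[OF s L0, of "?G x"]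
    have "S x \<le> (LINT y|lborel. gpoly s (?G x) ?L 0 0 (y - 2))"
      unfolding S_def
    proof (rule integral_mono')
      show "integrable lborel (\<lambda>y. gpoly s (?G x) ?L 0 0 (y - 2))"
        using lborel_integrable_real_affine[OF gu(1), of 1 "-2"] by simp
      show "0 \<le> gpoly s (?G x) ?L 0 0 (y - 2)" for y using G0[of x] L0 by (simp add: gpoly_def)
    qed (use pw[OF True] in auto)
    also have "\<dots> = (LINT y|lborel. gpoly s (?G x) ?L 0 0 y)"
      using lborel_integral_real_affine[of 1 "gpoly s (?G x) ?L 0 0" "-2"] by simp
    also have "\<dots> \<le> sqrt (2 * pi) * s * (?G x + ?L * s)" by (rule gu(2))
    finally have "S x \<le> sqrt (2 * pi) * s * (?G x + ?L * s)" .
    moreover have "x \<in> {-\<rho>..\<rho>}" using True by auto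
    ultimately show ?thesis by simp
  next
    case False
    have "?f (pt x y) = 0" for y
      using bump_support[of "pt 0 2" \<rho> "pt x y"] dist_pt_ge(1)[of x 0 y 2] False by fastforce
    moreover have "x \<notin> {-\<rho>..\<rho>}" using False by auto
    ultimately show ?thesis by (simp add: S_def)
  qed
  have c: "- 2 \<le> (0::real)" "0 + \<rho> \<le> 5/2" using \<rho> by auto
  have q0: "qt 0 = 2" using qt_flat(1)[of 0] by simp
  have e: "?G x * sqrt (1 + (dqt x)^2) * indicator {-\<rho>..\<rho>} x = ?G x * indicator {-\<rho>..\<rho>} x" for x
  proof (cases "x \<in> {-\<rho>..\<rho>}")
    case True
    then have "\<bar>x\<bar> \<le> 2" using \<rho> unfolding abs_le_iff by auto
    then show ?thesis by (simp add: qt_flat(2))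
  qed simp
  have vg: "integrable lborel (\<lambda>x. ?G x * indicator {-\<rho>..\<rho>} x)" "vol ?f = (LINT x|lborel. ?G x * indicator {-\<rho>..\<rho>} x)"
    using vol_bump_graph[OF \<rho>(1,2) c] unfolding q0 by (simp_all add: e)
  have ind: "integrable lborel (\<lambda>x. indicator {-\<rho>..\<rho>} x * (?L * s))" "(LINT x|lborel. indicator {-\<rho>..\<rho>} x * (?L * s)) = 2 * \<rho> * (?L * s)"
    using \<rho> by simp_all
  have eq: "indicator {-\<rho>..\<rho>} x * (sqrt (2 * pi) * s * (?G x + ?L * s))
     = sqrt (2 * pi) * s * (?G x * indicator {-\<rho>..\<rho>} x + indicator {-\<rho>..\<rho>} x * (?L * s))" for x :: real
    by (simp add: algebra_simps)
  have "W ?A ?\<kappa> ?f = integral\<^sup>L lborel S" unfolding W_def S_def by (rule integral_real2(2)[OF iw])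
  also have "\<dots> \<le> (LINT x|lborel. indicator {-\<rho>..\<rho>} x * (sqrt (2 * pi) * s * (?G x + ?L * s)))"
  proof (rule integral_mono'[OF _ S])
    show "integrable lborel (\<lambda>x. indicator {-\<rho>..\<rho>} x * (sqrt (2 * pi) * s * (?G x + ?L * s)))"
      unfolding eq using vg(1) ind(1) by (intro integrable_mult_right Bochner_Integration.integrable_add)
    show "0 \<le> indicator {-\<rho>..\<rho>} x * (sqrt (2 * pi) * s * (?G x + ?L * s))" for x using G0[of x] L0 s by simp
  qed
  also have "\<dots> = sqrt (2 * pi) * s * (vol ?f + 2 * \<rho> * (?L * s))"
    unfolding eq using vg ind by simp
  also have "\<dots> = sqrt (2 * pi) * s * vol ?f + sqrt (2 * pi) * (2 * \<rho> * ?L) * s^2" by (simp add: algebra_simps power2_eq_square)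
  finally show ?thesis .
qed

lemma W_mono:
  assumes "0 \<le> \<kappa>" "f \<in> borel_measurable borel" "h \<in> borel_measurable borel" "\<And>x. \<bar>f x\<bar> \<le> B" "\<And>x. \<bar>h x\<bar> \<le> B'" "\<And>x. f x \<le> h x"
  shows "W A \<kappa> f \<le> W A \<kappa> h"
  unfolding W_def
  by (rule integral_mono[OF integrable_wt[OF assms(1,2,4)] integrable_wt[OF assms(1,3,5)]]) (use assms(6) wt_nonneg in \<open>auto intro: mult_left_mono\<close>)

lemma W_lincomb:
  assumes "0 \<le> \<kappa>" "f \<in> borel_measurable borel" "h \<in> borel_measurable borel" "\<And>x. \<bar>f x\<bar> \<le> B" "\<And>x. \<bar>h x\<bar> \<le> B'"
  shows "W A \<kappa> (\<lambda>x. a * f x + b * h x) = a * W A \<kappa> f + b * W A \<kappa> h"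
proof -
  have "W A \<kappa> (\<lambda>x. a * f x + b * h x) = (LINT x|lborel. a * (wt A \<kappa> x * f x) + b * (wt A \<kappa> x * h x))"
    unfolding W_def by (simp add: algebra_simps)
  then show ?thesis unfolding W_def using integrable_wt[OF assms(1,2,4)] integrable_wt[OF assms(1,3,5)] by simp
qed

lemma W_cbox_le:
  assumes "0 \<le> \<kappa>" shows "W A \<kappa> (indicator (cbox l u)) \<le> E1 * measure lborel (cbox l u)"
proof -
  have "W A \<kappa> (indicator (cbox l u)) \<le> (LINT x|lborel. E1 * indicator (cbox l u) x)"
    unfolding W_def
  proof (rule integral_mono')
    show "integrable lborel (\<lambda>x. E1 * indicator (cbox l u) x :: real)" by (intro integrable_mult_right integrable_real_indicator) (use emeasure_lborel_cbox_finite[of l u] in auto)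
    show "wt A \<kappa> x * indicator (cbox l u) x \<le> E1 * indicator (cbox l u) x" for x
    proof -
      have "wt A \<kappa> x \<le> E1" using wt_le[OF assms, of A x] E01 E(3) by (cases "x \<in> K") auto
      then show ?thesis by (simp add: indicator_def)
    qed
  qed (use E01 E(3) in auto)
  also have "\<dots> = E1 * measure lborel (cbox l u)" by simp
  finally show ?thesis .
qed

lemma W_cbox_ge:
  assumes "0 \<le> \<kappa>" and e: "\<And>x. x \<in> cbox l u \<Longrightarrow> e \<le> wt A \<kappa> x" shows "e * measure lborel (cbox l u) \<le> W A \<kappa> (indicator (cbox l u))"
proof -
  have "e * measure lborel (cbox l u) = (LINT x|lborel. e * indicator (cbox l u) x)" by simp
  also have "\<dots> \<le> W A \<kappa> (indicator (cbox l u))"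
    unfolding W_def
  proof (rule integral_mono)
    show "integrable lborel (\<lambda>x. e * indicator (cbox l u) x :: real)" by (intro integrable_mult_right integrable_real_indicator) (use emeasure_lborel_cbox_finite[of l u] in auto)
    show "integrable lborel (\<lambda>x. wt A \<kappa> x * indicator (cbox l u) x)" by (rule integrable_wt[OF assms(1), of _ 1]) (auto simp: indicator_def)
    show "e * indicator (cbox l u) x \<le> wt A \<kappa> x * indicator (cbox l u) x" for x
      using e[of x] by (auto simp: indicator_def)
  qed
  finally show ?thesis .
qed

lemma measure_cbox2: "a \<le> b \<Longrightarrow> c \<le> d \<Longrightarrow> measure lborel (cbox (pt a c) (pt b d)) = (b - a) * (d - c)"
proof -
  assume h: "a \<le> b" "c \<le> d"
  have ne: "axis 1 1 \<noteq> (axis 2 1 :: real^2)" by (simp add: vec_eq_iff forall_2 axis_def)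
  have "measure lborel (cbox (pt a c) (pt b d)) = (\<Prod>e\<in>Basis. (pt b d - pt a c) \<bullet> e)"
    using h by (intro measure_lborel_cbox) (auto simp: Basis_real2 inner_axis)
  then show ?thesis using ne by (simp add: Basis_real2 inner_axis)
qed

lemma mem_cbox2: "p \<in> cbox (pt a c) (pt b d) \<longleftrightarrow> a \<le> p$1 \<and> p$1 \<le> b \<and> c \<le> p$2 \<and> p$2 \<le> d"
  by (auto simp: mem_box_cart forall_2)

text \<open>Anti-concentration: since \<open>\<delta> \<le> s\<close>, a box of half-height
  \<open>\<delta>\<close> around the edge is hardly penalized and has mass of order
  \<open>\<delta>\<close>. A strip thinner by a fixed factor holds at most half of the bump mass, so
  the rest lies at height of order \<open>\<delta>\<close>.\<close>

lemma flat_spread: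
  assumes s: "0 < s" and \<rho>: "0 < \<rho>" "\<rho> \<le> 1/4" "\<rho> \<le> r" and t: "0 < t" "t \<le> 1/20000"
    and X: "finite X" "X \<subseteq> M\<^sub>\<Omega>" and S: "\<And>y. y \<in> M\<^sub>\<Omega> \<Longrightarrow> \<exists>x\<in>X. dist y x \<le> \<eta> * t" and \<eta>: "\<eta> < 1/3"
    and \<delta>: "0 < \<delta>" "\<delta> \<le> s" "\<delta> \<le> \<rho> / 4" "1728 * t^2 \<le> \<delta>"
  shows "E0 * exp (- 2) / (16 * E1) * \<delta> / 2 * W (Conv t X) (1 / s^2) (bump (pt 0 2) \<rho>)
     \<le> W (Conv t X) (1 / s^2) (\<lambda>x. bump (pt 0 2) \<rho> x * \<bar>x$2 - 2\<bar>)"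
proof -
  let ?A = "Conv t X" and ?\<kappa> = "1 / s^2" and ?f = "bump (pt 0 2) \<rho>"
  let ?\<psi> = "\<lambda>x. bump (pt 0 2) \<rho> x * \<bar>x$2 - 2\<bar>"
  have \<kappa>: "0 \<le> ?\<kappa>" by simp
  have E1: "0 < E1" using E01 E(3) by linarith
  have \<rho>0: "0 \<le> \<rho>" using \<rho> by simp
  define \<mu> where "\<mu> = E0 * exp (- 2) / (16 * E1)"
  have \<mu>: "0 < \<mu>" using E(3) E1 by (simp add: \<mu>_def)
  let ?Q = "cbox (pt (- \<rho>/4) (2 - \<delta>)) (pt (\<rho>/4) (2 + \<delta>))"
  have wQ: "E0 * exp (- 2) \<le> wt ?A ?\<kappa> p" and fQ: "\<rho> / 2 \<le> ?f p" if p: "p \<in> ?Q" for p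
  proof -
    have p': "\<bar>p$1\<bar> \<le> \<rho>/4" "\<bar>p$2 - 2\<bar> \<le> \<delta>" using p by (auto simp: mem_cbox2 abs_le_iff)
    have d: "dist p (pt 0 2) \<le> \<rho> / 2" using dist_pt_le[of "p$1" "p$2" 0 2] p' \<delta> by (simp add: pt_components)
    then show "\<rho> / 2 \<le> ?f p" by (simp add: bump_def max_def)
    have pK: "p \<in> K" using nbhd[OF flat_point_in_M[of 0]] d \<rho> r by simp
    have m: "pt (p$1) 2 \<in> M\<^sub>\<Omega>" using p' \<rho> by (intro flat_point_in_M) linarith
    obtain a where a: "a \<in> ?A" "dist (pt (p$1) 2) a \<le> 1728 * t^2" using M_near_Conv[OF X S \<eta> t m] by blast
    have "dist p (pt (p$1) 2) = \<bar>p$2 - 2\<bar>" using dist_pt_vertical[of "p$1" "p$2" 2] by (simp add: pt_components)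
    then have "dist p a \<le> 2 * \<delta>" using dist_triangle[of p a "pt (p$1) 2"] a p' \<delta> by linarith
    \<comment> \<open>One \<open>\<delta>\<close> is the height of \<open>p\<close>, the other
      covers the distance \<open>1728 * t^2\<close> from the edge to the hull. As
      \<open>\<delta> \<le> s\<close>, the exponent is at most 2, whence
      \<open>exp (- 2)\<close>.\<close>
    then have i: "infdist p ?A \<le> 2 * \<delta>" using infdist_le2[OF a(1)] by blast
    then have i2: "(infdist p ?A)^2 \<le> (2 * \<delta>)^2" by (intro power_mono infdist_nonneg)
    moreover have "(2 * \<delta>)^2 \<le> r^2" using \<delta> \<rho> by (intro power_mono) auto
    ultimately have "\<phi> ((infdist p ?A)^2) = (infdist p ?A)^2" by (intro \<phi>_id) auto
    moreover have "(2 * \<delta>)^2 \<le> (2 * s)^2" using \<delta> by (intro power_mono) auto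
    ultimately have "\<phi> ((infdist p ?A)^2) \<le> 4 * s^2" using i2 by (simp add: power_mult_distrib)
    then have "?\<kappa> / 2 * \<phi> ((infdist p ?A)^2) \<le> ?\<kappa> / 2 * (4 * s^2)" by (intro mult_left_mono) auto
    also have "\<dots> = 2" using s by simp
    finally have "exp (- 2) \<le> exp (- (?\<kappa> / 2 * \<phi> ((infdist p ?A)^2)))" by simp
    then have "E0 * exp (- 2) \<le> exp (- g p) * exp (- (?\<kappa> / 2 * \<phi> ((infdist p ?A)^2)))"
      using E(1)[OF pK] E(3) by (intro mult_mono) auto
    then show "E0 * exp (- 2) \<le> wt ?A ?\<kappa> p" using pK by (simp add: wt_def flip: exp_add)
  qed
  have mQ: "measure lborel ?Q = \<rho> * \<delta>"
  proof -
    have "measure lborel ?Q = (\<rho>/4 - (- \<rho>/4)) * ((2 + \<delta>) - (2 - \<delta>))" using \<rho> \<delta> by (intro measure_cbox2) auto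
    then show ?thesis by simp
  qed
  have "E0 * exp (- 2) * (\<rho> * \<delta>) \<le> W ?A ?\<kappa> (indicator ?Q)" 
    using W_cbox_ge[OF \<kappa>, of "pt (- \<rho>/4) (2 - \<delta>)" "pt (\<rho>/4) (2 + \<delta>)" "E0 * exp (- 2)" ?A, OF wQ] unfolding mQ .
  then have "\<rho> / 2 * (E0 * exp (- 2) * (\<rho> * \<delta>)) \<le> \<rho> / 2 * W ?A ?\<kappa> (indicator ?Q)" using \<rho> by (intro mult_left_mono) auto
  also have "\<dots> = W ?A ?\<kappa> (\<lambda>x. \<rho> / 2 * indicator ?Q x)" by (rule W_cmult[symmetric])
  also have "\<dots> \<le> W ?A ?\<kappa> ?f"
  proof (rule W_mono[OF \<kappa>, of _ _ "\<rho> / 2" \<rho>])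
    show "\<rho> / 2 * indicator ?Q x \<le> ?f x" for x using fQ[of x] bump_nonneg by (auto simp: indicator_def)
    show "\<bar>\<rho> / 2 * indicator ?Q x\<bar> \<le> \<rho> / 2" for x using \<rho> by (auto simp: indicator_def)
  qed (use bump_abs_le \<rho> in auto)
  finally have low: "E0 * exp (- 2) * \<rho>^2 * \<delta> / 2 \<le> W ?A ?\<kappa> ?f" by (simp add: power2_eq_square algebra_simps)
  \<comment> \<open>The factor 16 in \<open>\<mu>\<close> makes the strip bound
    \<open>E1 * 4 * \<rho>^2 * \<delta>'\<close> half of the lower bound \<open>low\<close>.\<close>
  define \<delta>' where "\<delta>' = \<mu> * \<delta>"
  have \<delta>': "0 < \<delta>'" using \<mu> \<delta> by (simp add: \<delta>'_def)
  let ?Q' = "cbox (pt (- \<rho>) (2 - \<delta>')) (pt \<rho> (2 + \<delta>'))"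
  have f1: "\<bar>?f x\<bar> \<le> \<rho>" for x using bump_abs_le \<rho>0 .
  have \<psi>b: "\<bar>?\<psi> x\<bar> \<le> \<rho> * \<rho>" for x
  proof (cases "?f x = 0")
    case False
    then have "\<bar>x$2 - 2\<bar> \<le> \<rho>" using bump_support[of "pt 0 2" \<rho> x] dist_pt_ge(2)[of "x$2" 2 "x$1" 0] by (simp add: pt_components)
    then have "\<bar>?f x\<bar> * \<bar>x$2 - 2\<bar> \<le> \<rho> * \<rho>" using f1 \<rho>0 by (intro mult_mono) auto
    then show ?thesis by (simp add: abs_mult)
  qed (use \<rho> in auto)
  \<comment> \<open>Markov's inequality: off the strip the height divided by
    \<open>\<delta>'\<close> is at least 1.\<close>
  have "W ?A ?\<kappa> ?f \<le> W ?A ?\<kappa> (\<lambda>x. \<rho> * indicator ?Q' x + (1 / \<delta>') * ?\<psi> x)"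
  proof (rule W_mono[OF \<kappa>, of _ _ \<rho> "\<rho> + (1 / \<delta>') * (\<rho> * \<rho>)"])
    show "?f x \<le> \<rho> * indicator ?Q' x + (1 / \<delta>') * ?\<psi> x" for x
    proof (cases "?f x = 0 \<or> x \<in> ?Q'")
      case True
      moreover have "0 \<le> (1 / \<delta>') * ?\<psi> x" using \<delta>' bump_nonneg by simp
      ultimately show ?thesis using bump_le[OF \<rho>0, of "pt 0 2" x] \<rho> by (auto simp: indicator_def)
    next
      case False
      then have "\<bar>x$1\<bar> \<le> \<rho>" using bump_support[of "pt 0 2" \<rho> x] dist_pt_ge(1)[of "x$1" 0 "x$2" 2] by (simp add: pt_components)
      then have "\<delta>' \<le> \<bar>x$2 - 2\<bar>" using False by (auto simp: mem_cbox2 abs_le_iff)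
      then have "?f x * \<delta>' \<le> ?f x * \<bar>x$2 - 2\<bar>" by (intro mult_left_mono bump_nonneg)
      then show ?thesis using False \<delta>' by (simp add: field_simps)
    qed
    show "\<bar>\<rho> * indicator ?Q' x + (1 / \<delta>') * ?\<psi> x\<bar> \<le> \<rho> + (1 / \<delta>') * (\<rho> * \<rho>)" for x
    proof -
      have "\<bar>(1 / \<delta>') * ?\<psi> x\<bar> \<le> (1 / \<delta>') * (\<rho> * \<rho>)" using \<psi>b[of x] \<delta>' unfolding abs_mult[of "1 / \<delta>'"] by (intro mult_mono) auto
      moreover have "\<bar>\<rho> * indicator ?Q' x\<bar> \<le> \<rho>" using \<rho> by (auto simp: indicator_def)
      ultimately show ?thesis by linarith
    qed
  qed (use f1 in \<open>auto intro!: measurable\<close>)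
  also have "\<dots> = \<rho> * W ?A ?\<kappa> (indicator ?Q') + (1 / \<delta>') * W ?A ?\<kappa> ?\<psi>"
  proof (rule W_lincomb[OF \<kappa>])
    show "\<bar>indicator ?Q' x :: real\<bar> \<le> 1" for x by (simp add: indicator_def)
  qed (use \<psi>b in auto)
  also have "\<rho> * W ?A ?\<kappa> (indicator ?Q') \<le> \<rho> * (E1 * (4 * \<rho> * \<delta>'))"
  proof (rule mult_left_mono)
    have "measure lborel ?Q' = (\<rho> - - \<rho>) * ((2 + \<delta>') - (2 - \<delta>'))" using \<rho> \<delta>' by (intro measure_cbox2) auto
    then have "measure lborel ?Q' = 4 * \<rho> * \<delta>'" by simp
    then show "W ?A ?\<kappa> (indicator ?Q') \<le> E1 * (4 * \<rho> * \<delta>')" using W_cbox_le[OF \<kappa>, of ?A] by metis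
  qed (use \<rho> in auto)
  also have "\<rho> * (E1 * (4 * \<rho> * \<delta>')) = E0 * exp (- 2) * \<rho>^2 * \<delta> / 4"
    using E1 by (simp add: \<delta>'_def \<mu>_def power2_eq_square)
  finally have "W ?A ?\<kappa> ?f \<le> W ?A ?\<kappa> ?f / 2 + (1 / \<delta>') * W ?A ?\<kappa> ?\<psi>" using low by linarith
  then have "W ?A ?\<kappa> ?f / 2 \<le> (1 / \<delta>') * W ?A ?\<kappa> ?\<psi>" by linarith
  then have "\<delta>' * (W ?A ?\<kappa> ?f / 2) \<le> \<delta>' * ((1 / \<delta>') * W ?A ?\<kappa> ?\<psi>)" using \<delta>' by (intro mult_left_mono) auto
  also have "\<dots> = W ?A ?\<kappa> ?\<psi>" using \<delta>' by simp
  also have "\<delta>' * (W ?A ?\<kappa> ?f / 2) = E0 * exp (- 2) / (16 * E1) * \<delta> / 2 * W ?A ?\<kappa> ?f"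
    by (simp add: \<delta>'_def \<mu>_def)
  finally show ?thesis .
qed

end

subsection \<open>Mass over a curved corner\<close>

text \<open>Cuts a profile at 0 and pulls the halves apart to the two ends of a slice. The halves
  keep the full integral, so the mass in between is a pure gain.\<close>

lemma split_gaussian_integral:
  fixes F :: "real \<Rightarrow> real"
  assumes F: "integrable lborel F"
  shows "integrable lborel (\<lambda>y. indicator {b..} y * F (y - b))" "integrable lborel (\<lambda>y. indicator {..<a} y * F (y - a))"
    "(LINT y|lborel. indicator {b..} y * F (y - b)) + (LINT y|lborel. indicator {..<a} y * F (y - a)) = integral\<^sup>L lborel F"
proof -
  have 1: "integrable lborel (\<lambda>v. indicator {0..} v * F v)" "integrable lborel (\<lambda>v. indicator {..<0} v * F v)"
    using integrable_mult_indicator[OF _ F] by auto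
  have e: "(\<lambda>y. indicator {b..} y * F (y - b)) = (\<lambda>y. indicator {0..} (- b + 1 * y) * F (- b + 1 * y))"
    "(\<lambda>y. indicator {..<a} y * F (y - a)) = (\<lambda>y. indicator {..<0} (- a + 1 * y) * F (- a + 1 * y))"
    by (auto simp: indicator_def)
  show "integrable lborel (\<lambda>y. indicator {b..} y * F (y - b))" "integrable lborel (\<lambda>y. indicator {..<a} y * F (y - a))"
    unfolding e by (intro lborel_integrable_real_affine 1; simp)+
  have "(LINT y|lborel. indicator {b..} y * F (y - b)) = (LINT v|lborel. indicator {0..} v * F v)"
    "(LINT y|lborel. indicator {..<a} y * F (y - a)) = (LINT v|lborel. indicator {..<0} v * F v)"
    unfolding e
    using lborel_integral_real_affine[of 1 "\<lambda>v. indicator {0..} v * F v" "- b"]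
      lborel_integral_real_affine[of 1 "\<lambda>v. indicator {..<0} v * F v" "- a"] by simp_all
  then have "(LINT y|lborel. indicator {b..} y * F (y - b)) + (LINT y|lborel. indicator {..<a} y * F (y - a))
      = (LINT v|lborel. indicator {0..} v * F v + indicator {..<0} v * F v)" using 1 by simp
  also have "\<dots> = integral\<^sup>L lborel F" by (intro Bochner_Integration.integral_cong) (auto simp: indicator_def)
  finally show "(LINT y|lborel. indicator {b..} y * F (y - b)) + (LINT y|lborel. indicator {..<a} y * F (y - a)) = integral\<^sup>L lborel F" .
qed

lemma exp_times_ge:
  fixes b g' g0 G :: real
  assumes "0 \<le> b" "0 \<le> g'" "g0 \<le> g'" "g0 \<le> G" "0 \<le> G"
  shows "g0 - b * G \<le> exp (- b) * g'"
proof (cases "g0 \<le> 0")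
  case True
  have "0 \<le> b * G" "0 \<le> exp (- b) * g'" using assms by auto
  then show ?thesis using True by linarith
next
  case False
  have "g0 - b * G \<le> g0 - b * g0" using assms by (intro diff_left_mono mult_left_mono) auto
  also have "\<dots> = (1 - b) * g0" by (simp add: algebra_simps)
  also have "\<dots> \<le> exp (- b) * g0" using False exp_ge_add_one_self[of "- b"] by (intro mult_right_mono) auto
  also have "\<dots> \<le> exp (- b) * g'" using assms by (intro mult_left_mono) auto
  finally show ?thesis .
qed

lemma gpoly_coeffs_expand:
  fixes v :: real
  assumes "0 \<le> v"
  shows "(G - l) + - (L + e) * \<bar>v\<bar> + - b1 * v^2 + - b2 * \<bar>v\<bar>^3 = G - l - L * v - e * v - b1 * v^2 - b2 * v^3"
  using assms by (simp add: algebra_simps)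

context tube
begin

text \<open>Collects the error constants of \<open>corner_slice\<close>; it does not depend on
  \<open>s\<close>, \<open>t\<close> or the sample.\<close>

definition corner_const :: "real \<Rightarrow> real \<Rightarrow> real \<Rightarrow> real \<Rightarrow> real" where
  "corner_const C c h \<rho> = 2 * sqrt (2 * pi) * (\<Lambda>1 \<rho> * C + 4 * (3/2 * C * (E1 * \<rho>)) + 2 * (\<Lambda>1 \<rho> + E1 * \<rho> / h) + 16 * (3/2 * C * (E1 * \<rho>))) + c * \<Lambda>1 \<rho> * C"

text \<open>A point at vertical offset \<open>v\<close> from the slice is at distance about \<open>v / q\<close> from \<open>A\<close>, where \<open>1 / q\<close> is the
  cosine of the slope angle; this produces a Gaussian of standard deviation \<open>s q\<close>.\<close>

lemma corner_weight:
  assumes s: "0 < s" and t: "0 < t" and \<rho>: "0 < \<rho>" and q: "1 \<le> q" and C: "0 < C" and h: "0 < h" "2 * h \<le> r" "C * (t + h) \<le> 1" "C * t^2 \<le> r"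
    and M: "pt x y0 \<in> M\<^sub>\<Omega>" and v: "0 \<le> v" and y: "\<bar>y - y0\<bar> \<le> v + C * t^2"
    and d: "v \<le> h \<Longrightarrow> infdist (pt x y) A \<le> v * (1 / q + C * (t + v))"
    and G: "G = exp (- g (pt x y0)) * bump p \<rho> (pt x y0)" and B: "B = 3/2 * C * (E1 * \<rho>)"
  shows "gpoly (s * q) (G - \<Lambda>1 \<rho> * C * t^2) (- (\<Lambda>1 \<rho> + E1 * \<rho> / h)) (- (B * t / s^2)) (- (B / s^2)) v
    \<le> wt A (1 / s^2) (pt x y) * bump p \<rho> (pt x y)"
proof -
  let ?L = "\<Lambda>1 \<rho>" and ?\<kappa> = "1 / s^2"
  have \<rho>0: "0 \<le> \<rho>" using \<rho> by simp
  have L0: "0 \<le> ?L" using \<Lambda>1_nonneg \<rho>0 .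
  have E1: "0 < E1" using E01 E(3) by linarith
  have x0: "pt x y0 \<in> K" using M M_subset_K by blast
  have G0: "0 \<le> G" "G \<le> E1 * \<rho>"
    unfolding G using E(2)[OF x0] bump_le[OF \<rho>0] bump_nonneg E1 by (auto intro: mult_mono)
  have B0: "0 \<le> B" using C E1 \<rho> by (simp add: B)
  have nn: "0 \<le> wt A ?\<kappa> (pt x y) * bump p \<rho> (pt x y)" by (intro mult_nonneg_nonneg wt_nonneg bump_nonneg)
  show ?thesis
  proof (cases "v \<le> h")
    \<comment> \<open>Beyond \<open>h\<close> there is no distance estimate. The extra linear
      coefficient \<open>E1 * \<rho> / h\<close> makes the polynomial nonpositive there, so the
      bound is trivial.\<close>
    case False
    have "G \<le> E1 * \<rho> / h * v"
    proof -
      have "E1 * \<rho> * 1 \<le> E1 * \<rho> * (v / h)" using False h E1 \<rho> by (intro mult_left_mono) auto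
      then show ?thesis using G0 by simp
    qed
    moreover have "0 \<le> ?L * C * t^2" "0 \<le> ?L * v" "0 \<le> B * t / s^2 * v^2" "0 \<le> B / s^2 * v^3"
      using L0 C B0 t v by auto
    ultimately have "(G - ?L * C * t^2) + - (?L + E1 * \<rho> / h) * \<bar>v\<bar> + - (B * t / s^2) * v^2 + - (B / s^2) * \<bar>v\<bar>^3 \<le> 0"
      unfolding gpoly_coeffs_expand[OF v] by linarith
    then have "gpoly (s * q) (G - ?L * C * t^2) (- (?L + E1 * \<rho> / h)) (- (B * t / s^2)) (- (B / s^2)) v \<le> 0"
      unfolding gpoly_def by (intro mult_nonneg_nonpos) auto
    then show ?thesis using nn by linarith
  next
    case True
    define u where "u = C * (t + v)"
    have u: "0 \<le> u" "u \<le> 1"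
    proof -
      show "0 \<le> u" using C t v by (simp add: u_def)
      have "u \<le> C * (t + h)" using C True by (simp add: u_def)
      then show "u \<le> 1" using h by linarith
    qed
    have q1: "0 < 1 / q" "1 / q \<le> 1" using q by auto
    have i: "infdist (pt x y) A \<le> v * (1 / q + u)" using d[OF True] by (simp add: u_def)
    have "dist (pt x y) (pt x y0) \<le> 3 * r" using y h r True by (simp add: dist_pt_vertical)
    then have xy: "pt x y \<in> K" by (rule nbhd[OF M])
    have "0 \<le> 1 / q + u" "1 / q + u \<le> 2" using q1 u by linarith+
    then have "v * (1 / q + u) \<le> h * 2" using True v h by (intro mult_mono) auto
    then have "infdist (pt x y) A \<le> r" using i h by linarith
    then have "(infdist (pt x y) A)^2 \<le> r^2" by (intro power_mono infdist_nonneg)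
    then have "\<phi> ((infdist (pt x y) A)^2) = (infdist (pt x y) A)^2" by (intro \<phi>_id) auto
    also have "\<dots> \<le> (v * (1 / q + u))^2" using i by (intro power_mono infdist_nonneg)
    also have "\<dots> = v^2 * ((1 / q)^2 + (2 * (1 / q) * u + u * u))" by algebra
    also have "\<dots> \<le> v^2 * ((1 / q)^2 + 3 * u)"
    proof (intro mult_left_mono add_left_mono)
      have "1 / q * u \<le> 1 * u" "u * u \<le> 1 * u"
        by (rule mult_right_mono[OF q1(2) u(1)], rule mult_right_mono[OF u(2,1)])
      then show "2 * (1 / q) * u + u * u \<le> 3 * u" by linarith
    qed simp
    finally have \<phi>: "\<phi> ((infdist (pt x y) A)^2) \<le> v^2 * ((1 / q)^2 + 3 * u)" .
    \<comment> \<open>The part of the exponent bound beyond the Gaussian one. After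
      \<open>exp (- b) \<ge> 1 - b\<close> it becomes the quadratic and the cubic
      coefficient.\<close>
    define b where "b = 3/2 * C * (v^2 * (t + v)) / s^2"
    have b0: "0 \<le> b" using C t v by (simp add: b_def)
    have "?\<kappa> / 2 * \<phi> ((infdist (pt x y) A)^2) \<le> ?\<kappa> / 2 * (v^2 * ((1 / q)^2 + 3 * u))" using \<phi> by (intro mult_left_mono) auto
    also have "\<dots> = v^2 / (2 * (s * q)^2) + b"
      unfolding b_def u_def using s q by (simp add: power_mult_distrib power_divide field_simps)
    finally have "exp (- (v^2 / (2 * (s * q)^2) + b)) \<le> exp (- (?\<kappa> / 2 * \<phi> ((infdist (pt x y) A)^2)))" by simp
    moreover have "wt A ?\<kappa> (pt x y) = exp (- g (pt x y)) * exp (- (?\<kappa> / 2 * \<phi> ((infdist (pt x y) A)^2)))"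
      using xy by (simp add: wt_def flip: exp_add)
    ultimately have "exp (- g (pt x y)) * exp (- (v^2 / (2 * (s * q)^2) + b)) \<le> wt A ?\<kappa> (pt x y)"
      by (simp only: mult_left_mono exp_ge_zero)
    then have 1: "exp (- g (pt x y)) * exp (- (v^2 / (2 * (s * q)^2) + b)) * bump p \<rho> (pt x y)
        \<le> wt A ?\<kappa> (pt x y) * bump p \<rho> (pt x y)" by (intro mult_right_mono bump_nonneg)
    let ?g' = "exp (- g (pt x y)) * bump p \<rho> (pt x y)"
    have "\<bar>?g' - G\<bar> \<le> ?L * norm (pt x y - pt x y0)"
      unfolding G by (rule weighted_bump_lipschitz[OF xy x0 \<rho>0])
    also have "norm (pt x y - pt x y0) = \<bar>y - y0\<bar>" using dist_pt_vertical by (simp add: dist_norm)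
    also have "?L * \<bar>y - y0\<bar> \<le> ?L * (v + C * t^2)" using y L0 by (intro mult_left_mono) auto
    finally have g': "G - ?L * (v + C * t^2) \<le> ?g'" by linarith
    have "G - ?L * (v + C * t^2) - b * G \<le> exp (- b) * ?g'"
    proof (rule exp_times_ge[OF b0 _ g' _ G0(1)])
      show "0 \<le> ?g'" using bump_nonneg by simp
      have "0 \<le> ?L * (v + C * t^2)" using L0 v C by simp
      then show "G - ?L * (v + C * t^2) \<le> G" by simp
    qed
    moreover have "b * G \<le> b * (E1 * \<rho>)" using G0 b0 by (intro mult_left_mono)
    moreover have "b * (E1 * \<rho>) = B * t / s^2 * v^2 + B / s^2 * v^3"
      using s by (simp add: b_def B field_simps power2_eq_square power3_eq_cube)
    moreover have "0 \<le> E1 * \<rho> / h * v" using E1 \<rho> h v by simp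
    ultimately have "(G - ?L * C * t^2) + - (?L + E1 * \<rho> / h) * \<bar>v\<bar> + - (B * t / s^2) * v^2 + - (B / s^2) * \<bar>v\<bar>^3 \<le> exp (- b) * ?g'"
      unfolding gpoly_coeffs_expand[OF v] distrib_left mult.assoc[of ?L C] by linarith
    then have "exp (- (v^2) / (2 * (s * q)^2)) * ((G - ?L * C * t^2) + - (?L + E1 * \<rho> / h) * \<bar>v\<bar> + - (B * t / s^2) * v^2 + - (B / s^2) * \<bar>v\<bar>^3)
       \<le> exp (- (v^2) / (2 * (s * q)^2)) * (exp (- b) * ?g')" by (intro mult_left_mono) auto
    also have "\<dots> = exp (- g (pt x y)) * exp (- (v^2 / (2 * (s * q)^2) + b)) * bump p \<rho> (pt x y)"
    proof -
      have "exp (- (v^2 / (2 * (s * q)^2) + b)) = exp (- (v^2) / (2 * (s * q)^2)) * exp (- b)"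
        by (simp flip: exp_add)
      then show ?thesis by (simp only: mult_ac)
    qed
    finally show ?thesis using 1 unfolding gpoly_def by linarith
  qed
qed

lemma gpoly_even: "gpoly \<sigma> a0 a1 a2 a3 (- v) = gpoly \<sigma> a0 a1 a2 a3 v" by (simp add: gpoly_def)

text \<open>The half-profiles above \<open>yu\<close> and below \<open>yl\<close> add up to one
  Gaussian of standard deviation \<open>s * q\<close>. The slice between them lies in
  \<open>A\<close>, is not penalized and adds a mass of at least \<open>c * t^2\<close> times the
  weight: this is the excess.\<close>

lemma corner_slice:
  assumes s: "0 < s" and t: "0 < t" "t \<le> 1" and \<rho>: "0 < \<rho>" and q: "1 \<le> q" "q \<le> 2" and c: "0 < c" and C: "0 < C"
    and h: "0 < h" "2 * h \<le> r" "C * (t + h) \<le> 1" "C * t^2 \<le> r"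
    and M: "pt x y0 \<in> M\<^sub>\<Omega>"
    and sl: "y0 - C * t^2 \<le> yl" "yl + c * t^2 \<le> yu" "yu \<le> y0" "\<And>y. y \<in> {yl..yu} \<Longrightarrow> pt x y \<in> A"
    and d: "\<And>v. 0 \<le> v \<Longrightarrow> v \<le> h \<Longrightarrow> infdist (pt x (yu + v)) A \<le> v * (1 / q + C * (t + v))"
      "\<And>v. 0 \<le> v \<Longrightarrow> v \<le> h \<Longrightarrow> infdist (pt x (yl - v)) A \<le> v * (1 / q + C * (t + v))"
    and G: "G = exp (- g (pt x y0)) * bump p \<rho> (pt x y0)"
  shows "(sqrt (2 * pi) * s + c * t^2 / 2) * (G * q) - corner_const C c h \<rho> * (s * (s + t) + t^4)
     \<le> (LINT y|lborel. wt A (1 / s^2) (pt x y) * bump p \<rho> (pt x y))"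
proof -
  let ?L = "\<Lambda>1 \<rho>" and ?\<kappa> = "1 / s^2"
  define B where "B = 3/2 * C * (E1 * \<rho>)"
  define a0 where "a0 = G - ?L * C * t^2"
  define a1 where "a1 = ?L + E1 * \<rho> / h"
  define P where "P = gpoly (s * q) a0 (- a1) (- (B * t / s^2)) (- (B / s^2))"
  let ?H = "\<lambda>y. wt A ?\<kappa> (pt x y) * bump p \<rho> (pt x y)"
  have \<rho>0: "0 \<le> \<rho>" using \<rho> by simp
  have L0: "0 \<le> ?L" using \<Lambda>1_nonneg \<rho>0 .
  have E1: "0 < E1" using E01 E(3) by linarith
  have B0: "0 \<le> B" using C E1 \<rho> by (simp add: B_def)
  have a10: "0 \<le> a1" using L0 E1 \<rho> h by (simp add: a1_def)
  have sq: "0 < s * q" using s q by simp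
  have x0: "pt x y0 \<in> K" using M M_subset_K by blast
  have G0: "0 \<le> G" unfolding G using bump_nonneg by simp
  note gl = gaussian_lower[OF sq a10, of "B / s^2" a0 "B * t / s^2"]
  have iP: "integrable lborel P" unfolding P_def using gl(1) B0 by simp
  note sp = split_gaussian_integral[OF iP]
  have ylu: "yl \<le> yu" 
  proof -
    have "0 \<le> c * t^2" using c by simp
    then show ?thesis using sl(2) by linarith
  qed
  have low: "indicator {yu..} y * P (y - yu) + indicator {..<yl} y * P (y - yl) + indicator {yl..<yu} y * max 0 a0 \<le> ?H y" for y
  proof -
    consider "yu \<le> y" | "y < yl" | "yl \<le> y" "y < yu" by linarith
    then show ?thesis
    proof cases
      case 1
      have "\<bar>y - y0\<bar> \<le> (y - yu) + C * t^2" using 1 sl ylu by linarith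
      then have "P (y - yu) \<le> ?H y" unfolding P_def a0_def a1_def
        using 1 d(1)[of "y - yu"] by (intro corner_weight[OF s t(1) \<rho> q(1) C h M _ _ _ G B_def]) auto
      then show ?thesis using 1 ylu by simp
    next
      case 2
      have "\<bar>y - y0\<bar> \<le> (yl - y) + C * t^2" using 2 sl ylu by linarith
      then have "P (yl - y) \<le> ?H y" unfolding P_def a0_def a1_def
        using 2 d(2)[of "yl - y"] by (intro corner_weight[OF s t(1) \<rho> q(1) C h M _ _ _ G B_def]) auto
      moreover have "P (y - yl) = P (yl - y)" using gpoly_even[of _ _ _ _ _ "yl - y"] by (simp add: P_def)
      ultimately show ?thesis using 2 ylu by simp
    next
      case 3
      have yA: "pt x y \<in> A" using 3 sl(4) by auto
      have "\<bar>y - y0\<bar> \<le> C * t^2" using 3 sl by linarith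
      then have "dist (pt x y) (pt x y0) \<le> 3 * r" using h r by (simp add: dist_pt_vertical)
      then have xy: "pt x y \<in> K" by (rule nbhd[OF M])
      have "\<bar>exp (- g (pt x y)) * bump p \<rho> (pt x y) - G\<bar> \<le> ?L * norm (pt x y - pt x y0)"
        unfolding G by (rule weighted_bump_lipschitz[OF xy x0 \<rho>0])
      also have "norm (pt x y - pt x y0) = \<bar>y - y0\<bar>" using dist_pt_vertical by (simp add: dist_norm)
      also have "?L * \<bar>y - y0\<bar> \<le> ?L * (C * t^2)" using \<open>\<bar>y - y0\<bar> \<le> C * t^2\<close> L0 by (intro mult_left_mono) auto
      finally have "a0 \<le> exp (- g (pt x y)) * bump p \<rho> (pt x y)" by (simp add: a0_def)
      moreover have "wt A ?\<kappa> (pt x y) = exp (- g (pt x y))" using xy yA \<phi>_id[of 0] by (simp add: wt_def)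
      ultimately have "max 0 a0 \<le> ?H y" using bump_nonneg by simp
      then show ?thesis using 3 by simp
    qed
  qed
  have im: "integrable lborel (\<lambda>y. indicator {yl..<yu} y * max 0 a0)" "(LINT y|lborel. indicator {yl..<yu} y * max 0 a0) = (yu - yl) * max 0 a0"
    using ylu by simp_all
  have "(LINT y|lborel. indicator {yu..} y * P (y - yu) + indicator {..<yl} y * P (y - yl) + indicator {yl..<yu} y * max 0 a0) \<le> integral\<^sup>L lborel ?H"
  proof (rule integral_mono[OF _ _ low])
    show "integrable lborel ?H" by (rule slice_integrable[OF _ bump_measurable bump_abs_le[OF \<rho>0]]) simp
  qed (intro Bochner_Integration.integrable_add sp im)
  moreover have "(LINT y|lborel. indicator {yu..} y * P (y - yu) + indicator {..<yl} y * P (y - yl) + indicator {yl..<yu} y * max 0 a0)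
      = integral\<^sup>L lborel P + (yu - yl) * max 0 a0"
    using sp(1)[of yu] sp(2)[of yl] sp(3)[of yu yl] im by simp
  moreover have "c * t^2 * a0 \<le> (yu - yl) * max 0 a0"
  proof -
    have "c * t^2 * a0 \<le> c * t^2 * max 0 a0" using c by (intro mult_left_mono) auto
    also have "\<dots> \<le> (yu - yl) * max 0 a0" using sl(2) by (intro mult_right_mono) auto
    finally show ?thesis .
  qed
  moreover have "sqrt (2 * pi) * (s * q) * (a0 - a1 * (s * q) - B * t / s^2 * (s * q)^2 - 2 * (B / s^2) * (s * q)^3) \<le> integral\<^sup>L lborel P"
    using gl(2) B0 unfolding P_def by simp
  ultimately have 1: "sqrt (2 * pi) * (s * q) * (a0 - a1 * (s * q) - B * t / s^2 * (s * q)^2 - 2 * (B / s^2) * (s * q)^3) + c * t^2 * a0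
     \<le> integral\<^sup>L lborel ?H" by linarith
  have q2: "q^2 \<le> 4" "q^3 \<le> 8" using power_mono[of q 2 2] power_mono[of q 2 3] q by auto
  have tt: "t^2 \<le> t" using t power_decreasing[of 1 2 t] by simp
  have e1: "?L * C * t^2 \<le> ?L * C * t" using L0 C tt by (intro mult_left_mono) auto
  have e2: "a1 * (s * q) \<le> 2 * a1 * s" using mult_left_mono[of q 2 "a1 * s"] a10 s q by simp
  have e3: "B * t / s^2 * (s * q)^2 \<le> 4 * B * t"
  proof -
    have "B * t / s^2 * (s * q)^2 = B * t * q^2" using s by (simp add: power_mult_distrib)
    also have "\<dots> \<le> B * t * 4" using q2 B0 t by (intro mult_left_mono) auto
    finally show ?thesis by simp
  qed
  have e4: "2 * (B / s^2) * (s * q)^3 \<le> 16 * B * s"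
  proof -
    have "2 * (B / s^2) * (s * q)^3 = 2 * B * s * q^3" using s by (simp add: power_mult_distrib power2_eq_square power3_eq_cube)
    also have "\<dots> \<le> 2 * B * s * 8" using q2 B0 s by (intro mult_left_mono) auto
    finally show ?thesis by simp
  qed
  define N where "N = ?L * C + 4 * B + 2 * a1 + 16 * B"
  have N0: "0 \<le> ?L * C" "0 \<le> N" using L0 C B0 a10 by (auto simp: N_def)
  have "?L * C * t + 2 * a1 * s + 4 * B * t + 16 * B * s \<le> N * (s + t)"
  proof -
    have "0 \<le> ?L * C * s" "0 \<le> 2 * a1 * t" "0 \<le> 4 * B * s" "0 \<le> 16 * B * t" using N0 a10 B0 s t by auto
    then show ?thesis by (simp add: N_def algebra_simps)
  qed
  then have "G - N * (s + t) \<le> a0 - a1 * (s * q) - B * t / s^2 * (s * q)^2 - 2 * (B / s^2) * (s * q)^3"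
    unfolding a0_def using e1 e2 e3 e4 by linarith
  then have "sqrt (2 * pi) * (s * q) * (G - N * (s + t)) \<le> sqrt (2 * pi) * (s * q) * (a0 - a1 * (s * q) - B * t / s^2 * (s * q)^2 - 2 * (B / s^2) * (s * q)^3)"
    using sq by (intro mult_left_mono) auto
  moreover have "sqrt (2 * pi) * (s * q) * (N * (s + t)) \<le> sqrt (2 * pi) * (s * 2) * (N * (s + t))"
    using q s t N0 by (intro mult_right_mono mult_left_mono) auto
  \<comment> \<open>Half of the excess is given up, using \<open>q \<le> 2\<close>, so that both
    terms carry \<open>G * q\<close>, the integrand of \<open>vol\<close> over the graph.\<close>
  moreover have "c * t^2 / 2 * (G * q) \<le> c * t^2 * G"
    using mult_left_mono[of "q / 2" 1 "c * t^2 * G"] q c G0 by (simp add: mult_ac)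
  moreover have "c * t^2 * a0 = c * t^2 * G - c * ?L * C * t^4" unfolding a0_def by (simp add: algebra_simps power2_eq_square power4_eq_xxxx)
  ultimately have "sqrt (2 * pi) * (s * q) * G - 2 * sqrt (2 * pi) * N * (s * (s + t)) + c * t^2 / 2 * (G * q) - c * ?L * C * t^4 \<le> integral\<^sup>L lborel ?H"
    using 1 by (simp add: algebra_simps)
  moreover have "2 * sqrt (2 * pi) * N * (s * (s + t)) + c * ?L * C * t^4 \<le> corner_const C c h \<rho> * (s * (s + t) + t^4)"
  proof -
    have cc: "corner_const C c h \<rho> = 2 * sqrt (2 * pi) * N + c * ?L * C"
      by (simp add: corner_const_def N_def a1_def B_def)
    have "0 \<le> 2 * sqrt (2 * pi) * N * t^4" "0 \<le> c * ?L * C * (s * (s + t))" using N0 c C L0 s t by auto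
    then show ?thesis unfolding cc by (simp add: algebra_simps)
  qed
  ultimately show ?thesis by (simp add: algebra_simps)
qed

text \<open>Integrates \<open>corner_slice\<close> over the abscissas with \<open>q\<close> the
  arclength density, so that the slice weights \<open>G * q\<close> integrate to the
  \<open>vol\<close> of the bump.\<close>

lemma corner_lower:
  assumes s: "0 < s" and t: "0 < t" "t \<le> 1" and \<rho>: "0 < \<rho>" "\<rho> \<le> 1/4" and xc: "2 \<le> xc - \<rho>" "xc + \<rho> \<le> 5/2"
    and c: "0 < c" and C: "0 < C"
    and h: "0 < h" "2 * h \<le> r" "C * (t + h) \<le> 1" "C * t^2 \<le> r"
    and geo: "\<And>x. x \<in> {xc-\<rho>..xc+\<rho>} \<Longrightarrow>
       \<exists>yl yu. qt x - C * t^2 \<le> yl \<and> yl + c * t^2 \<le> yu \<and> yu \<le> qt x \<and>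
         (\<forall>y\<in>{yl..yu}. pt x y \<in> A) \<and>
         (\<forall>v. 0 \<le> v \<and> v \<le> h \<longrightarrow>
            infdist (pt x (yu + v)) A \<le> v * (1 / sqrt (1 + (dqt x)^2) + C * (t + v)) \<and>
            infdist (pt x (yl - v)) A \<le> v * (1 / sqrt (1 + (dqt x)^2) + C * (t + v)))"
  shows "(sqrt (2 * pi) * s + c * t^2 / 2) * vol (bump (pt xc (qt xc)) \<rho>) - 2 * \<rho> * corner_const C c h \<rho> * (s * (s + t) + t^4)
     \<le> W A (1 / s^2) (bump (pt xc (qt xc)) \<rho>)"
proof -
  let ?f = "bump (pt xc (qt xc)) \<rho>" and ?\<kappa> = "1 / s^2"
  let ?G = "\<lambda>x. exp (- g (pt x (qt x))) * ?f (pt x (qt x))"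
  define D where "D = corner_const C c h \<rho> * (s * (s + t) + t^4)"
  define a where "a = sqrt (2 * pi) * s + c * t^2 / 2"
  define S where "S x = (LINT y|lborel. wt A ?\<kappa> (pt x y) * ?f (pt x y))" for x
  have \<rho>0: "0 \<le> \<rho>" using \<rho> by simp
  have iw: "integrable lborel (\<lambda>x. wt A ?\<kappa> x * ?f x)"
    by (rule integrable_wt[OF _ bump_measurable bump_abs_le[OF \<rho>0]]) simp
  have xc': "- 2 \<le> xc" "xc + \<rho> \<le> 5/2" using xc \<rho> by auto
  note vg = vol_bump_graph[OF \<rho> xc']
  have S: "a * (?G x * sqrt (1 + (dqt x)^2) * indicator {xc-\<rho>..xc+\<rho>} x) - indicator {xc-\<rho>..xc+\<rho>} x * D \<le> S x" for x
  proof (cases "x \<in> {xc-\<rho>..xc+\<rho>}")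
    case True
    then have x: "2 \<le> x" "x \<le> 5/2" using xc by auto
    obtain yl yu where y: "qt x - C * t^2 \<le> yl" "yl + c * t^2 \<le> yu" "yu \<le> qt x"
         "\<And>y. y \<in> {yl..yu} \<Longrightarrow> pt x y \<in> A"
         "\<And>v. 0 \<le> v \<Longrightarrow> v \<le> h \<Longrightarrow> infdist (pt x (yu + v)) A \<le> v * (1 / sqrt (1 + (dqt x)^2) + C * (t + v))"
         "\<And>v. 0 \<le> v \<Longrightarrow> v \<le> h \<Longrightarrow> infdist (pt x (yl - v)) A \<le> v * (1 / sqrt (1 + (dqt x)^2) + C * (t + v))"
      using geo[OF True] by blast
    have "(x - 2)^3 \<le> (1/2)^3" using x by (intro power_mono) auto
    then have "\<bar>dqt x\<bar> \<le> 1" using dqt_bounds(1)[OF x] by (simp add: power_divide)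
    then have "(dqt x)^2 \<le> 1" by (simp add: abs_square_le_1)
    then have q: "1 \<le> sqrt (1 + (dqt x)^2)" "sqrt (1 + (dqt x)^2) \<le> 2" by (auto intro: real_le_lsqrt)
    have "pt x (qt x) \<in> M\<^sub>\<Omega>" using x by (intro qt_in_M) auto
    from corner_slice[OF s t \<rho>(1) q c C h this y refl]
    show ?thesis using True by (simp add: S_def a_def D_def)
  next
    case False
    then show ?thesis unfolding S_def by (simp add: integral_nonneg_AE wt_nonneg bump_nonneg)
  qed
  have ind: "integrable lborel (\<lambda>x. indicator {xc-\<rho>..xc+\<rho>} x * D)" "(LINT x|lborel. indicator {xc-\<rho>..xc+\<rho>} x * D) = 2 * \<rho> * D"
    using \<rho> by simp_all
  have "a * vol ?f - 2 * \<rho> * D = (LINT x|lborel. a * (?G x * sqrt (1 + (dqt x)^2) * indicator {xc-\<rho>..xc+\<rho>} x) - indicator {xc-\<rho>..xc+\<rho>} x * D)"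
    using vg ind \<rho>0 by simp
  also have "\<dots> \<le> integral\<^sup>L lborel S"
    using vg(1) ind(1) integral_real2(1)[OF iw]
    by (intro integral_mono[OF _ _ S] Bochner_Integration.integrable_diff integrable_mult_right) (simp_all add: S_def[abs_def])
  also have "\<dots> = W A ?\<kappa> ?f" unfolding W_def S_def by (rule integral_real2(2)[OF iw, symmetric])
  finally show ?thesis by (simp add: a_def D_def mult.assoc)
qed

lemma vol_bump_pos:
  assumes \<rho>: "0 < \<rho>" "\<rho> \<le> 1/4" and c: "- 2 \<le> c" "c + \<rho> \<le> 5/2"
  shows "0 < vol (bump (pt c (qt c)) \<rho>)"
proof -
  have \<rho>0: "0 \<le> \<rho>" using \<rho> by simp
  let ?f = "bump (pt c (qt c)) \<rho>"
  let ?h = "\<lambda>x. exp (- g (pt x (qt x))) * ?f (pt x (qt x)) * sqrt (1 + (dqt x)^2) * indicator {c-\<rho>..c+\<rho>} x"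
  have "isCont (\<lambda>x. dist (pt x (qt x)) (pt c (qt c))) c"
  proof -
    have "isCont qt c" using c \<rho> by (intro DERIV_isCont[OF DERIV_qt]) auto
    then show ?thesis unfolding pt_as_axis by (intro continuous_intros)
  qed
  then have "((\<lambda>x. dist (pt x (qt x)) (pt c (qt c))) \<longlongrightarrow> 0) (at c)" by (simp add: isCont_def)
  then have "eventually (\<lambda>x. dist (pt x (qt x)) (pt c (qt c)) < \<rho> / 2) (at c)" using \<rho> by (intro order_tendstoD) auto
  then obtain e where e: "0 < e" "\<And>x. x \<noteq> c \<Longrightarrow> dist x c < e \<Longrightarrow> dist (pt x (qt x)) (pt c (qt c)) < \<rho> / 2"
    unfolding eventually_at by auto
  define \<delta> where "\<delta> = min (e / 2) \<rho>"
  have \<delta>: "0 < \<delta>" "\<delta> < e" "\<delta> \<le> \<rho>" using e \<rho> by (auto simp: \<delta>_def)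
  have low: "indicator {c-\<delta>..c+\<delta>} x * (E0 * (\<rho> / 2)) \<le> ?h x" for x
  proof (cases "x \<in> {c-\<delta>..c+\<delta>}")
    case True
    then have x: "x \<in> {c-\<rho>..c+\<rho>}" "dist x c < e" using \<delta> by (auto simp: dist_real_def)
    have "dist (pt x (qt x)) (pt c (qt c)) < \<rho> / 2" using e(2)[of x] x \<rho> by (cases "x = c") auto
    then have f: "\<rho> / 2 \<le> ?f (pt x (qt x))" by (simp add: bump_def max_def)
    have "\<bar>x\<bar> < 3" using x(1) c \<rho> unfolding abs_less_iff by auto
    then have "pt x (qt x) \<in> K" using qt_in_M M_subset_K by blast
    then have "E0 * (\<rho> / 2) \<le> exp (- g (pt x (qt x))) * ?f (pt x (qt x))" using E(1,3) f \<rho> by (intro mult_mono) auto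
    also have "\<dots> * 1 \<le> exp (- g (pt x (qt x))) * ?f (pt x (qt x)) * sqrt (1 + (dqt x)^2)"
      by (intro mult_left_mono mult_nonneg_nonneg bump_nonneg) auto
    finally show ?thesis using True x by simp
  next
    case False
    have "0 \<le> ?h x" by (intro mult_nonneg_nonneg bump_nonneg) auto
    moreover have "indicator {c-\<delta>..c+\<delta>} x * (E0 * (\<rho> / 2)) = 0" using False by (auto simp: indicator_def)
    ultimately show ?thesis by linarith
  qed
  have "(LINT x|lborel. indicator {c-\<delta>..c+\<delta>} x * (E0 * (\<rho> / 2))) \<le> (LINT x|lborel. ?h x)"
    by (rule integral_mono[OF _ vol_bump_graph(1)[OF \<rho> c] low]) (use \<delta> in simp)
  moreover have "(LINT x|lborel. indicator {c-\<delta>..c+\<delta>} x * (E0 * (\<rho> / 2))) = 2 * \<delta> * (E0 * (\<rho> / 2))" using \<delta> by simp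
  moreover have "0 < 2 * \<delta> * (E0 * (\<rho> / 2))" using \<delta> E(3) \<rho> by simp
  ultimately show ?thesis unfolding vol_bump_graph(2)[OF \<rho> c] by linarith
qed

subsection \<open>The lower bound\<close>

lemma vol_lincomb:
  assumes [measurable]: "f \<in> borel_measurable borel" "h \<in> borel_measurable borel" and B: "\<And>x. \<bar>f x\<bar> \<le> B" "\<And>x. \<bar>h x\<bar> \<le> B'"
  shows "vol (\<lambda>x. a * f x + b * h x) = a * vol f + b * vol h"
proof -
  have "vol (\<lambda>x. a * f x + b * h x) = (LINT p|Vol M\<^sub>\<Omega>. a * (indicator M\<^sub>\<Omega> p * exp (- g p) * f p) + b * (indicator M\<^sub>\<Omega> p * exp (- g p) * h p))"
    unfolding vol_def by (simp add: algebra_simps)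
  then show ?thesis unfolding vol_def
    using integrable_mass[of f B] integrable_mass[of h B'] B by simp
qed

lemma vol_one_pos: "0 < vol (\<lambda>_. 1)"
proof -
  have "0 < vol (bump (pt 0 (qt 0)) (1/4))" by (rule vol_bump_pos) auto
  also have "\<dots> \<le> vol (\<lambda>_. 1)"
  proof (rule vol_mono[of _ _ 1])
    show "\<bar>bump (pt 0 (qt 0)) (1/4) p\<bar> \<le> 1" "bump (pt 0 (qt 0)) (1/4) p \<le> 1" for p
      using bump_abs_le[of "1/4" "pt 0 (qt 0)" p] bump_le[of "1/4" "pt 0 (qt 0)" p] by simp_all
  qed auto
  finally show ?thesis .
qed

lemma vertical_bump:
  fixes \<rho> :: real
  assumes \<rho>: "0 < \<rho>" "\<rho> \<le> 1/4"
  defines "\<psi> \<equiv> (\<lambda>x::real^2. bump (pt 0 2) \<rho> x * \<bar>x$2 - 2\<bar>)"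
  shows "\<bar>\<psi> x\<bar> \<le> \<rho> * \<rho>" "\<bar>\<psi> x - \<psi> y\<bar> \<le> 2 * \<rho> * norm (x - y)" "vol \<psi> = 0"
proof -
  let ?f = "bump (pt 0 2) \<rho>"
  have \<rho>0: "0 \<le> \<rho>" using \<rho> by simp
  have near: "\<bar>x$1\<bar> < \<rho>" "\<bar>x$2 - 2\<bar> < \<rho>" if "?f x \<noteq> 0" for x
    using bump_support[OF that] dist_pt_ge(1)[of "x$1" 0 "x$2" 2] dist_pt_ge(2)[of "x$2" 2 "x$1" 0] by (simp_all add: pt_components)
  show "\<bar>\<psi> x\<bar> \<le> \<rho> * \<rho>"
  proof (cases "?f x = 0")
    case False
    have "\<bar>?f x\<bar> * \<bar>x$2 - 2\<bar> \<le> \<rho> * \<rho>" using bump_abs_le[OF \<rho>0] near(2)[OF False] \<rho>0 by (intro mult_mono) auto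
    then show ?thesis by (simp add: \<psi>_def abs_mult)
  qed (use \<rho> in \<open>simp add: \<psi>_def\<close>)
  \<comment> \<open>The product rule needs \<open>\<bar>x$2 - 2\<bar> < \<rho>\<close>, so
    \<open>x\<close> is taken in the support; the other case follows by symmetry.\<close>
  have one: "\<bar>\<psi> x - \<psi> y\<bar> \<le> 2 * \<rho> * norm (x - y)" if "?f x \<noteq> 0" for x y
  proof -
    have "\<psi> x - \<psi> y = (?f x - ?f y) * \<bar>x$2 - 2\<bar> + ?f y * (\<bar>x$2 - 2\<bar> - \<bar>y$2 - 2\<bar>)" unfolding \<psi>_def by algebra
    then have "\<bar>\<psi> x - \<psi> y\<bar> \<le> \<bar>?f x - ?f y\<bar> * \<bar>x$2 - 2\<bar> + ?f y * \<bar>\<bar>x$2 - 2\<bar> - \<bar>y$2 - 2\<bar>\<bar>"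
      using abs_triangle_ineq[of "(?f x - ?f y) * \<bar>x$2 - 2\<bar>" "?f y * (\<bar>x$2 - 2\<bar> - \<bar>y$2 - 2\<bar>)"] bump_nonneg
      by (simp add: abs_mult)
    also have "\<dots> \<le> norm (x - y) * \<rho> + \<rho> * norm (x - y)"
    proof (intro add_mono mult_mono)
      have "\<bar>\<bar>x$2 - 2\<bar> - \<bar>y$2 - 2\<bar>\<bar> \<le> \<bar>(x - y)$2\<bar>" using abs_triangle_ineq3[of "x$2 - 2" "y$2 - 2"] by simp
      also have "\<dots> \<le> norm (x - y)" by (rule component_le_norm_cart)
      finally show "\<bar>\<bar>x$2 - 2\<bar> - \<bar>y$2 - 2\<bar>\<bar> \<le> norm (x - y)" .
    qed (use bump_lipschitz near(2)[OF that] bump_le[OF \<rho>0] \<rho>0 in auto)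
    finally show ?thesis by simp
  qed
  show "\<bar>\<psi> x - \<psi> y\<bar> \<le> 2 * \<rho> * norm (x - y)"
  proof (cases "?f x = 0 \<and> ?f y = 0")
    case True then show ?thesis using \<rho> by (simp add: \<psi>_def)
  next
    case False
    then show ?thesis using one[of x y] one[of y x] by (auto simp: abs_minus_commute norm_minus_commute)
  qed
  have z: "indicator M\<^sub>\<Omega> p * exp (- g p) * \<psi> p = 0" for p
  proof (cases "p \<in> M\<^sub>\<Omega> \<and> ?f p \<noteq> 0")
    case True
    have "\<bar>p$1\<bar> \<le> 2" "1 < p$2" using near[of p] True \<rho> by linarith+
    then have "p$2 = 2" using True M_flat_point by blast
    then show ?thesis by (simp add: \<psi>_def)
  next
    case False then show ?thesis by (auto simp: \<psi>_def)
  qed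
  show "vol \<psi> = 0" unfolding vol_def z by simp
qed

lemma asymptotics:
  assumes \<eta>: "0 < \<eta>" "\<eta> < 1/3"
  shows "\<exists>c\<^sub>1>0. \<exists>c\<^sub>2>0. \<exists>t\<^sub>0>0. \<forall>t X. 0 < t \<and> t < t\<^sub>0 \<and> finite X \<and> X \<noteq> {} \<and> X \<subseteq> M\<^sub>\<Omega> \<and>
      (\<forall>y\<in>M\<^sub>\<Omega>. \<exists>x\<in>X. dist y x \<le> \<eta> * t) \<longrightarrow>
      t \<le> 1/20000 \<and> c\<^sub>1 * t^2 \<le> hausdorff_dist (Conv t X) M\<^sub>\<Omega> \<and>
      (\<forall>\<kappa>>0. c\<^sub>2 * t \<le> W2 (penalized_law K g \<phi> (Conv t X) \<kappa>) (target_law g M\<^sub>\<Omega>))"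
proof -
  obtain a b c C tg h0 where ab: "2 < a" "a < b" "b < 5/2" and pos: "0 < c" "0 < C" "0 < tg" "0 < h0"
    and geo: "\<And>t X x. 0 < t \<Longrightarrow> t < tg \<Longrightarrow> finite X \<Longrightarrow> X \<subseteq> M\<^sub>\<Omega> \<Longrightarrow>
       (\<And>y. y \<in> M\<^sub>\<Omega> \<Longrightarrow> \<exists>x\<in>X. dist y x \<le> \<eta> * t) \<Longrightarrow> x \<in> {a..b} \<Longrightarrow>
       \<exists>yl yu. qt x - C * t^2 \<le> yl \<and> yl + c * t^2 \<le> yu \<and> yu \<le> qt x \<and>
         (\<forall>y\<in>{yl..yu}. pt x y \<in> Conv t X) \<and>
         (\<forall>v. 0 \<le> v \<and> v \<le> h0 \<longrightarrow>
            infdist (pt x (yu + v)) (Conv t X) \<le> v * (1 / sqrt (1 + (dqt x)^2) + C * (t + v)) \<and>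
            infdist (pt x (yl - v)) (Conv t X) \<le> v * (1 / sqrt (1 + (dqt x)^2) + C * (t + v)))"
    using corner_geometry[OF \<eta>] by metis
  \<comment> \<open>The corner bump then stays over the interval from \<open>a\<close> to
    \<open>b\<close>, and the supports of both bumps stay in the tube.\<close>
  define \<rho> where "\<rho> = min r (min (1/4) ((b - a) / 2))"
  have \<rho>: "0 < \<rho>" "\<rho> \<le> 1/4" "\<rho> \<le> r" "\<rho> \<le> (b - a) / 2"
  proof -
    have "\<rho> \<le> min (1/4) ((b - a) / 2)" unfolding \<rho>_def by (rule min.cobounded2)
    then have "\<rho> \<le> 1/4 \<and> \<rho> \<le> (b - a) / 2" by (simp only: min.bounded_iff)
    then show "\<rho> \<le> 1/4" "\<rho> \<le> (b - a) / 2" by blast+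
    show "\<rho> \<le> r" unfolding \<rho>_def by (rule min.cobounded1)
    show "0 < \<rho>" using r ab by (simp add: \<rho>_def)
  qed
  have \<rho>0: "0 \<le> \<rho>" using \<rho> by simp
  define xc where "xc = (a + b) / 2"
  have xcb: "a \<le> xc - \<rho>" "xc + \<rho> \<le> b"
  proof -
    have "2 * \<rho> \<le> b - a" using \<rho>(4) by (simp add: field_simps)
    moreover have "2 * xc = a + b" by (simp add: xc_def)
    ultimately show "a \<le> xc - \<rho>" "xc + \<rho> \<le> b" by linarith+
  qed
  have xc: "2 \<le> xc - \<rho>" "xc + \<rho> \<le> 5/2" "{xc-\<rho>..xc+\<rho>} \<subseteq> {a..b}" "xc \<in> {a..b}" using xcb \<rho> ab by auto
  define h where "h = min h0 (min (r / 2) (1 / (2 * C)))"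
  have h: "0 < h" "h \<le> h0" "2 * h \<le> r" "C * h \<le> 1/2"
  proof -
    have "h \<le> 1 / (2 * C)" "h \<le> r / 2" by (auto simp: h_def)
    then show "2 * h \<le> r" "C * h \<le> 1/2" using pos by (auto simp: field_simps)
  qed (use pos r in \<open>auto simp: h_def\<close>)
  let ?f = "bump (pt 0 2) \<rho>" and ?fc = "bump (pt xc (qt xc)) \<rho>"
  define eF where "eF = vol ?f"
  define eC where "eC = vol ?fc"
  define Z where "Z = vol (\<lambda>_. 1)"
  have Z: "0 < Z" using vol_one_pos by (simp add: Z_def)
  have "qt 0 = 2" using qt_flat(1)[of 0] by simp
  then have eF: "0 < eF" using vol_bump_pos[OF \<rho>(1,2), of 0] \<rho> by (simp add: eF_def)
  have eC: "0 < eC" unfolding eC_def by (rule vol_bump_pos[OF \<rho>(1,2)]) (use xc \<rho> in auto)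
  define \<theta> where "\<theta> = eF / (2 * Z)"
  have \<theta>: "0 < \<theta>" "eF / Z = 2 * \<theta>" using eF Z by (auto simp: \<theta>_def)
  \<comment> \<open>The absolute value spares an analysis of the sign of
    \<open>corner_const\<close>.\<close>
  define D where "D = \<bar>2 * \<rho> * corner_const C c h \<rho>\<bar>"
  define D' where "D' = sqrt (2 * pi) * (2 * \<rho> * \<Lambda>1 \<rho>)"
  have D: "0 \<le> D" "0 \<le> D'" using \<Lambda>1_nonneg[OF \<rho>0] \<rho> by (auto simp: D_def D'_def)
  define Q where "Q = eF * eC * c / 2"
  have Q: "0 < Q" using eF eC pos by (simp add: Q_def)
  define N where "N = 3 * eF * D + eC * D'"
  have N: "0 \<le> N" using eF eC D by (simp add: N_def)
  \<comment> \<open>The threshold between the regimes \<open>s \<le> \<beta> * t\<close> and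
    \<open>s > \<beta> * t\<close>, so small that all errors together,
    \<open>N * \<beta> * t^2\<close>, use up at most half of the excess
    \<open>Q * t^2\<close>.\<close>
  define \<beta> where "\<beta> = min 1 (Q / (2 * (N + 1)))"
  have \<beta>: "0 < \<beta>" "\<beta> \<le> 1" using Q N by (auto simp: \<beta>_def)
  have \<beta>N: "N * \<beta> \<le> Q / 2"
  proof -
    have "(N + 1) * \<beta> \<le> (N + 1) * (Q / (2 * (N + 1)))" using N by (intro mult_left_mono) (auto simp: \<beta>_def)
    also have "\<dots> = Q / 2" using N by (simp add: field_simps)
    finally show ?thesis using \<beta> by (simp add: distrib_right)
  qed
  define C4 where "C4 = (sqrt (2 * pi) * eF + D') / \<theta>"
  have C4: "0 < C4" using eF D \<theta> by (auto simp: C4_def intro!: divide_pos_pos add_pos_nonneg)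
  define \<mu> where "\<mu> = E0 * exp (- 2) / (16 * E1)"
  have \<mu>: "0 < \<mu>" using E(3) E01 by (simp add: \<mu>_def)
  \<comment> \<open>One entry for each outcome: a large distance, a thin law that shows the excess
    at the corner, and a wide law that spreads around the edge.\<close>
  define c2 where "c2 = min \<theta> (min (Q / (2 * C4 * (eF + eC))) (\<mu> * \<beta> * \<theta> / (4 * \<rho>)))"
  have c2: "0 < c2" "c2 \<le> \<theta>" "c2 \<le> Q / (2 * C4 * (eF + eC))" "c2 \<le> \<mu> * \<beta> * \<theta> / (4 * \<rho>)"
    using \<theta> Q C4 eF eC \<mu> \<beta> \<rho> by (auto simp: c2_def)
  define t0 where "t0 = min tg (min (1/20000) (min (\<beta> / 1728) (min (\<rho> / 4) (min (1 / (2 * C)) (r / C)))))"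
  have t0: "0 < t0" using pos \<beta> \<rho> r by (simp add: t0_def)
  have main: "t \<le> 1/20000 \<and> c / 64 * t^2 \<le> hausdorff_dist (Conv t X) M\<^sub>\<Omega> \<and>
      (\<forall>\<kappa>>0. c2 * t \<le> W2 (penalized_law K g \<phi> (Conv t X) \<kappa>) (target_law g M\<^sub>\<Omega>))"
    if t: "0 < t" "t < t0" and X: "finite X" "X \<noteq> {}" "X \<subseteq> M\<^sub>\<Omega>" and S: "\<And>y. y \<in> M\<^sub>\<Omega> \<Longrightarrow> \<exists>x\<in>X. dist y x \<le> \<eta> * t" for t X
  proof (intro conjI allI impI)
    have tt: "t < tg" "t \<le> 1/20000" "t \<le> \<beta> / 1728" "t \<le> \<rho> / 4" "t \<le> 1 / (2 * C)" "t \<le> r / C"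
      using t by (auto simp: t0_def)
    have Ct: "C * t \<le> 1/2" "C * t \<le> r" using tt(5,6) pos by (auto simp: field_simps)
    have t2: "t^2 \<le> t" using t tt(2) power_decreasing[of 1 2 t] by simp
    have "C * t^2 \<le> C * t" using t2 pos by (intro mult_left_mono) auto
    then have Ct2: "C * t^2 \<le> 1/2" "C * t^2 \<le> r" using Ct by auto
    have hC: "C * (t + h) \<le> 1" using Ct h by (simp add: distrib_left)
    let ?A = "Conv t X"
    show "t \<le> 1/20000" by (rule tt)
    show "c / 64 * t^2 \<le> hausdorff_dist ?A M\<^sub>\<Omega>"
    proof -
      \<comment> \<open>The lower end of a single slice lies at least \<open>c * t^2\<close> below
        the curve, which is enough for the Hausdorff distance.\<close>
      obtain yl yu where y: "qt xc - C * t^2 \<le> yl" "yl + c * t^2 \<le> yu" "yu \<le> qt xc" "\<forall>y\<in>{yl..yu}. pt xc y \<in> ?A"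
        using geo[OF t(1) tt(1) X(1,3) S xc(4)] by blast
      have x: "2 \<le> xc" "xc \<le> 5/2" using xc \<rho> by auto
      have "0 \<le> c * t^2" using pos by simp
      then have yl: "yl \<le> yu" using y by linarith
      have "1 \<le> yl" using y(1) Ct2 qt_corner(1)[OF x] by linarith
      then have "(qt xc - yl) / 64 \<le> infdist (pt xc yl) M\<^sub>\<Omega>" using yl y by (intro infdist_M_corner_ge x) auto
      also have "\<dots> \<le> hausdorff_dist ?A M\<^sub>\<Omega>"
        using infdist_le_hausdorff_dist(1)[OF bounded_Conv[OF X(3)] compact_imp_bounded[OF compact_M] _ flat_point_in_M[of 0]] y(4) yl by simp
      finally show ?thesis using y(2,3) by simp
    qed
    fix \<kappa> :: real assume \<kappa>: "0 < \<kappa>"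
    define s where "s = 1 / sqrt \<kappa>"
    have s: "0 < s" "1 / s^2 = \<kappa>" using \<kappa> by (auto simp: s_def power_divide)
    define \<omega> where "\<omega> = W2 (penalized_law K g \<phi> ?A \<kappa>) (target_law g M\<^sub>\<Omega>)"
    define V where "V = W ?A \<kappa> (\<lambda>_. 1)"
    have V: "0 < V" using W_one_pos \<kappa> by (simp add: V_def)
    note test = W2_test[OF \<kappa> vol_one_pos, of _ _ _ ?A, folded \<omega>_def V_def Z_def]
    have "\<bar>W ?A \<kappa> ?f / V - eF / Z\<bar> \<le> 1 * \<omega>" unfolding eF_def
      using bump_lipschitz by (intro test[OF bump_abs_le[OF \<rho>0]]) auto
    then have tF: "2 * \<theta> - \<omega> \<le> W ?A \<kappa> ?f / V" using \<theta> by linarith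
    show "c2 * t \<le> W2 (penalized_law K g \<phi> ?A \<kappa>) (target_law g M\<^sub>\<Omega>)"
      unfolding \<omega>_def[symmetric]
    proof (cases "\<theta> \<le> \<omega>")
      case True
      have "c2 * t \<le> c2 * 1" using c2 tt by (intro mult_left_mono) auto
      then show "c2 * t \<le> \<omega>" using True c2 by linarith
    next
      case False
      \<comment> \<open>A small distance forces the edge bump to keep half of its target mean
        \<open>2 * \<theta>\<close>. This is the only control of the normalizing constant.\<close>
      then have FV: "\<theta> \<le> W ?A \<kappa> ?f / V" using tF by linarith
      then have FV': "\<theta> * V \<le> W ?A \<kappa> ?f" using V by (simp add: field_simps)
      show "c2 * t \<le> \<omega>"
      proof (cases "s \<le> \<beta> * t")
        case small: True
        have slt: "s \<le> t" using order_trans[OF small mult_right_mono[OF \<beta>(2), of t]] t by simp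
        have up: "W ?A \<kappa> ?f \<le> sqrt (2 * pi) * s * eF + D' * s^2"
          using flat_upper[OF s(1) \<rho>(1-3) t(1) _ X] tt(2) by (simp add: s(2) eF_def D'_def)
        have geo': "\<exists>yl yu. qt x - C * t^2 \<le> yl \<and> yl + c * t^2 \<le> yu \<and> yu \<le> qt x \<and>
           (\<forall>y\<in>{yl..yu}. pt x y \<in> ?A) \<and>
           (\<forall>v. 0 \<le> v \<and> v \<le> h \<longrightarrow>
            infdist (pt x (yu + v)) ?A \<le> v * (1 / sqrt (1 + (dqt x)^2) + C * (t + v)) \<and>
            infdist (pt x (yl - v)) ?A \<le> v * (1 / sqrt (1 + (dqt x)^2) + C * (t + v)))"
          if "x \<in> {xc-\<rho>..xc+\<rho>}" for x
        proof -
          have "x \<in> {a..b}" using that xc(3) by blast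
          from geo[OF t(1) tt(1) X(1,3) S this] show ?thesis using h(2) by (meson order_trans)
        qed
        have t1: "t \<le> 1" using tt(2) by simp
        have T: "0 \<le> s * (s + t) + t^4" using s t by simp
        have "2 * \<rho> * corner_const C c h \<rho> * (s * (s + t) + t^4) \<le> D * (s * (s + t) + t^4)"
          unfolding D_def using T by (intro mult_right_mono) auto
        then have low: "(sqrt (2 * pi) * s + c * t^2 / 2) * eC - D * (s * (s + t) + t^4) \<le> W ?A \<kappa> ?fc"
          using corner_lower[OF s(1) t(1) t1 \<rho>(1,2) xc(1,2) pos(1,2) h(1,3) hC Ct2(2) geo'] unfolding s(2) eC_def by linarith
        let ?\<Phi> = "\<lambda>x. eF * ?fc x + (- eC) * ?f x"
        have W\<Phi>: "W ?A \<kappa> ?\<Phi> = eF * W ?A \<kappa> ?fc + (- eC) * W ?A \<kappa> ?f"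
          by (rule W_lincomb[OF _ _ _ bump_abs_le[OF \<rho>0] bump_abs_le[OF \<rho>0]]) (use \<kappa> in auto)
        have "vol ?\<Phi> = eF * vol ?fc + (- eC) * vol ?f"
          by (rule vol_lincomb[OF _ _ bump_abs_le[OF \<rho>0] bump_abs_le[OF \<rho>0]]) auto
        then have vol\<Phi>: "vol ?\<Phi> = 0" by (simp add: eF_def eC_def)
        have l1: "eF * ((sqrt (2 * pi) * s + c * t^2 / 2) * eC - D * (s * (s + t) + t^4)) \<le> eF * W ?A \<kappa> ?fc"
          using low eF by (intro mult_left_mono) auto
        have l2: "eC * W ?A \<kappa> ?f \<le> eC * (sqrt (2 * pi) * s * eF + D' * s^2)"
          using up eC by (intro mult_left_mono) auto
        \<comment> \<open>The leading terms \<open>sqrt (2 * pi) * s * eF * eC\<close> cancel; the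
          excess \<open>Q * t^2\<close> and the errors remain.\<close>
        have "Q * t^2 - (eF * D * (s * (s + t) + t^4) + eC * D' * s^2)
          = eF * ((sqrt (2 * pi) * s + c * t^2 / 2) * eC - D * (s * (s + t) + t^4)) - eC * (sqrt (2 * pi) * s * eF + D' * s^2)"
          unfolding Q_def by (simp add: algebra_simps)
        then have l3: "Q * t^2 - (eF * D * (s * (s + t) + t^4) + eC * D' * s^2) \<le> W ?A \<kappa> ?\<Phi>"
          using l1 l2 W\<Phi> by linarith
        have st: "s * t \<le> \<beta> * t^2" using mult_right_mono[OF small, of t] t by (simp add: power2_eq_square mult.assoc)
        have ss: "s^2 \<le> \<beta> * t^2"
        proof -
          have "s * s \<le> s * t" using slt s by (intro mult_left_mono) auto
          then show ?thesis using st by (simp add: power2_eq_square)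
        qed
        have t4: "t^4 \<le> \<beta> * t^2"
        proof -
          have "t^2 \<le> \<beta>" using t2 tt(3) \<beta> by linarith
          then have "t^2 * t^2 \<le> \<beta> * t^2" by (intro mult_right_mono) auto
          then show ?thesis by (simp add: power2_eq_square power4_eq_xxxx mult.assoc)
        qed
        have "s * (s + t) + t^4 \<le> 3 * (\<beta> * t^2)" using st ss t4 by (simp add: distrib_left power2_eq_square)
        then have "eF * D * (s * (s + t) + t^4) \<le> eF * D * (3 * (\<beta> * t^2))" using eF D by (intro mult_left_mono) auto
        moreover have "eC * D' * s^2 \<le> eC * D' * (\<beta> * t^2)" using ss eC D by (intro mult_left_mono) auto
        moreover have "eF * D * (3 * (\<beta> * t^2)) + eC * D' * (\<beta> * t^2) = N * \<beta> * t^2" by (simp add: N_def algebra_simps)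
        moreover have "N * \<beta> * t^2 \<le> Q / 2 * t^2" using \<beta>N by (intro mult_right_mono) auto
        ultimately have WQ: "Q / 2 * t^2 \<le> W ?A \<kappa> ?\<Phi>" using l3 by linarith
        \<comment> \<open>The edge bump carries a fixed fraction of the mass, and here its own mass
          is of order \<open>s\<close>, hence at most of order \<open>t\<close>.\<close>
        have VC: "V \<le> C4 * t"
        proof -
          have "s^2 \<le> t" using ss t2 mult_right_mono[OF \<beta>(2), of "t^2"] by simp
          then have "D' * s^2 \<le> D' * t" using D by (intro mult_left_mono) auto
          moreover have "sqrt (2 * pi) * s * eF \<le> sqrt (2 * pi) * t * eF" using slt eF by (intro mult_right_mono mult_left_mono) auto
          ultimately have "\<theta> * V \<le> (sqrt (2 * pi) * eF + D') * t" using FV' up by (simp add: algebra_simps)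
          then show ?thesis using \<theta> by (simp add: C4_def field_simps)
        qed
        have "\<bar>W ?A \<kappa> ?\<Phi> / V - vol ?\<Phi> / Z\<bar> \<le> (eF + eC) * \<omega>"
        proof (rule test)
          fix x y
          show "\<bar>?\<Phi> x\<bar> \<le> eF * \<rho> + eC * \<rho>"
          proof -
            have "\<bar>?\<Phi> x\<bar> \<le> \<bar>eF * ?fc x\<bar> + \<bar>(- eC) * ?f x\<bar>" by (rule abs_triangle_ineq)
            also have "\<dots> = eF * \<bar>?fc x\<bar> + eC * \<bar>?f x\<bar>" using eF eC by (simp add: abs_mult)
            also have "\<dots> \<le> eF * \<rho> + eC * \<rho>" using eF eC by (intro add_mono mult_left_mono bump_abs_le[OF \<rho>0]) auto
            finally show ?thesis .
          qed
          have "?\<Phi> x - ?\<Phi> y = eF * (?fc x - ?fc y) + (- eC) * (?f x - ?f y)" by algebra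
          then have "\<bar>?\<Phi> x - ?\<Phi> y\<bar> \<le> \<bar>eF * (?fc x - ?fc y)\<bar> + \<bar>(- eC) * (?f x - ?f y)\<bar>" using abs_triangle_ineq by metis
          also have "\<dots> = eF * \<bar>?fc x - ?fc y\<bar> + eC * \<bar>?f x - ?f y\<bar>" using eF eC by (simp add: abs_mult)
          also have "\<dots> \<le> eF * norm (x - y) + eC * norm (x - y)" using eF eC by (intro add_mono mult_left_mono bump_lipschitz) auto
          finally show "\<bar>?\<Phi> x - ?\<Phi> y\<bar> \<le> (eF + eC) * norm (x - y)" by (simp add: distrib_right)
        qed (use eF eC in simp)
        from abs_le_D1[OF this] have "W ?A \<kappa> ?\<Phi> / V \<le> (eF + eC) * \<omega>" unfolding vol\<Phi> by simp
        moreover have "(Q / 2 * t^2) / (C4 * t) \<le> W ?A \<kappa> ?\<Phi> / V"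
        proof (rule frac_le[OF _ WQ V VC])
          show "0 \<le> W ?A \<kappa> ?\<Phi>" using WQ Q by (intro order_trans[OF _ WQ]) simp
        qed
        moreover have "(Q / 2 * t^2) / (C4 * t) = Q / (2 * C4) * t" using t by (simp add: power2_eq_square)
        ultimately have "Q / (2 * C4) * t \<le> (eF + eC) * \<omega>" by linarith
        then have "Q / (2 * C4) * t / (eF + eC) \<le> \<omega>" using eF eC
          by (subst pos_divide_le_eq) (simp_all add: mult.commute)
        moreover have "Q / (2 * C4 * (eF + eC)) * t = Q / (2 * C4) * t / (eF + eC)" by simp
        ultimately have "Q / (2 * C4 * (eF + eC)) * t \<le> \<omega>" by (simp only:)
        moreover have "c2 * t \<le> Q / (2 * C4 * (eF + eC)) * t" using c2 t by (intro mult_right_mono) auto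
        ultimately show ?thesis by linarith
      next
        case large: False
        let ?\<psi> = "\<lambda>x. bump (pt 0 2) \<rho> x * \<bar>x$2 - 2\<bar>"
        \<comment> \<open>In the wide regime \<open>flat_spread\<close> is applied at height
          \<open>\<beta> * t\<close>, so the bound is uniform for all larger
          \<open>s\<close>.\<close>
        have \<delta>: "0 < \<beta> * t" "\<beta> * t \<le> s" "\<beta> * t \<le> \<rho> / 4" "1728 * t^2 \<le> \<beta> * t"
        proof -
          have "\<beta> * t \<le> t" using \<beta>(2) t by simp
          then show "\<beta> * t \<le> \<rho> / 4" using tt(4) by (rule order_trans)
          have "1728 * t * t \<le> \<beta> * t" using tt(3) t by (intro mult_right_mono) auto
          then show "1728 * t^2 \<le> \<beta> * t" by (simp add: power2_eq_square)
        qed (use \<beta> t large in auto)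
        have "\<mu> * (\<beta> * t) / 2 * W ?A \<kappa> ?f \<le> W ?A \<kappa> ?\<psi>"
          using flat_spread[OF s(1) \<rho>(1-3) t(1) tt(2) X(1,3) S \<eta>(2) \<delta>] unfolding s(2) \<mu>_def .
        then have "\<mu> * (\<beta> * t) / 2 * (W ?A \<kappa> ?f / V) \<le> W ?A \<kappa> ?\<psi> / V"
          using divide_right_mono[of "\<mu> * (\<beta> * t) / 2 * W ?A \<kappa> ?f" _ V] V by simp
        moreover have "\<mu> * (\<beta> * t) / 2 * \<theta> \<le> \<mu> * (\<beta> * t) / 2 * (W ?A \<kappa> ?f / V)"
          using FV \<mu> \<delta> by (intro mult_left_mono) auto
        moreover have "W ?A \<kappa> ?\<psi> / V - vol ?\<psi> / Z \<le> 2 * \<rho> * \<omega>"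
          using vertical_bump[OF \<rho>(1,2)] \<rho> by (intro abs_le_D1[OF test[of _ "\<rho> * \<rho>"]]) auto
        moreover have "vol ?\<psi> / Z = 0" by (simp add: vertical_bump(3)[OF \<rho>(1,2)])
        ultimately have "\<mu> * (\<beta> * t) / 2 * \<theta> \<le> 2 * \<rho> * \<omega>" by linarith
        then have "\<mu> * (\<beta> * t) / 2 * \<theta> / (2 * \<rho>) \<le> \<omega>" using \<rho>(1)
          by (subst pos_divide_le_eq) (simp_all add: mult.commute)
        moreover have "\<mu> * \<beta> * \<theta> / (4 * \<rho>) * t = \<mu> * (\<beta> * t) / 2 * \<theta> / (2 * \<rho>)" by simp
        ultimately have "\<mu> * \<beta> * \<theta> / (4 * \<rho>) * t \<le> \<omega>" by (simp only:)
        moreover have "c2 * t \<le> \<mu> * \<beta> * \<theta> / (4 * \<rho>) * t" using c2 t by (intro mult_right_mono) auto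
        ultimately show ?thesis by linarith
      qed
    qed
  qed
  have "0 < c / 64" using pos by simp
  show ?thesis
    by (rule exI[of _ "c / 64"], rule conjI, fact, rule exI[of _ c2], rule conjI, rule c2(1), rule exI[of _ t0], rule conjI, rule t0,
        intro allI impI, elim conjE, rule main; simp)
qed

end

section \<open>From the assumptions of the theorem to the estimates\<close>

lemma exp_lipschitz:
  fixes a b :: real
  assumes "exp (- a) \<le> m" "exp (- b) \<le> m" shows "\<bar>exp (- a) - exp (- b)\<bar> \<le> m * \<bar>a - b\<bar>"
proof -
  have *: "exp (- a) - exp (- b) \<le> m * \<bar>a - b\<bar>" if "exp (- a) \<le> m" for a b :: real
  proof -
    have "exp (- a) - exp (- b) = exp (- a) * (1 - exp (a - b))" by (simp add: right_diff_distrib flip: exp_add)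
    also have "\<dots> \<le> exp (- a) * (b - a)"
    proof (rule mult_left_mono)
      show "1 - exp (a - b) \<le> b - a" using exp_ge_add_one_self[of "a - b"] by linarith
    qed simp
    also have "\<dots> \<le> exp (- a) * \<bar>a - b\<bar>" by (intro mult_left_mono) auto
    also have "\<dots> \<le> m * \<bar>a - b\<bar>" using that by (intro mult_right_mono) auto
    finally show ?thesis .
  qed
  show ?thesis using *[OF assms(1), of b] *[OF assms(2), of a] by (simp add: abs_le_iff abs_minus_commute)
qed

text \<open>The radius \<open>R\<^sub>0 + 3 * r\<close> lets the ball absorb the tube by the
  triangle inequality. The gradient bound becomes a Lipschitz bound since \<open>K\<close> is
  convex, and bounds of \<open>g\<close> carry it over to \<open>exp (- g)\<close>.\<close>

lemma tube_exists:
  assumes M: "M\<^sub>\<Omega> \<subseteq> cball z\<^sub>0 R\<^sub>0" and r: "0 < r" and K: "K = cball z\<^sub>0 (R\<^sub>0 + 3 * r)" and cut: "cutoff r \<phi>" and pot: "potential K g"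
  shows "\<exists>E0 E1 \<Lambda>. tube K g \<phi> r E0 E1 \<Lambda>"
proof -
  from pot obtain U G H where P: "open U \<and> K \<subseteq> U \<and>
        (\<forall>x\<in>U. (g has_derivative (\<lambda>h. G x \<bullet> h)) (at x)) \<and>
        (\<forall>x\<in>U. (G has_derivative (\<lambda>h. H x *v h)) (at x)) \<and>
        continuous_on U H \<and>
        bdd_above ((\<lambda>x. norm (G x)) ` K) \<and>
        bdd_above ((\<lambda>x. onorm (\<lambda>h. H x *v h)) ` K) \<and>
        bdd_above (g ` K) \<and> bdd_below (g ` K)"
    unfolding potential_def by (elim exE) (rule that)
  note KU = P[THEN conjunct2, THEN conjunct1] and U = P[THEN conjunct2, THEN conjunct2, THEN conjunct1, rule_format]
    and bG = P[THEN conjunct2, THEN conjunct2, THEN conjunct2, THEN conjunct2, THEN conjunct2, THEN conjunct1] and bg = P[THEN conjunct2, THEN conjunct2, THEN conjunct2, THEN conjunct2, THEN conjunct2, THEN conjunct2, THEN conjunct2, THEN conjunct1] P[THEN conjunct2, THEN conjunct2, THEN conjunct2, THEN conjunct2, THEN conjunct2, THEN conjunct2, THEN conjunct2, THEN conjunct2]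
  obtain hi where hi: "\<And>x. x \<in> K \<Longrightarrow> g x \<le> hi" using bg(1) unfolding bdd_above_def by blast
  obtain lo where lo: "\<And>x. x \<in> K \<Longrightarrow> lo \<le> g x" using bg(2) unfolding bdd_below_def by blast
  obtain L where L: "\<And>x. x \<in> K \<Longrightarrow> norm (G x) \<le> L" using bG unfolding bdd_above_def by blast
  note cut' = cut[unfolded cutoff_def, THEN conjunct2]
  obtain \<phi>' where \<phi>': "\<forall>s\<ge>0. (\<phi> has_real_derivative \<phi>' s) (at s within {0..})"
    using cut'[THEN conjunct2, THEN conjunct1] by (elim exE conjE) (rule that)
  have convK: "convex K" by (simp add: K)
  have glip: "\<bar>g x - g y\<bar> \<le> L * norm (x - y)" if "x \<in> K" "y \<in> K" for x y
  proof -
    have "norm (g x - g y) \<le> L * norm (x - y)"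
    proof (rule differentiable_bound[OF convK _ _ that])
      fix z assume z: "z \<in> K"
      show "(g has_derivative (\<lambda>h. G z \<bullet> h)) (at z within K)"
        using has_derivative_at_withinI[OF U] KU z by blast
      have "onorm (\<lambda>h. G z \<bullet> h) \<le> norm (G z)" by (rule onorm_le) (simp add: Cauchy_Schwarz_ineq2)
      then show "onorm (\<lambda>h. G z \<bullet> h) \<le> L" using L[OF z] by linarith
    qed
    then show ?thesis by simp
  qed
  have "tube K g \<phi> r (exp (- hi)) (exp (- lo)) (exp (- lo) * L)"
  proof
    show "compact K" by (simp add: K)
    show "0 < r" by (rule r)
    show "x \<in> K" if "m \<in> M\<^sub>\<Omega>" "dist x m \<le> 3 * r" for m x
    proof -
      have "dist z\<^sub>0 m \<le> R\<^sub>0" using that M by auto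
      then show ?thesis using dist_triangle[of z\<^sub>0 x m] that by (simp add: K dist_commute)
    qed
    show "continuous_on K g"
    proof (intro continuous_at_imp_continuous_on ballI)
      fix x assume "x \<in> K"
      then have "x \<in> U" using KU by blast
      then show "isCont g x" by (rule has_derivative_continuous[OF U])
    qed
    show "exp (- hi) \<le> exp (- g x)" "exp (- g x) \<le> exp (- lo)" if "x \<in> K" for x using hi lo that by auto
    show "0 < exp (- hi)" by simp
    show "\<bar>exp (- g x) - exp (- g y)\<bar> \<le> exp (- lo) * L * norm (x - y)" if "x \<in> K" "y \<in> K" for x y
    proof -
      have "\<bar>exp (- g x) - exp (- g y)\<bar> \<le> exp (- lo) * \<bar>g x - g y\<bar>" using lo that by (intro exp_lipschitz) auto
      also have "\<dots> \<le> exp (- lo) * (L * norm (x - y))" using glip[OF that] by (intro mult_left_mono) auto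
      finally show ?thesis by simp
    qed
    show "continuous_on {0..} \<phi>"
      unfolding continuous_on_eq_continuous_within using \<phi>' by (auto intro: DERIV_continuous)
    show "mono_on {0..} \<phi>" by (rule cut'[THEN conjunct1])
    show "\<phi> s = s" if "0 \<le> s" "s \<le> r^2" for s
      using cut'[THEN conjunct2, THEN conjunct2, THEN conjunct1] that by blast
  qed
  then show ?thesis by blast
qed

lemma straight_edges:
  assumes "e \<in> {-1, 1::real}"
  shows "closed_segment (vector [-2, 2 * e]) (vector [2, 2 * e]) \<subseteq> M\<^sub>\<Omega>"
    "closed_segment (vector [3 * e, -1]) (vector [3 * e, 1]) \<subseteq> M\<^sub>\<Omega>"
proof -
  have *: "vector [x, 2 * e] \<in> M\<^sub>\<Omega>" if "\<bar>x\<bar> \<le> 2" for x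
    using that assms by (auto simp: M_eq FF_def qq_abs)
  have **: "vector [3 * e, y] \<in> M\<^sub>\<Omega>" if "\<bar>y\<bar> \<le> 1" for y
    using that assms by (auto simp: M_eq FF_def qq_abs)
  show "closed_segment (vector [-2, 2 * e]) (vector [2, 2 * e]) \<subseteq> M\<^sub>\<Omega>"
  proof
    fix p :: "real^2" assume "p \<in> closed_segment (vector [-2, 2 * e]) (vector [2, 2 * e])"
    then obtain u where u: "0 \<le> u" "u \<le> 1" "p = (1 - u) *\<^sub>R vector [-2, 2 * e] + u *\<^sub>R vector [2, 2 * e]"
      unfolding closed_segment_def by blast
    then have "p = vector [4 * u - 2, 2 * e]" by (simp add: vec_eq_iff forall_2 algebra_simps)
    then show "p \<in> M\<^sub>\<Omega>" using *[of "4 * u - 2"] u by (simp add: abs_le_iff)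
  qed
  show "closed_segment (vector [3 * e, -1]) (vector [3 * e, 1]) \<subseteq> M\<^sub>\<Omega>"
  proof
    fix p :: "real^2" assume "p \<in> closed_segment (vector [3 * e, -1]) (vector [3 * e, 1])"
    then obtain u where u: "0 \<le> u" "u \<le> 1" "p = (1 - u) *\<^sub>R vector [3 * e, -1] + u *\<^sub>R vector [3 * e, 1]"
      unfolding closed_segment_def by blast
    then have "p = vector [3 * e, 2 * u - 1]" by (simp add: vec_eq_iff forall_2 algebra_simps)
    then show "p \<in> M\<^sub>\<Omega>" using **[of "2 * u - 1"] u by (simp add: abs_le_iff)
  qed
qed

lemma reconstruction_bounds:
  assumes "M\<^sub>\<Omega> \<subseteq> cball z\<^sub>0 R\<^sub>0" "0 < r" "K = cball z\<^sub>0 (R\<^sub>0 + 3 * r)" "cutoff r \<phi>" "potential K g" and \<eta>: "0 < \<eta>" "\<eta> < 1/3"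
  shows "\<exists>c\<^sub>1>0. \<exists>c\<^sub>2>0. \<exists>c\<^sub>3>0. \<exists>C>0. \<exists>t\<^sub>0>0. \<forall>t X.
           0 < t \<and> t < t\<^sub>0 \<and> finite X \<and> X \<noteq> {} \<and> X \<subseteq> M\<^sub>\<Omega> \<and>
           hausdorff_dist X M\<^sub>\<Omega> \<le> \<eta> * t
           \<longrightarrow>
           (let A = Conv t X; \<Delta> = hausdorff_dist A M\<^sub>\<Omega> in
              c\<^sub>1 * t\<^sup>2 \<le> \<Delta> \<and> \<Delta> \<le> C * t\<^sup>2 \<and>
              (INF \<kappa>\<in>{0<..}. W2 (penalized_law K g \<phi> A \<kappa>) (target_law g M\<^sub>\<Omega>)) \<ge> c\<^sub>2 * t \<and>
              c\<^sub>2 * t \<ge> c\<^sub>3 * sqrt \<Delta>)"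
proof -
  obtain E0 E1 \<Lambda> where "tube K g \<phi> r E0 E1 \<Lambda>" using tube_exists[OF assms(1-5)] by blast
  then interpret tube K g \<phi> r E0 E1 \<Lambda> .
  obtain c1 c2 t0 where c: "0 < c1" "0 < c2" "0 < t0"
    and main: "\<forall>t X. 0 < t \<and> t < t0 \<and> finite X \<and> X \<noteq> {} \<and> X \<subseteq> M\<^sub>\<Omega> \<and>
      (\<forall>y\<in>M\<^sub>\<Omega>. \<exists>x\<in>X. dist y x \<le> \<eta> * t) \<longrightarrow>
      t \<le> 1/20000 \<and> c1 * t^2 \<le> hausdorff_dist (Conv t X) M\<^sub>\<Omega> \<and>
      (\<forall>\<kappa>>0. c2 * t \<le> W2 (penalized_law K g \<phi> (Conv t X) \<kappa>) (target_law g M\<^sub>\<Omega>))"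
    using asymptotics[OF \<eta>] by (elim exE conjE) (rule that)
  have bounds: "let A = Conv t X; \<Delta> = hausdorff_dist A M\<^sub>\<Omega> in
              c1 * t\<^sup>2 \<le> \<Delta> \<and> \<Delta> \<le> 62208 * t\<^sup>2 \<and>
              (INF \<kappa>\<in>{0<..}. W2 (penalized_law K g \<phi> A \<kappa>) (target_law g M\<^sub>\<Omega>)) \<ge> c2 * t \<and>
              c2 * t \<ge> c2 / sqrt 62208 * sqrt \<Delta>"
    if h: "0 < t \<and> t < t0 \<and> finite X \<and> X \<noteq> {} \<and> X \<subseteq> M\<^sub>\<Omega> \<and> hausdorff_dist X M\<^sub>\<Omega> \<le> \<eta> * t" for t X
  proof -
    have S: "\<exists>x\<in>X. dist y x \<le> \<eta> * t" if "y \<in> M\<^sub>\<Omega>" for y using sample_point[of X "\<eta> * t" y] h that by blast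
    have "0 < t \<and> t < t0 \<and> finite X \<and> X \<noteq> {} \<and> X \<subseteq> M\<^sub>\<Omega> \<and> (\<forall>y\<in>M\<^sub>\<Omega>. \<exists>x\<in>X. dist y x \<le> \<eta> * t)"
      using h S by blast
    from mp[OF spec[OF spec[OF main]] this]
    have m: "t \<le> 1/20000" "c1 * t^2 \<le> hausdorff_dist (Conv t X) M\<^sub>\<Omega>"
      "\<And>\<kappa>. 0 < \<kappa> \<Longrightarrow> c2 * t \<le> W2 (penalized_law K g \<phi> (Conv t X) \<kappa>) (target_law g M\<^sub>\<Omega>)"
      by blast+
    have up: "hausdorff_dist (Conv t X) M\<^sub>\<Omega> \<le> 62208 * t^2"
      using hausdorff_Conv_le[of X \<eta> t] S h \<eta> m(1) by blast
    \<comment> \<open>The second form of the lower bound is the first one combined with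
      \<open>\<Delta> \<le> 62208 * t^2\<close>.\<close>
    have "sqrt (hausdorff_dist (Conv t X) M\<^sub>\<Omega>) \<le> sqrt 62208 * t"
      using real_sqrt_le_mono[OF up] h by (simp add: real_sqrt_mult)
    then have "c2 / sqrt 62208 * sqrt (hausdorff_dist (Conv t X) M\<^sub>\<Omega>) \<le> c2 / sqrt 62208 * (sqrt 62208 * t)"
      using c by (intro mult_left_mono) auto
    then have "c2 / sqrt 62208 * sqrt (hausdorff_dist (Conv t X) M\<^sub>\<Omega>) \<le> c2 * t" by simp
    moreover have "c2 * t \<le> (INF \<kappa>\<in>{0<..}. W2 (penalized_law K g \<phi> (Conv t X) \<kappa>) (target_law g M\<^sub>\<Omega>))"
      using m(3) by (intro cINF_greatest) auto
    ultimately show ?thesis using m(2) up by (simp only: Let_def)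
  qed
  have "0 < c2 / sqrt 62208" "(0::real) < 62208" using c by simp_all
  then show ?thesis using c bounds by blast
qed

theorem theorem3:
  shows
    "compact Omega \<and> convex Omega \<and> interior Omega \<noteq> {} \<and>
     compact M\<^sub>\<Omega> \<and> connected M\<^sub>\<Omega> \<and> embedded_curve 2 M\<^sub>\<Omega> \<and> 0 < reach M\<^sub>\<Omega> \<and>
     (\<exists>z\<^sub>0 R\<^sub>0. M\<^sub>\<Omega> \<subseteq> cball z\<^sub>0 R\<^sub>0) \<and>
     (\<forall>e\<in>{-1, 1}.
        closed_segment (vector [-2, 2 * e]) (vector [2, 2 * e]) \<subseteq> M\<^sub>\<Omega> \<and>
        closed_segment (vector [3 * e, -1]) (vector [3 * e, 1]) \<subseteq> M\<^sub>\<Omega>) \<and>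
     (\<exists>\<gamma>. closed_curve_param 3 \<gamma> M\<^sub>\<Omega> \<and>
        (\<forall>e\<in>{-1, 1}. \<forall>f\<in>{-1, 1}. \<exists>a b k. a < b \<and> 0 < k \<and>
           (\<forall>s\<in>{a..b}. 2 < e * \<gamma> s $ 1 \<and> 1 < f * \<gamma> s $ 2 \<and> k \<le> curvature \<gamma> s))) \<and>
     (\<forall>(\<tau>\<^sub>0::real) (z\<^sub>0::real^2) (R\<^sub>0::real) (r::real) (\<phi>::real \<Rightarrow> real) (g::real^2 \<Rightarrow> real) (\<eta>::real) K.
        0 < \<tau>\<^sub>0 \<and> ereal \<tau>\<^sub>0 \<le> reach M\<^sub>\<Omega> \<and> 0 < R\<^sub>0 \<and> M\<^sub>\<Omega> \<subseteq> cball z\<^sub>0 R\<^sub>0 \<and>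
        0 < 2 * r \<and> 2 * r < \<tau>\<^sub>0 \<and> K = cball z\<^sub>0 (R\<^sub>0 + 3 * r) \<and>
        cutoff r \<phi> \<and> potential K g \<and> 0 < \<eta> \<and> \<eta> < 1 / 3
        \<longrightarrow>
        (\<exists>c\<^sub>1>0. \<exists>c\<^sub>2>0. \<exists>c\<^sub>3>0. \<exists>C>0. \<exists>t\<^sub>0>0. \<forall>t X.
           0 < t \<and> t < t\<^sub>0 \<and> finite X \<and> X \<noteq> {} \<and> X \<subseteq> M\<^sub>\<Omega> \<and>
           hausdorff_dist X M\<^sub>\<Omega> \<le> \<eta> * t
           \<longrightarrow>
           (let A = Conv t X; \<Delta> = hausdorff_dist A M\<^sub>\<Omega> in
              c\<^sub>1 * t\<^sup>2 \<le> \<Delta> \<and> \<Delta> \<le> C * t\<^sup>2 \<and>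
              (INF \<kappa>\<in>{0<..}. W2 (penalized_law K g \<phi> A \<kappa>) (target_law g M\<^sub>\<Omega>)) \<ge> c\<^sub>2 * t \<and>
              c\<^sub>2 * t \<ge> c\<^sub>3 * sqrt \<Delta>)))"
proof (intro conjI)
  show "compact Omega" by (rule compact_Omega)
  show "convex Omega" by (rule convex_Omega)
  show "interior Omega \<noteq> {}" using FF_0 by (auto simp: interior_Omega intro!: exI[of _ 0])
  show "compact M\<^sub>\<Omega>" by (rule compact_M)
  show "connected M\<^sub>\<Omega>" by (rule connected_M)
  show "embedded_curve 2 M\<^sub>\<Omega>"
    using closed_curve_embedded[OF closed_curve_param_mono[OF gam_param, of 2]] by simp
  show "0 < reach M\<^sub>\<Omega>" by (rule reach_M_pos)
  show "\<exists>z\<^sub>0 R\<^sub>0. M\<^sub>\<Omega> \<subseteq> cball z\<^sub>0 R\<^sub>0"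
    using M_bounds(3) by (intro exI[of _ 0] exI[of _ 4]) auto
  show "\<forall>e\<in>{-1, 1}.
        closed_segment (vector [-2, 2 * e]) (vector [2, 2 * e]) \<subseteq> M\<^sub>\<Omega> \<and>
        closed_segment (vector [3 * e, -1]) (vector [3 * e, 1]) \<subseteq> M\<^sub>\<Omega>"
    using straight_edges by blast
  show "\<exists>\<gamma>. closed_curve_param 3 \<gamma> M\<^sub>\<Omega> \<and>
        (\<forall>e\<in>{-1, 1}. \<forall>f\<in>{-1, 1}. \<exists>a b k. a < b \<and> 0 < k \<and>
           (\<forall>s\<in>{a..b}. 2 < e * \<gamma> s $ 1 \<and> 1 < f * \<gamma> s $ 2 \<and> k \<le> curvature \<gamma> s))"
    using gam_param gam_corner_curvature by blast
qed (intro allI impI; elim conjE; rule reconstruction_bounds; assumption?; simp)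

end
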